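(* Let $\mathcal{C}$ be a semi-abelian category satisfying the following properties: (1) for every object $B$, the kernel functor $\mathrm{Ker}_B\colon \mathrm{Pt}_{B}(\mathcal{C})\to \mathcal{C}$ preserves jointly strongly epimorphic pairs; (2) for every object $B$, the kernel functor $\mathrm{Ker}_B\colon \mathrm{Pt}_{B}(\mathcal{C})\to \mathcal{C}$ preserves cokernels. If $H$ and $K$ are characteristic subobjects of an object $G$ of $\mathcal{C}$, then the Huq commutator $[H,K]_G$ is a characteristic subobject of $G$.
   Context: For an object $B$ of a pointed category $\mathcal{C}$ with finite limits and finite coproducts, let $\mathrm{Pt}_B(\mathcal{C})$ be the category of points over $B$: objects are split epimorphisms $(A,p,s)$ with $p\colon A\to B$, $s\colon B\to A$, $ps=1_B$; morphisms $(A,p,s)\to(A',p',s')$ are arrows $f\colon A\to A'$ with $p'f=p$, $fs=s'$. This category is pointed, with zero object $(B,1_B,1_B)$. The functor $\mathrm{Ker}_B\colon \mathrm{Pt}_B(\mathcal{C})\to\mathcal{C}$, $(A,p,s)\mapsto \mathrm{Ker}(p)$, is right adjoint to $B+(-)$, which sends $X$ to the point $(B+X,[1,0],\iota_B)$. The induced monad on $\mathcal{C}$ is denoted $B\flat(-)$, so that $B\flat X$ is the kernel of $[1,0]\colon B+X\to B$. An (internal) action of $B$ on $X$ is an algebra $\xi\colon B\flat X\to X$ for this monad. A subobject $h\colon H\rightarrowtail G$ is called characteristic in $G$ if for every object $B$ and every action $\xi\colon B\flat G\to G$ there exists a (unique) action $\overline{\xi}\colon B\flat H\to H$ with $h\,\overline{\xi}=\xi\,(1_B\flat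 h)$. A pair of arrows with common codomain is jointly strongly epimorphic if it does not factor through any proper subobject of the codomain. Given subobjects $h\colon H\rightarrowtail G$ and $k\colon K\rightarrowtail G$, let $\Sigma_{H,K}=\langle[1,0],[0,1]\rangle\colon H+K\to H\times K$ be the canonical map. The Huq commutator $[H,K]_G$ is the kernel of $\pi\colon G\to Q$, where $\pi$ is the pushout of $\Sigma_{H,K}$ along $[h,k]\colon H+K\to G$. *)

theory Defs
  imports Main
begin

section \<open>Categories and functors\<close>

record ('o, 'a) cat =
  Obj :: "'o set"
  Arr :: "'a set"
  Dom :: "'a \<Rightarrow> 'o"
  Cod :: "'a \<Rightarrow> 'o"
  Id :: "'o \<Rightarrow> 'a"
  Comp :: "'a \<Rightarrow> 'a \<Rightarrow> 'a"  (infixl "\<cdot>\<index>" 70)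

definition hom :: "('o, 'a) cat \<Rightarrow> 'o \<Rightarrow> 'o \<Rightarrow> 'a set" where
  "hom C X Y = {f \<in> Arr C. Dom C f = X \<and> Cod C f = Y}"

locale category =
  fixes C :: "('o, 'a) cat" (structure)
  assumes Dom_Obj: "f \<in> Arr C \<Longrightarrow> Dom C f \<in> Obj C"
    and Cod_Obj: "f \<in> Arr C \<Longrightarrow> Cod C f \<in> Obj C"
    and Id_hom: "X \<in> Obj C \<Longrightarrow> Id C X \<in> hom C X X"
    and Comp_hom: "f \<in> hom C X Y \<Longrightarrow> g \<in> hom C Y Z \<Longrightarrow> g \<cdot> f \<in> hom C X Z"
    and Comp_Id_left: "f \<in> hom C X Y \<Longrightarrow> Id C Y \<cdot> f = f"
    and Comp_Id_right: "f \<in> hom C X Y \<Longrightarrow> f \<cdot> Id C X = f"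
    and Comp_assoc: "f \<in> hom C W X \<Longrightarrow> g \<in> hom C X Y \<Longrightarrow> h \<in> hom C Y Z
                       \<Longrightarrow> h \<cdot> (g \<cdot> f) = h \<cdot> g \<cdot> f"

record ('o, 'a, 'p, 'b) cat_fun =
  fobj :: "'o \<Rightarrow> 'p"
  farr :: "'a \<Rightarrow> 'b"

definition is_functor ::
  "('o, 'a) cat \<Rightarrow> ('p, 'b) cat \<Rightarrow> ('o, 'a, 'p, 'b) cat_fun \<Rightarrow> bool" where
  "is_functor C D F \<longleftrightarrow> category C \<and> category D \<and>
     (\<forall>X\<in>Obj C. fobj F X \<in> Obj D) \<and>
     (\<forall>f\<in>Arr C. farr F f \<in> hom D (fobj F (Dom C f)) (fobj F (Cod C f))) \<and>
     (\<forall>X\<in>Obj C. farr F (Id C X) = Id D (fobj F X)) \<and>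
     (\<forall>f\<in>Arr C. \<forall>g\<in>Arr C. Cod C f = Dom C g \<longrightarrow>
        farr F (g \<cdot>\<^bsub>C\<^esub> f) = farr F g \<cdot>\<^bsub>D\<^esub> farr F f)"

definition fun_comp ::
  "('p, 'b, 'q, 'c) cat_fun \<Rightarrow> ('o, 'a, 'p, 'b) cat_fun \<Rightarrow> ('o, 'a, 'q, 'c) cat_fun" where
  "fun_comp G F = \<lparr>fobj = \<lambda>X. fobj G (fobj F X), farr = \<lambda>f. farr G (farr F f)\<rparr>"

definition is_mono :: "('o, 'a) cat \<Rightarrow> 'a \<Rightarrow> bool" where
  "is_mono C m \<longleftrightarrow> m \<in> Arr C \<and>
     (\<forall>W. \<forall>u\<in>hom C W (Dom C m). \<forall>v\<in>hom C W (Dom C m).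
        m \<cdot>\<^bsub>C\<^esub> u = m \<cdot>\<^bsub>C\<^esub> v \<longrightarrow> u = v)"

definition is_iso :: "('o, 'a) cat \<Rightarrow> 'a \<Rightarrow> bool" where
  "is_iso C f \<longleftrightarrow> f \<in> Arr C \<and>
     (\<exists>g\<in>hom C (Cod C f) (Dom C f).
        g \<cdot>\<^bsub>C\<^esub> f = Id C (Dom C f) \<and> f \<cdot>\<^bsub>C\<^esub> g = Id C (Cod C f))"

definition reflects_isos ::
  "('o, 'a) cat \<Rightarrow> ('p, 'b) cat \<Rightarrow> ('o, 'a, 'p, 'b) cat_fun \<Rightarrow> bool" where
  "reflects_isos C D F \<longleftrightarrow> (\<forall>f\<in>Arr C. is_iso D (farr F f) \<longrightarrow> is_iso C f)"


section \<open>Limits and colimits\<close>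

definition is_cone ::
  "('j, 'u) cat \<Rightarrow> ('o, 'a) cat \<Rightarrow> ('j, 'u, 'o, 'a) cat_fun \<Rightarrow> 'o \<Rightarrow> ('j \<Rightarrow> 'a) \<Rightarrow> bool" where
  "is_cone J C D L lam \<longleftrightarrow> L \<in> Obj C \<and> (\<forall>j\<in>Obj J. lam j \<in> hom C L (fobj D j)) \<and>
     (\<forall>u\<in>Arr J. farr D u \<cdot>\<^bsub>C\<^esub> lam (Dom J u) = lam (Cod J u))"

definition is_limit ::
  "('j, 'u) cat \<Rightarrow> ('o, 'a) cat \<Rightarrow> ('j, 'u, 'o, 'a) cat_fun \<Rightarrow> 'o \<Rightarrow> ('j \<Rightarrow> 'a) \<Rightarrow> bool" where
  "is_limit J C D L lam \<longleftrightarrow> is_cone J C D L lam \<and>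
     (\<forall>M mu. is_cone J C D M mu \<longrightarrow>
        (\<exists>!t. t \<in> hom C M L \<and> (\<forall>j\<in>Obj J. lam j \<cdot>\<^bsub>C\<^esub> t = mu j)))"

text \<open>Every finite category is isomorphic to one whose objects and arrows are natural numbers,
  so quantifying over index categories of type \<^typ>\<open>(nat, nat) cat\<close> covers all finite diagrams.\<close>

definition has_finite_limits :: "('o, 'a) cat \<Rightarrow> bool" where
  "has_finite_limits C \<longleftrightarrow>
     (\<forall>(J :: (nat, nat) cat) D. finite (Obj J) \<and> finite (Arr J) \<and> is_functor J C D \<longrightarrow>
        (\<exists>L lam. is_limit J C D L lam))"

definition is_zero_obj :: "('o, 'a) cat \<Rightarrow> 'o \<Rightarrow> bool" where
  "is_zero_obj C Z \<longleftrightarrow> Z \<in> Obj C \<and>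
     (\<forall>X\<in>Obj C. (\<exists>!f. f \<in> hom C X Z) \<and> (\<exists>!f. f \<in> hom C Z X))"

definition pointed :: "('o, 'a) cat \<Rightarrow> bool" where
  "pointed C \<longleftrightarrow> (\<exists>Z. is_zero_obj C Z)"

definition zero_arr :: "('o, 'a) cat \<Rightarrow> 'o \<Rightarrow> 'o \<Rightarrow> 'a" where
  "zero_arr C X Y = (THE f. \<exists>Z u v. is_zero_obj C Z \<and> u \<in> hom C X Z \<and> v \<in> hom C Z Y \<and>
     f = v \<cdot>\<^bsub>C\<^esub> u)"

definition is_product :: "('o, 'a) cat \<Rightarrow> 'o \<Rightarrow> 'o \<Rightarrow> 'a \<Rightarrow> 'a \<Rightarrow> bool" where
  "is_product C X Y p q \<longleftrightarrow> p \<in> hom C (Dom C p) X \<and> q \<in> hom C (Dom C p) Y \<and>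
     (\<forall>W. \<forall>u\<in>hom C W X. \<forall>v\<in>hom C W Y.
        \<exists>!t. t \<in> hom C W (Dom C p) \<and> p \<cdot>\<^bsub>C\<^esub> t = u \<and> q \<cdot>\<^bsub>C\<^esub> t = v)"

definition is_coproduct :: "('o, 'a) cat \<Rightarrow> 'o \<Rightarrow> 'o \<Rightarrow> 'a \<Rightarrow> 'a \<Rightarrow> bool" where
  "is_coproduct C X Y i j \<longleftrightarrow> i \<in> hom C X (Cod C i) \<and> j \<in> hom C Y (Cod C i) \<and>
     (\<forall>W. \<forall>u\<in>hom C X W. \<forall>v\<in>hom C Y W.
        \<exists>!t. t \<in> hom C (Cod C i) W \<and> t \<cdot>\<^bsub>C\<^esub> i = u \<and> t \<cdot>\<^bsub>C\<^esub> j = v)"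

definition has_binary_coproducts :: "('o, 'a) cat \<Rightarrow> bool" where
  "has_binary_coproducts C \<longleftrightarrow> (\<forall>X\<in>Obj C. \<forall>Y\<in>Obj C. \<exists>i j. is_coproduct C X Y i j)"

text \<open>\<open>is_pullback C f g p q\<close>: the square \<open>f \<cdot> p = g \<cdot> q\<close> is a pullback.\<close>

definition is_pullback :: "('o, 'a) cat \<Rightarrow> 'a \<Rightarrow> 'a \<Rightarrow> 'a \<Rightarrow> 'a \<Rightarrow> bool" where
  "is_pullback C f g p q \<longleftrightarrow> f \<in> Arr C \<and> g \<in> Arr C \<and> Cod C f = Cod C g \<and>
     p \<in> hom C (Dom C p) (Dom C f) \<and> q \<in> hom C (Dom C p) (Dom C g) \<and>
     f \<cdot>\<^bsub>C\<^esub> p = g \<cdot>\<^bsub>C\<^esub> q \<and>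
     (\<forall>W. \<forall>u\<in>hom C W (Dom C f). \<forall>v\<in>hom C W (Dom C g). f \<cdot>\<^bsub>C\<^esub> u = g \<cdot>\<^bsub>C\<^esub> v \<longrightarrow>
        (\<exists>!t. t \<in> hom C W (Dom C p) \<and> p \<cdot>\<^bsub>C\<^esub> t = u \<and> q \<cdot>\<^bsub>C\<^esub> t = v))"

text \<open>\<open>is_pushout C f g i j\<close>: the square \<open>i \<cdot> f = j \<cdot> g\<close> is a pushout.\<close>

definition is_pushout :: "('o, 'a) cat \<Rightarrow> 'a \<Rightarrow> 'a \<Rightarrow> 'a \<Rightarrow> 'a \<Rightarrow> bool" where
  "is_pushout C f g i j \<longleftrightarrow> f \<in> Arr C \<and> g \<in> Arr C \<and> Dom C f = Dom C g \<and>
     i \<in> hom C (Cod C f) (Cod C i) \<and> j \<in> hom C (Cod C g) (Cod C i) \<and>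
     i \<cdot>\<^bsub>C\<^esub> f = j \<cdot>\<^bsub>C\<^esub> g \<and>
     (\<forall>W. \<forall>u\<in>hom C (Cod C f) W. \<forall>v\<in>hom C (Cod C g) W. u \<cdot>\<^bsub>C\<^esub> f = v \<cdot>\<^bsub>C\<^esub> g \<longrightarrow>
        (\<exists>!t. t \<in> hom C (Cod C i) W \<and> t \<cdot>\<^bsub>C\<^esub> i = u \<and> t \<cdot>\<^bsub>C\<^esub> j = v))"

definition is_coequalizer :: "('o, 'a) cat \<Rightarrow> 'a \<Rightarrow> 'a \<Rightarrow> 'a \<Rightarrow> bool" where
  "is_coequalizer C f g e \<longleftrightarrow> f \<in> Arr C \<and> g \<in> Arr C \<and> Dom C f = Dom C g \<and> Cod C f = Cod C g \<and>
     e \<in> hom C (Cod C f) (Cod C e) \<and> e \<cdot>\<^bsub>C\<^esub> f = e \<cdot>\<^bsub>C\<^esub> g \<and>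
     (\<forall>W. \<forall>u\<in>hom C (Cod C f) W. u \<cdot>\<^bsub>C\<^esub> f = u \<cdot>\<^bsub>C\<^esub> g \<longrightarrow>
        (\<exists>!t. t \<in> hom C (Cod C e) W \<and> t \<cdot>\<^bsub>C\<^esub> e = u))"

definition is_kernel :: "('o, 'a) cat \<Rightarrow> 'a \<Rightarrow> 'a \<Rightarrow> bool" where
  "is_kernel C f k \<longleftrightarrow> f \<in> Arr C \<and> k \<in> hom C (Dom C k) (Dom C f) \<and>
     f \<cdot>\<^bsub>C\<^esub> k = zero_arr C (Dom C k) (Cod C f) \<and>
     (\<forall>W. \<forall>u\<in>hom C W (Dom C f). f \<cdot>\<^bsub>C\<^esub> u = zero_arr C W (Cod C f) \<longrightarrow>
        (\<exists>!t. t \<in> hom C W (Dom C k) \<and> k \<cdot>\<^bsub>C\<^esub> t = u))"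

definition is_cokernel :: "('o, 'a) cat \<Rightarrow> 'a \<Rightarrow> 'a \<Rightarrow> bool" where
  "is_cokernel C f q \<longleftrightarrow> f \<in> Arr C \<and> q \<in> hom C (Cod C f) (Cod C q) \<and>
     q \<cdot>\<^bsub>C\<^esub> f = zero_arr C (Dom C f) (Cod C q) \<and>
     (\<forall>W. \<forall>u\<in>hom C (Cod C f) W. u \<cdot>\<^bsub>C\<^esub> f = zero_arr C (Dom C f) W \<longrightarrow>
        (\<exists>!t. t \<in> hom C (Cod C q) W \<and> t \<cdot>\<^bsub>C\<^esub> q = u))"


subsection \<open>Chosen (co)limits\<close>

text \<open>Kernel functors, coproduct functors etc. depend on a choice of the (co)limits involved;
  it is made once and for all by Hilbert choice.\<close>

definition prd :: "('o, 'a) cat \<Rightarrow> 'o \<Rightarrow> 'o \<Rightarrow> 'a \<times> 'a" where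
  "prd C X Y = (SOME (p, q). is_product C X Y p q)"

definition prod_obj :: "('o, 'a) cat \<Rightarrow> 'o \<Rightarrow> 'o \<Rightarrow> 'o" where
  "prod_obj C X Y = Dom C (fst (prd C X Y))"

definition pair :: "('o, 'a) cat \<Rightarrow> 'a \<Rightarrow> 'a \<Rightarrow> 'a" where
  "pair C u v = (THE t. t \<in> hom C (Dom C u) (prod_obj C (Cod C u) (Cod C v)) \<and>
     fst (prd C (Cod C u) (Cod C v)) \<cdot>\<^bsub>C\<^esub> t = u \<and>
     snd (prd C (Cod C u) (Cod C v)) \<cdot>\<^bsub>C\<^esub> t = v)"

definition coprd :: "('o, 'a) cat \<Rightarrow> 'o \<Rightarrow> 'o \<Rightarrow> 'a \<times> 'a" where
  "coprd C X Y = (SOME (i, j). is_coproduct C X Y i j)"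

definition inl :: "('o, 'a) cat \<Rightarrow> 'o \<Rightarrow> 'o \<Rightarrow> 'a" where
  "inl C X Y = fst (coprd C X Y)"

definition inr :: "('o, 'a) cat \<Rightarrow> 'o \<Rightarrow> 'o \<Rightarrow> 'a" where
  "inr C X Y = snd (coprd C X Y)"

definition coprod_obj :: "('o, 'a) cat \<Rightarrow> 'o \<Rightarrow> 'o \<Rightarrow> 'o" where
  "coprod_obj C X Y = Cod C (inl C X Y)"

definition copair :: "('o, 'a) cat \<Rightarrow> 'a \<Rightarrow> 'a \<Rightarrow> 'a" where
  "copair C u v = (THE t. t \<in> hom C (coprod_obj C (Dom C u) (Dom C v)) (Cod C u) \<and>
     t \<cdot>\<^bsub>C\<^esub> inl C (Dom C u) (Dom C v) = u \<and> t \<cdot>\<^bsub>C\<^esub> inr C (Dom C u) (Dom C v) = v)"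

definition ker :: "('o, 'a) cat \<Rightarrow> 'a \<Rightarrow> 'a" where
  "ker C f = (SOME k. is_kernel C f k)"

definition pb :: "('o, 'a) cat \<Rightarrow> 'a \<Rightarrow> 'a \<Rightarrow> 'a \<times> 'a" where
  "pb C f g = (SOME (p, q). is_pullback C f g p q)"


section \<open>The category of points\<close>

text \<open>An arrow of \<open>Pt C B\<close> is recorded together with its domain and codomain points, since
  the underlying arrow of \<open>C\<close> does not determine them.\<close>

definition Pt_Obj :: "('o, 'a) cat \<Rightarrow> 'o \<Rightarrow> ('o \<times> 'a \<times> 'a) set" where
  "Pt_Obj C B = {(A, p, s). p \<in> hom C A B \<and> s \<in> hom C B A \<and> p \<cdot>\<^bsub>C\<^esub> s = Id C B}"

definition Pt_Arr ::
  "('o, 'a) cat \<Rightarrow> 'o \<Rightarrow> (('o \<times> 'a \<times> 'a) \<times> 'a \<times> ('o \<times> 'a \<times> 'a)) set" where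
  "Pt_Arr C B = {((A, p, s), f, (A', p', s')).
     (A, p, s) \<in> Pt_Obj C B \<and> (A', p', s') \<in> Pt_Obj C B \<and> f \<in> hom C A A' \<and>
     p' \<cdot>\<^bsub>C\<^esub> f = p \<and> f \<cdot>\<^bsub>C\<^esub> s = s'}"

definition Pt ::
  "('o, 'a) cat \<Rightarrow> 'o \<Rightarrow> ('o \<times> 'a \<times> 'a, ('o \<times> 'a \<times> 'a) \<times> 'a \<times> ('o \<times> 'a \<times> 'a)) cat" where
  "Pt C B = \<lparr>Obj = Pt_Obj C B, Arr = Pt_Arr C B,
     Dom = (\<lambda>(x, f, y). x), Cod = (\<lambda>(x, f, y). y),
     Id = (\<lambda>x. (x, Id C (fst x), x)),
     Comp = (\<lambda>(y, g, z) (x, f, y'). (x, g \<cdot>\<^bsub>C\<^esub> f, z))\<rparr>"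

text \<open>Change of base along \<open>v : E \<rightarrow> B\<close>: a point \<open>(A, p, s)\<close> is sent to the pullback of \<open>p\<close>
  along \<open>v\<close>, with the section induced by \<open>s \<cdot> v\<close> and the identity of \<open>E\<close>.\<close>

definition change_base ::
  "('o, 'a) cat \<Rightarrow> 'a \<Rightarrow> ('o \<times> 'a \<times> 'a, ('o \<times> 'a \<times> 'a) \<times> 'a \<times> ('o \<times> 'a \<times> 'a),
     'o \<times> 'a \<times> 'a, ('o \<times> 'a \<times> 'a) \<times> 'a \<times> ('o \<times> 'a \<times> 'a)) cat_fun" where
  "change_base C v =
    (let E = Dom C v;
         pt = (\<lambda>(A, p, s). let (q, p') = pb C p v; P = Dom C q in
           (P, p', THE s'. s' \<in> hom C E P \<and> q \<cdot>\<^bsub>C\<^esub> s' = s \<cdot>\<^bsub>C\<^esub> v \<and> p' \<cdot>\<^bsub>C\<^esub> s' = Id C E))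
     in \<lparr>fobj = pt,
         farr = (\<lambda>((A1, p1, s1), f, (A2, p2, s2)).
           let (q1, p1') = pb C p1 v; (q2, p2') = pb C p2 v in
           (pt (A1, p1, s1),
            THE g. g \<in> hom C (Dom C q1) (Dom C q2) \<and>
              q2 \<cdot>\<^bsub>C\<^esub> g = f \<cdot>\<^bsub>C\<^esub> q1 \<and> p2' \<cdot>\<^bsub>C\<^esub> g = p1',
            pt (A2, p2, s2)))\<rparr>)"


section \<open>Semi-abelian categories\<close>

definition is_regular_epi :: "('o, 'a) cat \<Rightarrow> 'a \<Rightarrow> bool" where
  "is_regular_epi C e \<longleftrightarrow> (\<exists>f g. is_coequalizer C f g e)"

definition regular :: "('o, 'a) cat \<Rightarrow> bool" where
  "regular C \<longleftrightarrow> has_finite_limits C \<and>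
     (\<forall>f r1 r2. is_pullback C f f r1 r2 \<longrightarrow> (\<exists>e. is_coequalizer C r1 r2 e)) \<and>
     (\<forall>e g p q. is_regular_epi C e \<and> is_pullback C e g p q \<longrightarrow> is_regular_epi C q)"

definition is_equivalence_relation :: "('o, 'a) cat \<Rightarrow> 'o \<Rightarrow> 'a \<Rightarrow> 'a \<Rightarrow> bool" where
  "is_equivalence_relation C X r1 r2 \<longleftrightarrow>
     (let R = Dom C r1 in
       r1 \<in> hom C R X \<and> r2 \<in> hom C R X \<and>
       (\<forall>W. \<forall>u\<in>hom C W R. \<forall>v\<in>hom C W R.
          r1 \<cdot>\<^bsub>C\<^esub> u = r1 \<cdot>\<^bsub>C\<^esub> v \<and> r2 \<cdot>\<^bsub>C\<^esub> u = r2 \<cdot>\<^bsub>C\<^esub> v \<longrightarrow> u = v) \<and>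
       (\<exists>d\<in>hom C X R. r1 \<cdot>\<^bsub>C\<^esub> d = Id C X \<and> r2 \<cdot>\<^bsub>C\<^esub> d = Id C X) \<and>
       (\<exists>s\<in>hom C R R. r1 \<cdot>\<^bsub>C\<^esub> s = r2 \<and> r2 \<cdot>\<^bsub>C\<^esub> s = r1) \<and>
       (\<forall>q1 q2. is_pullback C r2 r1 q1 q2 \<longrightarrow>
          (\<exists>t\<in>hom C (Dom C q1) R.
             r1 \<cdot>\<^bsub>C\<^esub> t = r1 \<cdot>\<^bsub>C\<^esub> q1 \<and> r2 \<cdot>\<^bsub>C\<^esub> t = r2 \<cdot>\<^bsub>C\<^esub> q2)))"

definition barr_exact :: "('o, 'a) cat \<Rightarrow> bool" where
  "barr_exact C \<longleftrightarrow> regular C \<and>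
     (\<forall>X r1 r2. is_equivalence_relation C X r1 r2 \<longrightarrow> (\<exists>f. is_pullback C f f r1 r2))"

definition protomodular :: "('o, 'a) cat \<Rightarrow> bool" where
  "protomodular C \<longleftrightarrow>
     (\<forall>v\<in>Arr C. reflects_isos (Pt C (Cod C v)) (Pt C (Dom C v)) (change_base C v))"

definition semi_abelian :: "('o, 'a) cat \<Rightarrow> bool" where
  "semi_abelian C \<longleftrightarrow> category C \<and> pointed C \<and> has_binary_coproducts C \<and>
     barr_exact C \<and> protomodular C"


section \<open>Internal actions\<close>

definition Ker_fun :: "('o, 'a) cat \<Rightarrow> 'o \<Rightarrow>
    ('o \<times> 'a \<times> 'a, ('o \<times> 'a \<times> 'a) \<times> 'a \<times> ('o \<times> 'a \<times> 'a), 'o, 'a) cat_fun" where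
  "Ker_fun C B = \<lparr>fobj = (\<lambda>(A, p, s). Dom C (ker C p)),
     farr = (\<lambda>((A, p, s), f, (A', p', s')).
       THE g. g \<in> hom C (Dom C (ker C p)) (Dom C (ker C p')) \<and>
         ker C p' \<cdot>\<^bsub>C\<^esub> g = f \<cdot>\<^bsub>C\<^esub> ker C p)\<rparr>"

definition plus_pt :: "('o, 'a) cat \<Rightarrow> 'o \<Rightarrow> 'o \<Rightarrow> 'o \<times> 'a \<times> 'a" where
  "plus_pt C B X = (coprod_obj C B X, copair C (Id C B) (zero_arr C X B), inl C B X)"

definition plus_fun :: "('o, 'a) cat \<Rightarrow> 'o \<Rightarrow>
    ('o, 'a, 'o \<times> 'a \<times> 'a, ('o \<times> 'a \<times> 'a) \<times> 'a \<times> ('o \<times> 'a \<times> 'a)) cat_fun" where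
  "plus_fun C B = \<lparr>fobj = plus_pt C B,
     farr = (\<lambda>f. (plus_pt C B (Dom C f),
       copair C (inl C B (Cod C f)) (inr C B (Cod C f) \<cdot>\<^bsub>C\<^esub> f),
       plus_pt C B (Cod C f)))\<rparr>"

definition bflat :: "('o, 'a) cat \<Rightarrow> 'o \<Rightarrow> ('o, 'a, 'o, 'a) cat_fun" where
  "bflat C B = fun_comp (Ker_fun C B) (plus_fun C B)"

text \<open>The monad structure on \<open>bflat C B\<close> is the one induced by the adjunction between
  \<open>plus_fun C B\<close> and \<open>Ker_fun C B\<close>. Its unit at \<open>X\<close> is the corestriction of the coproduct
  inclusion of \<open>X\<close> to the kernel of \<open>[1, 0]\<close>; its counit at a point \<open>(A, p, s)\<close> is
  \<open>[s, ker p] : B + Ker p \<rightarrow> A\<close>; and the multiplication is the kernel functor applied to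
  the counit at \<open>B + X\<close>.\<close>

definition bflat_unit :: "('o, 'a) cat \<Rightarrow> 'o \<Rightarrow> 'o \<Rightarrow> 'a" where
  "bflat_unit C B X = (THE e. e \<in> hom C X (fobj (bflat C B) X) \<and>
     ker C (copair C (Id C B) (zero_arr C X B)) \<cdot>\<^bsub>C\<^esub> e = inr C B X)"

definition pt_counit :: "('o, 'a) cat \<Rightarrow> 'o \<Rightarrow> 'o \<times> 'a \<times> 'a \<Rightarrow>
    ('o \<times> 'a \<times> 'a) \<times> 'a \<times> ('o \<times> 'a \<times> 'a)" where
  "pt_counit C B = (\<lambda>(A, p, s).
     (fobj (plus_fun C B) (fobj (Ker_fun C B) (A, p, s)), copair C s (ker C p), (A, p, s)))"

definition bflat_mult :: "('o, 'a) cat \<Rightarrow> 'o \<Rightarrow> 'o \<Rightarrow> 'a" where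
  "bflat_mult C B X = farr (Ker_fun C B) (pt_counit C B (fobj (plus_fun C B) X))"

definition is_action :: "('o, 'a) cat \<Rightarrow> 'o \<Rightarrow> 'o \<Rightarrow> 'a \<Rightarrow> bool" where
  "is_action C B X xi \<longleftrightarrow> xi \<in> hom C (fobj (bflat C B) X) X \<and>
     xi \<cdot>\<^bsub>C\<^esub> bflat_unit C B X = Id C X \<and>
     xi \<cdot>\<^bsub>C\<^esub> bflat_mult C B X = xi \<cdot>\<^bsub>C\<^esub> farr (bflat C B) xi"


section \<open>Characteristic subobjects, jointly strongly epimorphic pairs, Huq commutators\<close>

text \<open>Subobjects are represented by monomorphisms.\<close>

definition is_subobject :: "('o, 'a) cat \<Rightarrow> 'o \<Rightarrow> 'a \<Rightarrow> bool" where
  "is_subobject C G h \<longleftrightarrow> is_mono C h \<and> Cod C h = G"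

definition characteristic :: "('o, 'a) cat \<Rightarrow> 'o \<Rightarrow> 'a \<Rightarrow> bool" where
  "characteristic C G h \<longleftrightarrow> is_subobject C G h \<and>
     (\<forall>B\<in>Obj C. \<forall>xi. is_action C B G xi \<longrightarrow>
        (\<exists>!xi'. is_action C B (Dom C h) xi' \<and>
           h \<cdot>\<^bsub>C\<^esub> xi' = xi \<cdot>\<^bsub>C\<^esub> farr (bflat C B) h))"

definition jointly_strongly_epi :: "('o, 'a) cat \<Rightarrow> 'a \<Rightarrow> 'a \<Rightarrow> bool" where
  "jointly_strongly_epi C f g \<longleftrightarrow> f \<in> Arr C \<and> g \<in> Arr C \<and> Cod C f = Cod C g \<and>
     (\<forall>m. is_subobject C (Cod C f) m \<and>
        (\<exists>f'\<in>hom C (Dom C f) (Dom C m). m \<cdot>\<^bsub>C\<^esub> f' = f) \<and>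
        (\<exists>g'\<in>hom C (Dom C g) (Dom C m). m \<cdot>\<^bsub>C\<^esub> g' = g) \<longrightarrow> is_iso C m)"

definition preserves_jointly_strongly_epi_pairs ::
  "('o, 'a) cat \<Rightarrow> ('p, 'b) cat \<Rightarrow> ('o, 'a, 'p, 'b) cat_fun \<Rightarrow> bool" where
  "preserves_jointly_strongly_epi_pairs C D F \<longleftrightarrow>
     (\<forall>f g. jointly_strongly_epi C f g \<longrightarrow> jointly_strongly_epi D (farr F f) (farr F g))"

definition preserves_cokernels ::
  "('o, 'a) cat \<Rightarrow> ('p, 'b) cat \<Rightarrow> ('o, 'a, 'p, 'b) cat_fun \<Rightarrow> bool" where
  "preserves_cokernels C D F \<longleftrightarrow>
     (\<forall>f q. is_cokernel C f q \<longrightarrow> is_cokernel D (farr F f) (farr F q))"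

definition Sigma_arr :: "('o, 'a) cat \<Rightarrow> 'o \<Rightarrow> 'o \<Rightarrow> 'a" where
  "Sigma_arr C H K = pair C (copair C (Id C H) (zero_arr C K H)) (copair C (zero_arr C H K) (Id C K))"

text \<open>\<open>l\<close> represents the Huq commutator of the subobjects \<open>h\<close> and \<open>k\<close> of \<open>G\<close>. Pushouts and
  kernels being determined up to isomorphism only, this is a relation.\<close>

definition is_huq_commutator :: "('o, 'a) cat \<Rightarrow> 'o \<Rightarrow> 'a \<Rightarrow> 'a \<Rightarrow> 'a \<Rightarrow> bool" where
  "is_huq_commutator C G h k l \<longleftrightarrow> is_subobject C G h \<and> is_subobject C G k \<and>
     (\<exists>\<pi> m. is_pushout C (copair C h k) (Sigma_arr C (Dom C h) (Dom C k)) \<pi> m \<and> is_kernel C \<pi> l)"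

end

theory Submission
  imports Defs
begin

text \<open>An action of \<open>B\<close> on \<open>G\<close> comes from a point \<open>A\<close> over \<open>B\<close> with kernel \<open>G\<close>, and characteristic
  subobjects \<open>H\<close>, \<open>K\<close> give points \<open>A\<^sub>H\<close>, \<open>A\<^sub>K\<close> over \<open>A\<close>. Let \<open>P\<close> be the kernel of their coproduct in
  \<open>Pt B\<close>. By preservation of jointly strongly epimorphic pairs \<open>H + K \<rightarrow> P\<close> is epimorphic, so the
  factorization of \<open>[h, k]\<close> followed by \<open>\<pi>\<close> through \<open>\<Sigma>\<close> becomes a factorization of \<open>P \<rightarrow> G \<rightarrow> Q\<close>
  through the equivariant arrow \<open>P \<rightarrow> H \<times> K\<close>. Let \<open>\<nu>\<close> be the restriction of \<open>[h, k]\<close> to the kernel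
  \<open>N\<close> of \<open>\<Sigma>\<close>. It follows that \<open>\<pi>\<close>, the cokernel of \<open>\<nu>\<close>, is also the cokernel of the
  arrow \<open>B\<flat>N \<rightarrow> G\<close> obtained by acting on \<open>\<nu>\<close>. This arrow is the restriction to kernels of a morphism
  \<open>B + N \<rightarrow> A\<close> of points, so by preservation of cokernels \<open>\<pi>\<close> underlies a morphism of points, and
  the action restricts to its kernel.\<close>

section \<open>Zero arrows, limits and colimits\<close>

text \<open>The kernel functor is not assumed to preserve coproducts, so \<open>H + K\<close> and
  \<open>N\<close> come with no action of \<open>B\<close>, and the pushout defining the quotient
  \<open>Q\<close> cannot simply be transported along the action. The object \<open>P\<close> stands
  in for \<open>H + K\<close>: it has a conjugation action, and its arrows to \<open>G\<close>,
  \<open>H\<close> and \<open>K\<close> are equivariant because they restrict morphisms of points.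
  Acting on the image of \<open>N\<close> in \<open>P\<close> gives an arrow killed by the
  projections to \<open>H\<close> and \<open>K\<close>, hence by the arrow to \<open>Q\<close>.
  Conversely, precomposing the acted arrow with the unit of the monad returns the original one; so
  the two cokernels agree. Preservation of cokernels serves a second time, to build a point from an
  action. Exactness only provides quotients of equivalence relations, whereas the commutator,
  coproducts of points and semidirect products all require coequalizers. These come from
  protomodularity, which enters only through change of base along \<open>0 -> B\<close>: the kernel
  and the section of a point are jointly strongly epimorphic, and this makes every reflexive
  relation an equivalence relation.\<close>

context category
begin

lemma hom_iff [simp]: "f \<in> hom C X Y \<longleftrightarrow> f \<in> Arr C \<and> Dom C f = X \<and> Cod C f = Y"
  by (simp add: hom_def)

lemma hom_Obj: "f \<in> hom C X Y \<Longrightarrow> X \<in> Obj C \<and> Y \<in> Obj C"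
  using Dom_Obj Cod_Obj by auto

lemma Id_simps [simp]:
  assumes "X \<in> Obj C"
  shows "Id C X \<in> Arr C" "Dom C (Id C X) = X" "Cod C (Id C X) = X"
  using Id_hom[OF assms] by auto

lemma comp_simps [simp]:
  assumes "f \<in> Arr C" "g \<in> Arr C" "Cod C f = Dom C g"
  shows "g \<cdot> f \<in> Arr C" "Dom C (g \<cdot> f) = Dom C f" "Cod C (g \<cdot> f) = Cod C g"
  using Comp_hom[of f "Dom C f" "Cod C f" g "Cod C g"] assms by auto

lemma comp_assoc [simp]:
  assumes "f \<in> Arr C" "g \<in> Arr C" "h \<in> Arr C" "Cod C f = Dom C g" "Cod C g = Dom C h"
  shows "h \<cdot> g \<cdot> f = h \<cdot> (g \<cdot> f)"
  using Comp_assoc[of f "Dom C f" "Cod C f" g "Cod C g" h "Cod C h"] assms by auto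

lemma comp_Id [simp]:
  assumes "f \<in> Arr C"
  shows "Cod C f = Y \<Longrightarrow> Id C Y \<cdot> f = f" "Dom C f = X \<Longrightarrow> f \<cdot> Id C X = f"
  using Comp_Id_left[of f "Dom C f" "Cod C f"] Comp_Id_right[of f "Dom C f" "Cod C f"] assms
  by auto

lemma reassoc:
  assumes "p \<cdot> s = t" "s \<in> Arr C" "p \<in> Arr C" "Cod C s = Dom C p" "x \<in> Arr C" "Cod C x = Dom C s"
  shows "p \<cdot> (s \<cdot> x) = t \<cdot> x"
  using comp_assoc[of x s p] assms by auto

lemma is_monoD:
  assumes "is_mono C m" "u \<in> hom C W (Dom C m)" "v \<in> hom C W (Dom C m)" "m \<cdot> u = m \<cdot> v"
  shows "u = v"
  using assms unfolding is_mono_def by blast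

lemma is_iso_mono_section:
  assumes "is_mono C m" "t \<in> hom C (Cod C m) (Dom C m)" "m \<cdot> t = Id C (Cod C m)"
  shows "is_iso C m"
proof -
  have m: "m \<in> Arr C" using assms(1) by (simp add: is_mono_def)
  note o = Dom_Obj[OF m] Cod_Obj[OF m]
  have "m \<cdot> (t \<cdot> m) = m \<cdot> Id C (Dom C m)"
    using assms m o by (simp add: reassoc[OF assms(3)])
  then have "t \<cdot> m = Id C (Dom C m)"
    using is_monoD[OF assms(1), of "t \<cdot> m" "Dom C m"] assms m o by simp
  then show ?thesis unfolding is_iso_def using assms m by blast
qed

lemma zero_obj_unique:
  assumes "is_zero_obj C Z"
  shows "f \<in> hom C X Z \<Longrightarrow> g \<in> hom C X Z \<Longrightarrow> f = g"
    and "f \<in> hom C Z Y \<Longrightarrow> g \<in> hom C Z Y \<Longrightarrow> f = g"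
proof -
  show "f = g" if "f \<in> hom C X Z" "g \<in> hom C X Z"
  proof -
    have "\<exists>!f. f \<in> hom C X Z"
      using assms hom_Obj[OF that(1)] unfolding is_zero_obj_def by simp
    with that show ?thesis by (metis (no_types))
  qed
  show "f = g" if "f \<in> hom C Z Y" "g \<in> hom C Z Y"
  proof -
    have "\<exists>!f. f \<in> hom C Z Y"
      using assms hom_Obj[OF that(1)] unfolding is_zero_obj_def by simp
    with that show ?thesis by (metis (no_types))
  qed
qed

lemma zero_obj_ex:
  assumes "is_zero_obj C Z" "X \<in> Obj C"
  shows "\<exists>f. f \<in> hom C X Z" "\<exists>f. f \<in> hom C Z X"
  using assms unfolding is_zero_obj_def by (auto intro: ex1_implies_ex simp del: hom_iff)

text \<open>\<open>zero_arr\<close> is a definite description ranging over all zero objects, so it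
  denotes something only if the composite does not depend on the one chosen. The arrow
  \<open>w\<close> between two zero objects compares the composites.\<close>

lemma zero_arr_eq:
  assumes Z: "is_zero_obj C Z" and u: "u \<in> hom C X Z" and v: "v \<in> hom C Z Y"
  shows "zero_arr C X Y = v \<cdot> u"
  unfolding zero_arr_def
proof (rule the_equality)
  show "\<exists>Z u' v'. is_zero_obj C Z \<and> u' \<in> hom C X Z \<and> v' \<in> hom C Z Y \<and> v \<cdot> u = v' \<cdot> u'"
    using assms by blast
next
  fix f assume "\<exists>Z u v. is_zero_obj C Z \<and> u \<in> hom C X Z \<and> v \<in> hom C Z Y \<and> f = v \<cdot> u"
  then obtain Z' u' v' where Z': "is_zero_obj C Z'" and u': "u' \<in> hom C X Z'"
    and v': "v' \<in> hom C Z' Y" and f: "f = v' \<cdot> u'" by blast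
  have ob: "X \<in> Obj C" "Y \<in> Obj C" "Z \<in> Obj C" "Z' \<in> Obj C"
    using hom_Obj[OF u] hom_Obj[OF v] hom_Obj[OF u'] by auto
  then obtain w where w: "w \<in> hom C Z Z'" using zero_obj_ex(1)[OF Z'] by blast
  have "w \<cdot> u \<in> hom C X Z'" "v' \<cdot> w \<in> hom C Z Y" using w u v' by auto
  then have e: "w \<cdot> u = u'" "v' \<cdot> w = v"
    using u' v zero_obj_unique(1)[OF Z'] zero_obj_unique(2)[OF Z] by blast+
  have "v' \<cdot> u' = v' \<cdot> (w \<cdot> u)" by (simp only: e)
  also have "\<dots> = v \<cdot> u" using w u v' by (simp add: reassoc[OF e(2)])
  finally show "f = v \<cdot> u" using f by simp
qed

lemma zero_arr_simps:
  assumes "is_zero_obj C Z" "X \<in> Obj C" "Y \<in> Obj C"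
  shows "zero_arr C X Y \<in> hom C X Y"
    and "f \<in> hom C Y W \<Longrightarrow> f \<cdot> zero_arr C X Y = zero_arr C X W"
    and "g \<in> hom C W X \<Longrightarrow> zero_arr C X Y \<cdot> g = zero_arr C W Y"
proof -
  obtain u v where uv: "u \<in> hom C X Z" "v \<in> hom C Z Y"
    using zero_obj_ex[OF assms(1)] assms(2,3) by blast
  have e: "zero_arr C X Y = v \<cdot> u" using zero_arr_eq[OF assms(1) uv] .
  show "zero_arr C X Y \<in> hom C X Y" using e uv by simp
  show "f \<cdot> zero_arr C X Y = zero_arr C X W" if "f \<in> hom C Y W"
    using e uv that zero_arr_eq[OF assms(1) uv(1), of "f \<cdot> v" W] by simp
  show "zero_arr C X Y \<cdot> g = zero_arr C W Y" if "g \<in> hom C W X"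
    using e uv that zero_arr_eq[OF assms(1) _ uv(2), of "u \<cdot> g" W] by simp
qed

lemma kernelD:
  assumes "is_kernel C f k"
  shows "f \<in> Arr C" "k \<in> Arr C" "Cod C k = Dom C f"
    "f \<cdot> k = zero_arr C (Dom C k) (Cod C f)"
  using assms unfolding is_kernel_def by auto

lemma kernel_lift:
  assumes "is_kernel C f k" "u \<in> hom C W (Dom C f)" "f \<cdot> u = zero_arr C W (Cod C f)"
  obtains t where "t \<in> hom C W (Dom C k)" "k \<cdot> t = u"
  using assms unfolding is_kernel_def by blast

lemma cokernelD:
  assumes "is_cokernel C f q"
  shows "f \<in> Arr C" "q \<in> Arr C" "Dom C q = Cod C f"
    "q \<cdot> f = zero_arr C (Dom C f) (Cod C q)"
  using assms unfolding is_cokernel_def by auto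

lemma cokernel_desc:
  assumes "is_cokernel C f q" "u \<in> hom C (Cod C f) W" "u \<cdot> f = zero_arr C (Dom C f) W"
  obtains t where "t \<in> hom C (Cod C q) W" "t \<cdot> q = u"
  using assms unfolding is_cokernel_def by blast

lemma coequalizerD:
  assumes "is_coequalizer C f g e"
  shows "f \<in> Arr C" "g \<in> Arr C" "Dom C g = Dom C f" "Cod C g = Cod C f"
    "e \<in> Arr C" "Dom C e = Cod C f" "e \<cdot> f = e \<cdot> g"
  using assms unfolding is_coequalizer_def by auto

lemma coequalizer_desc:
  assumes "is_coequalizer C f g e" "u \<in> hom C (Cod C f) W" "u \<cdot> f = u \<cdot> g"
  obtains t where "t \<in> hom C (Cod C e) W" "t \<cdot> e = u"
  using assms unfolding is_coequalizer_def by blast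

lemma coequalizer_epi:
  assumes "is_coequalizer C f g e" "u \<in> hom C (Cod C e) W" "v \<in> hom C (Cod C e) W" "u \<cdot> e = v \<cdot> e"
  shows "u = v"
proof -
  note d = coequalizerD[OF assms(1)]
  have "u \<cdot> e \<in> hom C (Cod C f) W" "u \<cdot> e \<cdot> f = u \<cdot> e \<cdot> g"
    using assms(2) d by auto
  then have "\<exists>!t. t \<in> hom C (Cod C e) W \<and> t \<cdot> e = u \<cdot> e"
    using assms(1) unfolding is_coequalizer_def by blast
  then show ?thesis using assms by auto
qed

lemma pullbackD:
  assumes "is_pullback C f g p q"
  shows "f \<in> Arr C" "g \<in> Arr C" "Cod C g = Cod C f" "p \<in> Arr C" "q \<in> Arr C"
    "Dom C q = Dom C p" "Cod C p = Dom C f" "Cod C q = Dom C g" "f \<cdot> p = g \<cdot> q"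
  using assms unfolding is_pullback_def by auto

lemma pullback_lift:
  assumes "is_pullback C f g p q" "u \<in> hom C W (Dom C f)" "v \<in> hom C W (Dom C g)" "f \<cdot> u = g \<cdot> v"
  obtains t where "t \<in> hom C W (Dom C p)" "p \<cdot> t = u" "q \<cdot> t = v"
  using assms unfolding is_pullback_def by blast

lemma pullback_ext:
  assumes "is_pullback C f g p q" "t \<in> hom C W (Dom C p)" "t' \<in> hom C W (Dom C p)"
    "p \<cdot> t = p \<cdot> t'" "q \<cdot> t = q \<cdot> t'"
  shows "t = t'"
proof -
  note d = pullbackD[OF assms(1)]
  have "p \<cdot> t \<in> hom C W (Dom C f)" "q \<cdot> t \<in> hom C W (Dom C g)" using assms(2) d by auto
  moreover have "f \<cdot> (p \<cdot> t) = g \<cdot> (q \<cdot> t)" using assms(2) d by (simp add: reassoc[OF d(9)])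
  ultimately have "\<exists>!s. s \<in> hom C W (Dom C p) \<and> p \<cdot> s = p \<cdot> t \<and> q \<cdot> s = q \<cdot> t"
    using assms(1) unfolding is_pullback_def by blast
  then show ?thesis using assms by auto
qed

lemma finite_limits_pullback:
  assumes lim: "has_finite_limits C"
    and f: "f \<in> Arr C" and g: "g \<in> Arr C" and fg: "Cod C f = Cod C g"
  shows "\<exists>p q. is_pullback C f g p q"
proof -
  \<comment> \<open>The cospan \<open>0 -> 2 <- 1\<close>: identities carry the numbers of their
    objects, 3 and 4 are the legs. Two legs never compose, so the left factor decides the composite:
    an identity (\<open>v \<le> 2\<close>) returns \<open>u\<close>, and a leg can only follow an
    identity.\<close>
  define J :: "(nat, nat) cat" where "J = \<lparr>Obj = {0, 1, 2}, Arr = {0, 1, 2, 3, 4},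
    Dom = (\<lambda>u. if u = 3 then 0 else if u = 4 then 1 else u),
    Cod = (\<lambda>u. if u = 3 \<or> u = 4 then 2 else u), Id = (\<lambda>x. x),
    Comp = (\<lambda>v u. if v \<le> 2 then u else v)\<rparr>"
  define D :: "(nat, nat, 'o, 'a) cat_fun" where "D = \<lparr>
    fobj = (\<lambda>x. if x = 0 then Dom C f else if x = 1 then Dom C g else Cod C f),
    farr = (\<lambda>u. if u = 0 then Id C (Dom C f) else if u = 1 then Id C (Dom C g)
      else if u = 2 then Id C (Cod C f) else if u = 3 then f else g)\<rparr>"
  have J: "category J"
  proof
    show "g \<cdot>\<^bsub>J\<^esub> f \<in> hom J X Z" if "f \<in> hom J X Y" "g \<in> hom J Y Z" for f g X Y Z
      using that unfolding J_def hom_def by (simp; elim conjE disjE; simp)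
  qed (auto simp: J_def hom_def)
  note o = Dom_Obj[OF f] Dom_Obj[OF g] Cod_Obj[OF f]
  have "is_functor J C D"
    unfolding is_functor_def
  proof (intro conjI ballI impI)
    fix u v assume "u \<in> Arr J" "v \<in> Arr J" "Cod J u = Dom J v"
    then consider "v = Cod J u" "v \<le> 2" "u \<in> {0, 1, 2, 3, 4}" | "v = 3" "u = 0" | "v = 4" "u = 1"
      by (fastforce simp: J_def split: if_splits)
    then show "farr D (v \<cdot>\<^bsub>J\<^esub> u) = farr D v \<cdot> farr D u"
      by cases (use f g fg o in \<open>auto simp: J_def D_def\<close>)
  qed (use J category_axioms f g fg o in \<open>auto simp: J_def D_def\<close>)
  then obtain L lam where L: "is_limit J C D L lam"
    using lim unfolding has_finite_limits_def by (force simp: J_def)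
  have c: "is_cone J C D L lam" using L unfolding is_limit_def by blast
  have l: "lam 0 \<in> hom C L (Dom C f)" "lam 1 \<in> hom C L (Dom C g)" "lam 2 = f \<cdot> lam 0"
    "f \<cdot> lam 0 = g \<cdot> lam 1"
    using c unfolding is_cone_def by (auto simp: J_def D_def)
  have u: "\<exists>!t. t \<in> hom C W L \<and> lam 0 \<cdot> t = u \<and> lam 1 \<cdot> t = v"
    if u: "u \<in> hom C W (Dom C f)" and v: "v \<in> hom C W (Dom C g)" and uv: "f \<cdot> u = g \<cdot> v" for W u v
  proof -
    define mu where "mu = (\<lambda>j :: nat. if j = 0 then u else if j = 1 then v else f \<cdot> u)"
    have "is_cone J C D W mu"
      unfolding is_cone_def using hom_Obj[OF u] u v uv f g fg
      by (auto simp: J_def D_def mu_def)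
    then have "\<exists>!t. t \<in> hom C W L \<and> (\<forall>j\<in>Obj J. lam j \<cdot> t = mu j)"
      using L unfolding is_limit_def by blast
    moreover have "(t \<in> hom C W L \<and> (\<forall>j\<in>Obj J. lam j \<cdot> t = mu j)) \<longleftrightarrow>
        t \<in> hom C W L \<and> lam 0 \<cdot> t = u \<and> lam 1 \<cdot> t = v" for t
      using l f g fg by (auto simp: J_def mu_def reassoc[OF l(4)])
    ultimately show ?thesis by simp
  qed
  have "Dom C (lam 0) = L" "Dom C (lam 1) = L" using l by auto
  then have "is_pullback C f g (lam 0) (lam 1)"
    unfolding is_pullback_def using f g fg l(1,2,4) u by metis
  then show ?thesis by blast
qed

end

lemma is_zero_objD: "is_zero_obj C Z \<Longrightarrow> Z \<in> Obj C"
  by (simp add: is_zero_obj_def)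

section \<open>Chosen coproducts, kernels and products in a semi-abelian category\<close>

locale semi_abelian_category = category C for C :: "('o, 'a) cat" (structure) +
  assumes semi_abelian: "semi_abelian C"
begin

abbreviation zero :: "'o \<Rightarrow> 'o \<Rightarrow> 'a" where "zero \<equiv> zero_arr C"

lemma ex_zero: "\<exists>Z. is_zero_obj C Z"
  using semi_abelian unfolding semi_abelian_def pointed_def by blast

lemma zero_simps [simp]:
  assumes "X \<in> Obj C" "Y \<in> Obj C"
  shows "zero X Y \<in> Arr C" "Dom C (zero X Y) = X" "Cod C (zero X Y) = Y"
  using ex_zero zero_arr_simps(1)[OF _ assms] by auto

lemma comp_zero [simp]:
  "f \<in> Arr C \<Longrightarrow> Dom C f = Y \<Longrightarrow> X \<in> Obj C \<Longrightarrow> f \<cdot> zero X Y = zero X (Cod C f)"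
  using ex_zero zero_arr_simps(2)[of _ X Y f "Cod C f"] Dom_Obj by auto

lemma zero_comp [simp]:
  "f \<in> Arr C \<Longrightarrow> Cod C f = X \<Longrightarrow> Y \<in> Obj C \<Longrightarrow> zero X Y \<cdot> f = zero (Dom C f) Y"
  using ex_zero zero_arr_simps(3)[of _ X Y f "Dom C f"] Cod_Obj by auto

lemma coproduct:
  assumes "X \<in> Obj C" "Y \<in> Obj C"
  shows "is_coproduct C X Y (inl C X Y) (inr C X Y)"
proof -
  have "\<exists>x. case x of (i, j) \<Rightarrow> is_coproduct C X Y i j"
    using semi_abelian assms unfolding semi_abelian_def has_binary_coproducts_def by fast
  then have "case coprd C X Y of (i, j) \<Rightarrow> is_coproduct C X Y i j"
    unfolding coprd_def by (rule someI_ex)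
  then show ?thesis by (simp add: inl_def inr_def case_prod_beta)
qed

lemma coprod_simps [simp]:
  assumes "X \<in> Obj C" "Y \<in> Obj C"
  shows "inl C X Y \<in> Arr C" "Dom C (inl C X Y) = X" "Cod C (inl C X Y) = coprod_obj C X Y"
    "inr C X Y \<in> Arr C" "Dom C (inr C X Y) = Y" "Cod C (inr C X Y) = coprod_obj C X Y"
    "coprod_obj C X Y \<in> Obj C"
  using coproduct[OF assms] Cod_Obj unfolding is_coproduct_def by (auto simp: coprod_obj_def)

lemma coprod_ex1:
  assumes "u \<in> hom C X W" "v \<in> hom C Y W"
  shows "\<exists>!t. t \<in> hom C (coprod_obj C X Y) W \<and> t \<cdot> inl C X Y = u \<and> t \<cdot> inr C X Y = v"
  using coproduct[of X Y] hom_Obj[OF assms(1)] hom_Obj[OF assms(2)] assms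
  unfolding is_coproduct_def coprod_obj_def by blast

lemma copair_props:
  assumes "u \<in> hom C X W" "v \<in> hom C Y W"
  shows "copair C u v \<in> hom C (coprod_obj C X Y) W \<and>
    copair C u v \<cdot> inl C X Y = u \<and> copair C u v \<cdot> inr C X Y = v"
proof -
  have "copair C u v = (THE t. t \<in> hom C (coprod_obj C X Y) W \<and>
      t \<cdot> inl C X Y = u \<and> t \<cdot> inr C X Y = v)"
    using assms by (auto simp: copair_def)
  then show ?thesis using theI'[OF coprod_ex1[OF assms]] by simp
qed

lemma copair_simps [simp]:
  assumes "u \<in> Arr C" "v \<in> Arr C" "Cod C u = Cod C v"
  shows "copair C u v \<in> Arr C" "Cod C (copair C u v) = Cod C v"
    "Dom C (copair C u v) = coprod_obj C (Dom C u) (Dom C v)"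
  using copair_props[of u "Dom C u" "Cod C v" v "Dom C v"] assms by auto

lemma copair_inj [simp]:
  assumes "u \<in> Arr C" "v \<in> Arr C" "Cod C u = Cod C v" "Dom C u = X" "Dom C v = Y"
  shows "copair C u v \<cdot> inl C X Y = u" "copair C u v \<cdot> inr C X Y = v"
  using copair_props[of u X "Cod C v" v Y] assms by auto

lemma copair_inj_comp [simp]:
  assumes "u \<in> Arr C" "v \<in> Arr C" "Cod C u = Cod C v" "Dom C u = X" "Dom C v = Y" "x \<in> Arr C"
  shows "Cod C x = X \<Longrightarrow> copair C u v \<cdot> (inl C X Y \<cdot> x) = u \<cdot> x"
    "Cod C x = Y \<Longrightarrow> copair C u v \<cdot> (inr C X Y \<cdot> x) = v \<cdot> x"
proof -
  have o: "X \<in> Obj C" "Y \<in> Obj C" using assms Dom_Obj by auto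
  show "copair C u v \<cdot> (inl C X Y \<cdot> x) = u \<cdot> x" if "Cod C x = X"
    using reassoc[OF copair_inj(1)[OF assms(1-5)], of x] assms o that by simp
  show "copair C u v \<cdot> (inr C X Y \<cdot> x) = v \<cdot> x" if "Cod C x = Y"
    using reassoc[OF copair_inj(2)[OF assms(1-5)], of x] assms o that by simp
qed

lemma coprod_ext:
  assumes "t \<in> hom C (coprod_obj C X Y) W" "t' \<in> hom C (coprod_obj C X Y) W"
    "X \<in> Obj C" "Y \<in> Obj C" "t \<cdot> inl C X Y = t' \<cdot> inl C X Y" "t \<cdot> inr C X Y = t' \<cdot> inr C X Y"
  shows "t = t'"
proof -
  have "\<exists>!s. s \<in> hom C (coprod_obj C X Y) W \<and> s \<cdot> inl C X Y = t \<cdot> inl C X Y \<and>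
      s \<cdot> inr C X Y = t \<cdot> inr C X Y"
    by (rule coprod_ex1) (use assms in auto)
  then show ?thesis using assms by metis
qed

lemma comp_copair:
  assumes "u \<in> Arr C" "v \<in> Arr C" "Cod C u = Cod C v" "f \<in> Arr C" "Dom C f = Cod C v"
  shows "f \<cdot> copair C u v = copair C (f \<cdot> u) (f \<cdot> v)"
  by (rule coprod_ext[of _ "Dom C u" "Dom C v" "Cod C f"]) (use assms Dom_Obj in auto)

lemma pullback:
  assumes "f \<in> Arr C" "g \<in> Arr C" "Cod C f = Cod C g"
  obtains p q where "is_pullback C f g p q"
  using finite_limits_pullback[OF _ assms] semi_abelian
  unfolding semi_abelian_def barr_exact_def regular_def by blast

lemma kernel_ex:
  assumes f: "f \<in> Arr C"
  shows "\<exists>k. is_kernel C f k"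
proof -
  obtain Z where Z: "is_zero_obj C Z" using ex_zero by blast
  note o = Dom_Obj[OF f] Cod_Obj[OF f] is_zero_objD[OF Z]
  obtain p q where pb: "is_pullback C f (zero Z (Cod C f)) p q"
    using pullback[of f "zero Z (Cod C f)"] f o by auto
  note d = pullbackD[OF pb]
  have o': "Dom C p \<in> Obj C" using d Dom_Obj by blast
  have *: "\<exists>!t. t \<in> hom C W (Dom C p) \<and> p \<cdot> t = u"
    if u: "u \<in> hom C W (Dom C f)" "f \<cdot> u = zero W (Cod C f)" for W u
  proof -
    have W: "W \<in> Obj C" using hom_Obj[OF u(1)] by simp
    obtain t where t: "t \<in> hom C W (Dom C p)" "p \<cdot> t = u"
      using pullback_lift[OF pb u(1), of "zero W Z"] u W o by auto
    have "t' = t" if t': "t' \<in> hom C W (Dom C p)" "p \<cdot> t' = u" for t'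
    proof (rule pullback_ext[OF pb t'(1) t(1)])
      show "p \<cdot> t' = p \<cdot> t" using t t' by simp
      show "q \<cdot> t' = q \<cdot> t"
        using zero_obj_unique(1)[OF Z, of "q \<cdot> t'" W "q \<cdot> t"] t t' d o by auto
    qed
    then show ?thesis using t by blast
  qed
  have "is_kernel C f p"
    unfolding is_kernel_def
  proof (intro conjI allI ballI impI)
    show "f \<cdot> p = zero (Dom C p) (Cod C f)" using d o o' by simp
  qed (use * d f in auto)
  then show ?thesis by blast
qed

lemma ker: "f \<in> Arr C \<Longrightarrow> is_kernel C f (ker C f)"
  unfolding ker_def using kernel_ex by (rule someI_ex)

lemma ker_simps [simp]:
  assumes "f \<in> Arr C"
  shows "ker C f \<in> Arr C" "Cod C (ker C f) = Dom C f"
    "f \<cdot> ker C f = zero (Dom C (ker C f)) (Cod C f)" "Dom C (ker C f) \<in> Obj C"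
  using kernelD[OF ker[OF assms]] Dom_Obj by auto

lemma kernel_cancel:
  assumes k: "is_kernel C f k" and "u \<in> hom C W (Dom C k)" "v \<in> hom C W (Dom C k)" "k \<cdot> u = k \<cdot> v"
  shows "u = v"
proof -
  note d = kernelD[OF k]
  have "k \<cdot> u \<in> hom C W (Dom C f)" "f \<cdot> (k \<cdot> u) = zero W (Cod C f)"
    using d assms(2) Cod_Obj by (auto simp: reassoc[OF d(4)])
  then have "\<exists>!t. t \<in> hom C W (Dom C k) \<and> k \<cdot> t = k \<cdot> u"
    using k unfolding is_kernel_def by blast
  then show ?thesis using assms by metis
qed

lemma kernel_mono: "is_kernel C f k \<Longrightarrow> is_mono C k"
  unfolding is_mono_def using kernel_cancel kernelD by blast

lemma kernel_unique:
  assumes k: "is_kernel C f k" and k': "is_kernel C f k'"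
  obtains t t' where "t \<in> hom C (Dom C k) (Dom C k')" "k' \<cdot> t = k"
    "t' \<in> hom C (Dom C k') (Dom C k)" "k \<cdot> t' = k'"
    "t \<cdot> t' = Id C (Dom C k')" "t' \<cdot> t = Id C (Dom C k)"
proof -
  note d = kernelD[OF k] kernelD[OF k']
  obtain t where t: "t \<in> hom C (Dom C k) (Dom C k')" "k' \<cdot> t = k"
    using kernel_lift[OF k', of k "Dom C k"] d by auto
  obtain t' where t': "t' \<in> hom C (Dom C k') (Dom C k)" "k \<cdot> t' = k'"
    using kernel_lift[OF k, of k' "Dom C k'"] d by auto
  note o = hom_Obj[OF t(1)]
  have "t \<cdot> t' = Id C (Dom C k')"
    by (rule kernel_cancel[OF k', of _ "Dom C k'"]) (use t t' d o in \<open>auto simp: reassoc[OF t(2)]\<close>)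
  moreover have "t' \<cdot> t = Id C (Dom C k)"
    by (rule kernel_cancel[OF k, of _ "Dom C k"]) (use t t' d o in \<open>auto simp: reassoc[OF t'(2)]\<close>)
  ultimately show thesis using that t t' by blast
qed

lemma product_ex:
  assumes "X \<in> Obj C" "Y \<in> Obj C"
  shows "\<exists>p q. is_product C X Y p q"
proof -
  obtain Z where Z: "is_zero_obj C Z" using ex_zero by blast
  note o = is_zero_objD[OF Z] assms
  obtain p q where pb: "is_pullback C (zero X Z) (zero Y Z) p q"
    using pullback[of "zero X Z" "zero Y Z"] o by auto
  note d = pullbackD[OF pb]
  have "\<exists>!t. t \<in> hom C W (Dom C p) \<and> p \<cdot> t = u \<and> q \<cdot> t = v"
    if "u \<in> hom C W X" "v \<in> hom C W Y" for W u v
  proof -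
    have "zero X Z \<cdot> u = zero Y Z \<cdot> v" using that o by auto
    then show ?thesis using pb that o unfolding is_pullback_def by auto
  qed
  moreover have "p \<in> hom C (Dom C p) X" "q \<in> hom C (Dom C p) Y" using d o by auto
  ultimately have "is_product C X Y p q" unfolding is_product_def by blast
  then show ?thesis by blast
qed

abbreviation pr1 :: "'o \<Rightarrow> 'o \<Rightarrow> 'a" where "pr1 X Y \<equiv> fst (prd C X Y)"
abbreviation pr2 :: "'o \<Rightarrow> 'o \<Rightarrow> 'a" where "pr2 X Y \<equiv> snd (prd C X Y)"

lemma product:
  assumes "X \<in> Obj C" "Y \<in> Obj C"
  shows "is_product C X Y (pr1 X Y) (pr2 X Y)"
proof -
  have "\<exists>x. case x of (i, j) \<Rightarrow> is_product C X Y i j"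
    using product_ex[OF assms] by fast
  then have "case prd C X Y of (i, j) \<Rightarrow> is_product C X Y i j"
    unfolding prd_def by (rule someI_ex)
  then show ?thesis by (simp add: case_prod_beta)
qed

lemma prod_simps [simp]:
  assumes "X \<in> Obj C" "Y \<in> Obj C"
  shows "pr1 X Y \<in> Arr C" "Dom C (pr1 X Y) = prod_obj C X Y" "Cod C (pr1 X Y) = X"
    "pr2 X Y \<in> Arr C" "Dom C (pr2 X Y) = prod_obj C X Y" "Cod C (pr2 X Y) = Y"
    "prod_obj C X Y \<in> Obj C"
  using product[OF assms] Dom_Obj unfolding is_product_def by (auto simp: prod_obj_def)

lemma prod_ex1:
  assumes "u \<in> hom C W X" "v \<in> hom C W Y"
  shows "\<exists>!t. t \<in> hom C W (prod_obj C X Y) \<and> pr1 X Y \<cdot> t = u \<and> pr2 X Y \<cdot> t = v"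
  using product[of X Y] hom_Obj[OF assms(1)] hom_Obj[OF assms(2)] assms
  unfolding is_product_def prod_obj_def by blast

lemma pair_props:
  assumes "u \<in> hom C W X" "v \<in> hom C W Y"
  shows "pair C u v \<in> hom C W (prod_obj C X Y) \<and> pr1 X Y \<cdot> pair C u v = u \<and> pr2 X Y \<cdot> pair C u v = v"
proof -
  have "pair C u v = (THE t. t \<in> hom C W (prod_obj C X Y) \<and>
      pr1 X Y \<cdot> t = u \<and> pr2 X Y \<cdot> t = v)"
    using assms by (auto simp: pair_def)
  then show ?thesis using theI'[OF prod_ex1[OF assms]] by simp
qed

lemma pair_simps [simp]:
  assumes "u \<in> Arr C" "v \<in> Arr C" "Dom C u = Dom C v"
  shows "pair C u v \<in> Arr C" "Dom C (pair C u v) = Dom C v"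
    "Cod C (pair C u v) = prod_obj C (Cod C u) (Cod C v)"
  using pair_props[of u "Dom C v" "Cod C u" v "Cod C v"] assms by auto

lemma pr_pair [simp]:
  assumes "u \<in> Arr C" "v \<in> Arr C" "Dom C u = Dom C v" "Cod C u = X" "Cod C v = Y"
  shows "pr1 X Y \<cdot> pair C u v = u" "pr2 X Y \<cdot> pair C u v = v"
  using pair_props[of u "Dom C v" X v Y] assms by auto

lemma pr_pair_comp [simp]:
  assumes "u \<in> Arr C" "v \<in> Arr C" "Dom C u = Dom C v" "Cod C u = X" "Cod C v = Y"
    "x \<in> Arr C" "Cod C x = Dom C v"
  shows "pr1 X Y \<cdot> (pair C u v \<cdot> x) = u \<cdot> x" "pr2 X Y \<cdot> (pair C u v \<cdot> x) = v \<cdot> x"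
  using reassoc[OF pr_pair(1)[OF assms(1-5)], of x] reassoc[OF pr_pair(2)[OF assms(1-5)], of x]
    assms Cod_Obj by auto

lemma prod_ext:
  assumes "t \<in> hom C W (prod_obj C X Y)" "t' \<in> hom C W (prod_obj C X Y)"
    "X \<in> Obj C" "Y \<in> Obj C" "pr1 X Y \<cdot> t = pr1 X Y \<cdot> t'" "pr2 X Y \<cdot> t = pr2 X Y \<cdot> t'"
  shows "t = t'"
proof -
  have "\<exists>!s. s \<in> hom C W (prod_obj C X Y) \<and> pr1 X Y \<cdot> s = pr1 X Y \<cdot> t \<and> pr2 X Y \<cdot> s = pr2 X Y \<cdot> t"
    by (rule prod_ex1) (use assms in auto)
  then show ?thesis using assms by metis
qed

text \<open>The pullback of the two graphs \<open><1, f>\<close> and \<open><1, g>\<close>: first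
  components force its legs to coincide, second components then give the equation. The factorization
  is stated without uniqueness because \<open>m\<close> is monic.\<close>

lemma equalizer:
  assumes f: "f \<in> hom C X Y" and g: "g \<in> hom C X Y"
  obtains m where "is_mono C m" "Cod C m = X" "f \<cdot> m = g \<cdot> m"
    "\<And>W u. u \<in> hom C W X \<Longrightarrow> f \<cdot> u = g \<cdot> u \<Longrightarrow> \<exists>t\<in>hom C W (Dom C m). m \<cdot> t = u"
proof -
  note o = hom_Obj[OF f]
  obtain p q where pb: "is_pullback C (pair C (Id C X) f) (pair C (Id C X) g) p q"
    using pullback[of "pair C (Id C X) f" "pair C (Id C X) g"] f g o by auto
  note d = pullbackD[OF pb]
  have dd: "Cod C p = X" "Cod C q = X" using d f g o by auto
  have "pr1 X Y \<cdot> (pair C (Id C X) f \<cdot> p) = pr1 X Y \<cdot> (pair C (Id C X) g \<cdot> q)"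
    using d by simp
  then have pq: "p = q" using d(1-8) dd f g o by simp
  have "pr2 X Y \<cdot> (pair C (Id C X) f \<cdot> p) = pr2 X Y \<cdot> (pair C (Id C X) g \<cdot> q)"
    using d by simp
  then have e: "f \<cdot> p = g \<cdot> p" using d(1-8) dd f g o pq by simp
  have "is_mono C p"
    unfolding is_mono_def using d pullback_ext[OF pb] pq by blast
  moreover have "\<exists>t\<in>hom C W (Dom C p). p \<cdot> t = u" if u: "u \<in> hom C W X" "f \<cdot> u = g \<cdot> u" for W u
  proof -
    have "pair C (Id C X) f \<cdot> u = pair C (Id C X) g \<cdot> u"
      by (rule prod_ext[of _ W X Y]) (use u f g o in auto)
    then obtain t where "t \<in> hom C W (Dom C p)" "p \<cdot> t = u"
      by (rule pullback_lift[OF pb, rotated 2]) (use u f g o in auto)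
    then show ?thesis by blast
  qed
  ultimately show thesis using that e dd by blast
qed

section \<open>Regular images and protomodularity\<close>

lemma coequalizer_kernel_pair:
  assumes "is_pullback C f f r1 r2"
  obtains e where "is_coequalizer C r1 r2 e"
  using assms semi_abelian unfolding semi_abelian_def barr_exact_def regular_def by blast

text \<open>Pullback stability of regular epimorphisms makes \<open>q\<close> epic. An equation may
  thus be checked on a cover, which replaces reasoning with elements.\<close>

lemma coequalizer_pullback_epi:
  assumes e: "is_coequalizer C f g e" and pb: "is_pullback C e w p q"
    and "u \<in> hom C (Dom C w) W" "v \<in> hom C (Dom C w) W" "u \<cdot> q = v \<cdot> q"
  shows "u = v"
proof -
  have "is_regular_epi C e" using e unfolding is_regular_epi_def by blast
  then have "is_regular_epi C q"
    using pb semi_abelian unfolding semi_abelian_def barr_exact_def regular_def by blast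
  then obtain f' g' where q: "is_coequalizer C f' g' q" unfolding is_regular_epi_def by blast
  show ?thesis
    by (rule coequalizer_epi[OF q]) (use assms pullbackD[OF pb] in auto)
qed

text \<open>If \<open>m \<cdot> u = m \<cdot> v\<close>, then over a cover \<open>w\<close> the arrows \<open>u\<close> and \<open>v\<close> lift along \<open>e\<close> to a pair of
  arrows that factors through the kernel pair of \<open>f\<close>.\<close>

lemma image:
  assumes f: "f \<in> Arr C"
  obtains r1 r2 e m where "is_pullback C f f r1 r2" "is_coequalizer C r1 r2 e"
    "m \<in> hom C (Cod C e) (Cod C f)" "m \<cdot> e = f" "is_mono C m"
proof -
  obtain r1 r2 where pb: "is_pullback C f f r1 r2" using pullback[OF f f] by auto
  obtain e where e: "is_coequalizer C r1 r2 e" using coequalizer_kernel_pair[OF pb] .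
  note p = pullbackD[OF pb] and c = coequalizerD[OF e]
  obtain m where m: "m \<in> hom C (Cod C e) (Cod C f)" "m \<cdot> e = f"
    by (rule coequalizer_desc[OF e, of f "Cod C f"]) (use p c in auto)
  have "u = v" if u: "u \<in> hom C W (Cod C e)" and v: "v \<in> hom C W (Cod C e)" and uv: "m \<cdot> u = m \<cdot> v" for W u v
  proof -
    obtain a w where aw: "is_pullback C e u a w" by (rule pullback[of e u]) (use u c in auto)
    note d = pullbackD[OF aw]
    obtain b w' where bw: "is_pullback C e (v \<cdot> w) b w'"
      by (rule pullback[of e "v \<cdot> w"]) (use u v c d in auto)
    note d' = pullbackD[OF bw]
    have "f \<cdot> (a \<cdot> w') = m \<cdot> (e \<cdot> (a \<cdot> w'))"
      using m c d d' u v p by (simp add: reassoc[OF m(2)])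
    also have "\<dots> = m \<cdot> (u \<cdot> (w \<cdot> w'))"
      using m c d d' u v p by (simp add: reassoc[OF d(9)])
    also have "\<dots> = m \<cdot> (v \<cdot> (w \<cdot> w'))"
      using m c d d' u v p by (simp add: reassoc[OF uv])
    also have "\<dots> = m \<cdot> (e \<cdot> b)"
      using m c d d' u v p by simp
    also have "\<dots> = f \<cdot> b"
      using m c d d'(1-8) u v p by (simp add: reassoc[OF m(2)])
    finally have fab: "f \<cdot> (a \<cdot> w') = f \<cdot> b" .
    obtain t where t: "t \<in> hom C (Dom C b) (Dom C r1)" "r1 \<cdot> t = a \<cdot> w'" "r2 \<cdot> t = b"
      by (rule pullback_lift[OF pb _ _ fab]) (use c d d' u v p in auto)
    have "u \<cdot> w \<cdot> w' = e \<cdot> (a \<cdot> w')"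
      using m c d d' u v p by (simp add: reassoc[OF d(9)])
    also have "\<dots> = e \<cdot> (r1 \<cdot> t)" by (simp only: t)
    also have "\<dots> = e \<cdot> (r2 \<cdot> t)"
      using c(1-6) d' p t(1) by (simp add: reassoc[OF c(7)])
    also have "\<dots> = e \<cdot> b" by (simp only: t)
    also have "\<dots> = v \<cdot> w \<cdot> w'" using d'(9) .
    finally have "u \<cdot> w \<cdot> w' = v \<cdot> w \<cdot> w'" .
    then have "u \<cdot> w = v \<cdot> w"
      by (rule coequalizer_pullback_epi[OF e bw, rotated 2]) (use c d d' u v in auto)
    then show "u = v"
      by (rule coequalizer_pullback_epi[OF e aw, rotated 2]) (use c d d' u v in auto)
  qed
  then have "is_mono C m" unfolding is_mono_def using m by simp
  then show thesis using that pb e m by blast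
qed

text \<open>The extremal form (no factorization through a proper subobject) is taken instead of a
  lifting property, as the one-arrow counterpart of \<open>jointly_strongly_epi\<close>.\<close>

definition strong_epi :: "'a \<Rightarrow> bool" where
  "strong_epi f \<longleftrightarrow> f \<in> Arr C \<and>
     (\<forall>m. is_mono C m \<and> Cod C m = Cod C f \<and> (\<exists>f'\<in>hom C (Dom C f) (Dom C m). m \<cdot> f' = f) \<longrightarrow> is_iso C m)"

lemma split_epi_strong:
  assumes "f \<in> Arr C" "s \<in> hom C (Cod C f) (Dom C f)" "f \<cdot> s = Id C (Cod C f)"
  shows "strong_epi f"
  unfolding strong_epi_def
proof (intro conjI allI impI; (elim conjE bexE)?)
  fix m f' assume m: "is_mono C m" "Cod C m = Cod C f" "f' \<in> hom C (Dom C f) (Dom C m)" "m \<cdot> f' = f"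
  have "m \<in> Arr C" using m by (simp add: is_mono_def)
  then show "is_iso C m"
    using is_iso_mono_section[OF m(1), of "f' \<cdot> s"] m(2,3) assms by (simp add: reassoc[OF m(4)])
qed fact

text \<open>A subobject \<open>m\<close> containing the section is itself a point over
  \<open>B\<close>, and \<open>m\<close> is a morphism of points. Change of base along
  \<open>0 -> B\<close> turns it into the comparison of kernels, which is invertible because
  \<open>m\<close> also contains \<open>k\<close>; protomodularity reflects this
  isomorphism.\<close>

lemma point_strong:
  assumes p: "p \<in> hom C A B" and s: "s \<in> hom C B A" and ps: "p \<cdot> s = Id C B"
    and k: "is_kernel C p k"
    and m: "is_mono C m" "Cod C m = A"
    and mk: "k' \<in> hom C (Dom C k) (Dom C m)" "m \<cdot> k' = k"
    and ms: "s' \<in> hom C B (Dom C m)" "m \<cdot> s' = s"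
  shows "is_iso C m"
proof -
  obtain Z where Z: "is_zero_obj C Z" using ex_zero by blast
  have mA: "m \<in> Arr C" using m by (simp add: is_mono_def)
  note o = hom_Obj[OF p] is_zero_objD[OF Z] Dom_Obj[OF mA]
  note h = p s m mk ms mA o
  define v where "v = zero Z B"
  have v: "v \<in> Arr C" "Dom C v = Z" "Cod C v = B" using o by (auto simp: v_def)
  define f where "f = ((Dom C m, p \<cdot> m, s'), m, (A, p, s))"
  have f: "f \<in> Arr (Pt C B)"
    using h ps by (simp add: f_def Pt_def Pt_Arr_def Pt_Obj_def)
  have pbx: "is_pullback C g v (fst (pb C g v)) (snd (pb C g v))"
    if g: "g \<in> Arr C" "Cod C g = B" for g
  proof -
    have "\<exists>x. case x of (a, b) \<Rightarrow> is_pullback C g v a b"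
    proof -
      obtain a b where "is_pullback C g v a b" by (rule pullback[of g v]) (use g v in auto)
      then show ?thesis by (intro exI[of _ "(a, b)"]) simp
    qed
    then have "case pb C g v of (a, b) \<Rightarrow> is_pullback C g v a b"
      unfolding pb_def by (rule someI_ex)
    then show ?thesis by (simp add: case_prod_beta)
  qed
  define q1 p1 q2 p2 where "q1 = fst (pb C (p \<cdot> m) v)" and "p1 = snd (pb C (p \<cdot> m) v)"
    and "q2 = fst (pb C p v)" and "p2 = snd (pb C p v)"
  have pb1: "is_pullback C (p \<cdot> m) v q1 p1" unfolding q1_def p1_def by (rule pbx) (use h in auto)
  have pb2: "is_pullback C p v q2 p2" unfolding q2_def p2_def by (rule pbx) (use h in auto)
  note d1 = pullbackD[OF pb1] and d2 = pullbackD[OF pb2]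
  have oP: "Dom C q1 \<in> Obj C" "Dom C q2 \<in> Obj C" using d1 d2 Dom_Obj by auto
  \<comment> \<open>Unique existence is what gives meaning to the definite descriptions of the
    sections inside \<open>change_base\<close>.\<close>
  have section_ex: "\<exists>!t. t \<in> hom C Z (Dom C a) \<and> a \<cdot> t = r \<cdot> v \<and> b \<cdot> t = Id C Z"
    if "is_pullback C g v a b" "g \<in> hom C X B" "r \<in> hom C B X" "g \<cdot> r = Id C B" for g a b r X
  proof -
    have "g \<cdot> (r \<cdot> v) = v \<cdot> Id C Z" using that(2,3) v o by (simp add: reassoc[OF that(4)])
    moreover have "r \<cdot> v \<in> hom C Z (Dom C g)" "Id C Z \<in> hom C Z (Dom C v)"
      using that(2,3) v o by auto
    ultimately show ?thesis using that(1) unfolding is_pullback_def by blast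
  qed
  define t1 where "t1 = (THE t. t \<in> hom C Z (Dom C q1) \<and> q1 \<cdot> t = s' \<cdot> v \<and> p1 \<cdot> t = Id C Z)"
  define t2 where "t2 = (THE t. t \<in> hom C Z (Dom C q2) \<and> q2 \<cdot> t = s \<cdot> v \<and> p2 \<cdot> t = Id C Z)"
  have t1: "t1 \<in> hom C Z (Dom C q1) \<and> q1 \<cdot> t1 = s' \<cdot> v \<and> p1 \<cdot> t1 = Id C Z"
    unfolding t1_def by (rule theI'[OF section_ex[OF pb1]]) (use h ps in auto)
  have t2: "t2 \<in> hom C Z (Dom C q2) \<and> q2 \<cdot> t2 = s \<cdot> v \<and> p2 \<cdot> t2 = Id C Z"
    unfolding t2_def by (rule theI'[OF section_ex[OF pb2]]) (use h ps in auto)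
  define g where "g = (THE g. g \<in> hom C (Dom C q1) (Dom C q2) \<and> q2 \<cdot> g = m \<cdot> q1 \<and> p2 \<cdot> g = p1)"
  have "\<exists>!g. g \<in> hom C (Dom C q1) (Dom C q2) \<and> q2 \<cdot> g = m \<cdot> q1 \<and> p2 \<cdot> g = p1"
  proof -
    have "p \<cdot> (m \<cdot> q1) = v \<cdot> p1" "m \<cdot> q1 \<in> hom C (Dom C q1) (Dom C p)"
      "p1 \<in> hom C (Dom C q1) (Dom C v)" using d1 h by auto
    then show ?thesis using pb2 unfolding is_pullback_def by blast
  qed
  from theI'[OF this] have g: "g \<in> hom C (Dom C q1) (Dom C q2)" "q2 \<cdot> g = m \<cdot> q1" "p2 \<cdot> g = p1"
    unfolding g_def by auto
  have F: "farr (change_base C v) f = ((Dom C q1, p1, t1), g, (Dom C q2, p2, t2))"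
    unfolding f_def change_base_def g_def t1_def t2_def q1_def q2_def p1_def p2_def
    by (simp add: Let_def case_prod_beta v)
  \<comment> \<open>The other leg of the pullback ends in the zero object, so \<open>q2\<close>
    factors through the kernel \<open>k\<close>.\<close>
  have kq: "p \<cdot> q2 = zero (Dom C q2) B"
  proof -
    have "p2 = zero (Dom C q2) Z"
      by (rule zero_obj_unique(1)[OF Z, of _ "Dom C q2"]) (use d2 v o oP in auto)
    then show ?thesis using d2 v o oP by simp
  qed
  obtain w0 where w0: "w0 \<in> hom C (Dom C q2) (Dom C k)" "k \<cdot> w0 = q2"
    by (rule kernel_lift[OF k, of q2 "Dom C q2"]) (use kq d2 h in auto)
  \<comment> \<open>As \<open>k\<close> lies in the subobject \<open>m\<close>, so does
    \<open>q2\<close>. This lift into \<open>Dom C m\<close> induces the inverse \<open>t\<close> of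
    \<open>g\<close>.\<close>
  define w where "w = k' \<cdot> w0"
  have w: "w \<in> hom C (Dom C q2) (Dom C m)" "m \<cdot> w = q2"
    using w0 h by (auto simp: w_def reassoc[OF mk(2)])
  obtain t where t: "t \<in> hom C (Dom C q2) (Dom C q1)" "q1 \<cdot> t = w" "p1 \<cdot> t = p2"
    by (rule pullback_lift[OF pb1, of w "Dom C q2" p2]) (use w d2 h in \<open>auto simp: reassoc[OF ms(2)]\<close>)
  have gt: "g \<cdot> t = Id C (Dom C q2)"
    by (rule pullback_ext[OF pb2, of _ "Dom C q2"])
      (use g(1) t w d1 d2 h oP in \<open>auto simp: reassoc[OF g(2)] reassoc[OF g(3)]\<close>)
  have wg: "w \<cdot> g = q1"
    by (rule is_monoD[OF m(1), of _ "Dom C q1"])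
      (use g w(1) d1 d2 h oP in \<open>auto simp: reassoc[OF w(2)]\<close>)
  have tg: "t \<cdot> g = Id C (Dom C q1)"
    by (rule pullback_ext[OF pb1, of _ "Dom C q1"])
      (use g t(1) d1 d2 h oP wg in \<open>auto simp: reassoc[OF t(2)] reassoc[OF t(3)]\<close>)
  \<comment> \<open>Compatibility with sections is automatic over the base \<open>Z\<close>: both
    sides start at a zero object.\<close>
  have gs: "g \<cdot> t1 = t2" "t \<cdot> t2 = t1"
    using zero_obj_unique(2)[OF Z] g t t1 t2 by auto
  have "is_iso (Pt C Z) (farr (change_base C v) f)"
    unfolding is_iso_def F
    by (intro conjI bexI[of _ "((Dom C q2, p2, t2), t, (Dom C q1, p1, t1))"])
      (use g t t1 t2 gs tg gt d1 d2 oP v in \<open>auto simp: Pt_def Pt_Arr_def Pt_Obj_def hom_def\<close>)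
  then have "is_iso (Pt C B) f"
    using f v semi_abelian unfolding semi_abelian_def protomodular_def reflects_isos_def by blast
  then obtain x where x: "x \<in> hom (Pt C B) (A, p, s) (Dom C m, p \<cdot> m, s')"
    "Comp (Pt C B) f x = Id (Pt C B) (A, p, s)"
    unfolding is_iso_def by (auto simp: Pt_def f_def)
  then obtain y where "y \<in> hom C A (Dom C m)" "m \<cdot> y = Id C A"
    by (auto simp: Pt_def f_def hom_def Pt_Arr_def)
  then show ?thesis using is_iso_mono_section[OF m(1)] m(2) by simp
qed

text \<open>The equalizer of \<open>u\<close> and \<open>v\<close> contains the section and the
  kernel, hence is everything by \<open>point_strong\<close>.\<close>

lemma point_ext:
  assumes "p \<in> hom C A B" "s \<in> hom C B A" "p \<cdot> s = Id C B" "is_kernel C p k"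
    and u: "u \<in> hom C A W" and v: "v \<in> hom C A W"
    and "u \<cdot> s = v \<cdot> s" "u \<cdot> k = v \<cdot> k"
  shows "u = v"
proof -
  obtain m where m: "is_mono C m" "Cod C m = A" "u \<cdot> m = v \<cdot> m"
    "\<And>W w. w \<in> hom C W A \<Longrightarrow> u \<cdot> w = v \<cdot> w \<Longrightarrow> \<exists>t\<in>hom C W (Dom C m). m \<cdot> t = w"
    using equalizer[OF u v] by blast
  have "k \<in> hom C (Dom C k) A" using kernelD[OF assms(4)] assms by auto
  then obtain k' s' where "k' \<in> hom C (Dom C k) (Dom C m)" "m \<cdot> k' = k"
    "s' \<in> hom C B (Dom C m)" "m \<cdot> s' = s"
    using m(4) assms by metis
  then have "is_iso C m" using point_strong[OF assms(1-4) m(1,2)] by blast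
  then obtain n where n: "n \<in> hom C A (Dom C m)" "m \<cdot> n = Id C A" "m \<in> Arr C"
    using m(2) unfolding is_iso_def by auto
  have "u \<cdot> (m \<cdot> n) = v \<cdot> (m \<cdot> n)" using u v m(2) n(1,3) by (simp add: reassoc[OF m(3)])
  then show ?thesis using n u v by simp
qed

section \<open>Cokernels and coequalizers\<close>

lemma is_isoE:
  assumes "is_iso C m"
  obtains n where "n \<in> hom C (Cod C m) (Dom C m)" "n \<cdot> m = Id C (Dom C m)" "m \<cdot> n = Id C (Cod C m)"
  using assms unfolding is_iso_def by blast

lemma strong_epiD:
  assumes "strong_epi f" "is_mono C m" "f' \<in> hom C (Dom C f) (Dom C m)" "m \<cdot> f' = f" "Cod C m = Cod C f"
  shows "is_iso C m"
  using assms unfolding strong_epi_def by blast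

text \<open>The monic part of the image factorization is invertible, so \<open>f\<close> is, up to
  isomorphism, the coequalizer of its kernel pair. It remains to see that an arrow killing the
  kernel of \<open>f\<close> coequalizes the kernel pair, and here the kernel pair is treated as a
  point split by the diagonal.\<close>

lemma strong_epi_cokernel:
  assumes f: "strong_epi f" and k: "is_kernel C f k"
  shows "is_cokernel C k f"
proof -
  note dk = kernelD[OF k]
  obtain r1 r2 e m where pb: "is_pullback C f f r1 r2" and e: "is_coequalizer C r1 r2 e"
    and m: "m \<in> hom C (Cod C e) (Cod C f)" "m \<cdot> e = f" "is_mono C m"
    by (rule image[OF dk(1)])
  note p = pullbackD[OF pb] and c = coequalizerD[OF e]
  note o = Dom_Obj[OF dk(1)] Cod_Obj[OF dk(1)] Dom_Obj[OF p(4)] Dom_Obj[OF dk(2)]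
  have "is_iso C m" by (rule strong_epiD[OF f m(3) _ m(2)]) (use m(1) c p in auto)
  then obtain n where n: "n \<in> hom C (Cod C f) (Cod C e)" "n \<cdot> m = Id C (Cod C e)" "m \<cdot> n = Id C (Cod C f)"
    using m by (auto elim: is_isoE)
  obtain d where d: "d \<in> hom C (Dom C f) (Dom C r1)" "r1 \<cdot> d = Id C (Dom C f)" "r2 \<cdot> d = Id C (Dom C f)"
    by (rule pullback_lift[OF pb, of "Id C (Dom C f)" "Dom C f" "Id C (Dom C f)"]) (use o p in auto)
  have kr: "is_kernel C r1 (ker C r1)" using p by (simp add: ker)
  have epi: "x = y" if x: "x \<in> hom C (Cod C f) W" and y: "y \<in> hom C (Cod C f) W"
    and xy: "x \<cdot> f = y \<cdot> f" for x y W
  proof -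
    have "x \<cdot> m \<cdot> e = y \<cdot> m \<cdot> e" using xy x y m c by simp
    then have xm: "x \<cdot> m = y \<cdot> m"
      by (rule coequalizer_epi[OF e, rotated 2]) (use x y m in auto)
    have "x \<cdot> (m \<cdot> n) = y \<cdot> (m \<cdot> n)"
      using x y m n(1) by (simp add: reassoc[OF xm])
    then show ?thesis using x y n(3) by simp
  qed
  have desc: "\<exists>t. t \<in> hom C (Cod C f) W \<and> t \<cdot> f = u"
    if u: "u \<in> hom C (Dom C f) W" "u \<cdot> k = zero (Dom C k) W" for u W
  proof -
    have W: "W \<in> Obj C" using hom_Obj[OF u(1)] by simp
    \<comment> \<open>\<open>r2\<close> carries the kernel of \<open>r1\<close> into that of
      \<open>f\<close>, where \<open>u\<close> vanishes. So \<open>u \<cdot> r1\<close> and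
      \<open>u \<cdot> r2\<close> agree on \<open>ker C r1\<close> and on the diagonal
      \<open>d\<close>, and \<open>point_ext\<close> applies.\<close>
    have "f \<cdot> (r2 \<cdot> ker C r1) = zero (Dom C (ker C r1)) (Cod C f)"
      using p(1-8) o by (simp add: reassoc[OF p(9)[symmetric]])
    then obtain w where w: "w \<in> hom C (Dom C (ker C r1)) (Dom C k)" "k \<cdot> w = r2 \<cdot> ker C r1"
      by (rule kernel_lift[OF k, rotated]) (use p in auto)
    have "u \<cdot> (r2 \<cdot> ker C r1) = zero (Dom C (ker C r1)) W"
      unfolding w(2)[symmetric] using u(1) dk w(1) W by (simp add: reassoc[OF u(2)])
    then have "u \<cdot> r1 = u \<cdot> r2"
      by (rule_tac point_ext[OF _ d(1,2) kr, of _ W]) (use u(1) p d o in auto)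
    then obtain t where t: "t \<in> hom C (Cod C e) W" "t \<cdot> e = u"
      by (rule coequalizer_desc[OF e, rotated]) (use u p in auto)
    have "t \<cdot> n \<cdot> f = t \<cdot> n \<cdot> (m \<cdot> e)" by (simp only: m)
    also have "\<dots> = u" using t m(1) n(1) c o Cod_Obj[OF c(5)] by (simp add: reassoc[OF n(2)])
    finally show ?thesis using t n by (intro exI[of _ "t \<cdot> n"]) auto
  qed
  show ?thesis
    unfolding is_cokernel_def
  proof (intro conjI allI ballI impI)
    fix W u assume u: "u \<in> hom C (Cod C k) W" "u \<cdot> k = zero (Dom C k) W"
    then obtain t where "t \<in> hom C (Cod C f) W" "t \<cdot> f = u" using desc dk by auto
    then show "\<exists>!t. t \<in> hom C (Cod C f) W \<and> t \<cdot> f = u" using epi by blast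
  qed (use dk in auto)
qed

text \<open>The arrow \<open>\<langle>r1, r2\<rangle>\<close> is an internal relation. The object \<open>D\<close> of the proof consists of the
  \<open>(x, y), (z, y), (z, w)\<close> in \<open>R\<close>, and the subobject of those with \<open>(x, w)\<close> in \<open>R\<close> contains
  the kernel \<open>y = z = w = 0\<close> and the section \<open>x = z\<close> of the projection to \<open>(z, y), (z, w)\<close>.\<close>

lemma reflexive_relation_difunctional:
  assumes r: "r1 \<in> hom C R X" "r2 \<in> hom C R X"
    and jm: "is_mono C (pair C r1 r2)"
    and a: "a \<in> hom C W R" and b: "b \<in> hom C W R" and c: "c \<in> hom C W R"
    and ac: "r2 \<cdot> a = r2 \<cdot> c" and bc: "r1 \<cdot> c = r1 \<cdot> b"
  obtains t where "t \<in> hom C W R" "r1 \<cdot> t = r1 \<cdot> a" "r2 \<cdot> t = r2 \<cdot> b"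
proof -
  obtain a1 c1 where v1: "is_pullback C r2 r2 a1 c1" using pullback[of r2 r2] r by auto
  obtain c2 b2 where v2: "is_pullback C r1 r1 c2 b2" using pullback[of r1 r1] r by auto
  note p1 = pullbackD[OF v1] and p2 = pullbackD[OF v2]
  obtain d1 d2 where D: "is_pullback C c1 c2 d1 d2" using pullback[of c1 c2] p1 p2 r by auto
  note pD = pullbackD[OF D]
  note o = hom_Obj[OF r(1)] Dom_Obj[OF p1(4)] Dom_Obj[OF p2(4)] Dom_Obj[OF pD(4)]
  \<comment> \<open>For a triple \<open>(x, y), (z, y), (z, w)\<close> this is the outer pair
    \<open>(x, w)\<close>; \<open>m\<close> below is the subobject on which it belongs to the
    relation.\<close>
  define f where "f = pair C (r1 \<cdot> (a1 \<cdot> d1)) (r2 \<cdot> (b2 \<cdot> d2))"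
  have f: "f \<in> hom C (Dom C d1) (prod_obj C X X)"
    using r p1 p2 pD by (simp add: f_def)
  obtain m z where S: "is_pullback C f (pair C r1 r2) m z"
    by (rule pullback[of f "pair C r1 r2"]) (use f r in auto)
  note pS = pullbackD[OF S]
  have "is_mono C m"
    unfolding is_mono_def
  proof (intro conjI allI ballI impI)
    fix W u v assume u: "u \<in> hom C W (Dom C m)" and v: "v \<in> hom C W (Dom C m)" and uv: "m \<cdot> u = m \<cdot> v"
    have "pair C r1 r2 \<cdot> (z \<cdot> u) = pair C r1 r2 \<cdot> (z \<cdot> v)"
      using u v pS(1-8) by (simp add: reassoc[OF pS(9)[symmetric]] uv)
    then have "z \<cdot> u = z \<cdot> v"
      by (rule is_monoD[OF jm, rotated 2]) (use u v pS(1-8) r in auto)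
    then show "u = v" using pullback_ext[OF S u v uv] by simp
  qed (use pS in simp)
  have lift: "\<exists>t\<in>hom C W (Dom C m). m \<cdot> t = x"
    if x: "x \<in> hom C W (Dom C d1)" and t: "t \<in> hom C W R" "r1 \<cdot> t = r1 \<cdot> (a1 \<cdot> (d1 \<cdot> x))"
      "r2 \<cdot> t = r2 \<cdot> (b2 \<cdot> (d2 \<cdot> x))" for x t W
  proof -
    have "f \<cdot> x = pair C r1 r2 \<cdot> t"
      by (rule prod_ext[of _ W X X]) (use x t p1(1-8) p2(1-8) pD(1-8) r o in \<open>auto simp: f_def\<close>)
    then obtain y where "y \<in> hom C W (Dom C m)" "m \<cdot> y = x"
      by (rule pullback_lift[OF S, rotated 2]) (use x t f r in auto)
    then show ?thesis by blast
  qed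
  obtain s1 where s1: "s1 \<in> hom C (Dom C c2) (Dom C a1)" "a1 \<cdot> s1 = c2" "c1 \<cdot> s1 = c2"
    by (rule pullback_lift[OF v1, of c2 "Dom C c2" c2]) (use p2 r in auto)
  obtain s where s: "s \<in> hom C (Dom C c2) (Dom C d1)" "d1 \<cdot> s = s1" "d2 \<cdot> s = Id C (Dom C c2)"
    by (rule pullback_lift[OF D, of s1 "Dom C c2" "Id C (Dom C c2)"]) (use p1 p2 s1 o in auto)
  have ms: "\<exists>t\<in>hom C (Dom C c2) (Dom C m). m \<cdot> t = s"
    by (rule lift[of _ _ b2]) (use s s1 p1 p2 r in auto)
  define k where "k = ker C d2"
  have k: "is_kernel C d2 k" using ker pD by (simp add: k_def)
  note dk = kernelD[OF k]
  \<comment> \<open>On this kernel \<open>w\<close> and \<open>y\<close> are both zero, so the outer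
    pair \<open>(x, w)\<close> equals \<open>(x, y)\<close>, and the first member of the triple
    witnesses that it lies in the relation.\<close>
  have "r2 \<cdot> (a1 \<cdot> (d1 \<cdot> k)) = r2 \<cdot> (c1 \<cdot> (d1 \<cdot> k))"
    using p1 dk pD r by (simp add: reassoc[OF p1(9)])
  also have "\<dots> = r2 \<cdot> (c2 \<cdot> (d2 \<cdot> k))"
    using p1 p2 dk(1-3) pD(1-8) r by (simp add: reassoc[OF pD(9)])
  also have "\<dots> = r2 \<cdot> (b2 \<cdot> (d2 \<cdot> k))"
    using p1 p2 dk pD(1-8) r Dom_Obj[OF dk(2)] by simp
  finally have mk: "\<exists>t\<in>hom C (Dom C k) (Dom C m). m \<cdot> t = k"
    by (intro lift[of _ _ "a1 \<cdot> (d1 \<cdot> k)"]) (use p1 dk pD r in auto)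
  have "is_iso C m"
    using ms mk
  proof (elim bexE)
    fix s' k' assume *: "s' \<in> hom C (Dom C c2) (Dom C m)" "m \<cdot> s' = s"
      "k' \<in> hom C (Dom C k) (Dom C m)" "m \<cdot> k' = k"
    show ?thesis
      by (rule point_strong[OF _ s(1,3) k \<open>is_mono C m\<close> _ *(3,4,1,2)]) (use pD pS f in auto)
  qed
  then obtain n where n: "n \<in> hom C (Dom C d1) (Dom C m)" "m \<cdot> n = Id C (Dom C d1)"
    using pS f by (auto elim: is_isoE)
  have t: "r1 \<cdot> (z \<cdot> n) = r1 \<cdot> (a1 \<cdot> d1)" "r2 \<cdot> (z \<cdot> n) = r2 \<cdot> (b2 \<cdot> d2)"
  proof -
    have "pair C r1 r2 \<cdot> (z \<cdot> n) = f"
      using pS(1-8) f r n by (simp add: reassoc[OF pS(9)[symmetric]])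
    then have "pr1 X X \<cdot> (pair C r1 r2 \<cdot> (z \<cdot> n)) = pr1 X X \<cdot> f"
      "pr2 X X \<cdot> (pair C r1 r2 \<cdot> (z \<cdot> n)) = pr2 X X \<cdot> f" by simp_all
    then show "r1 \<cdot> (z \<cdot> n) = r1 \<cdot> (a1 \<cdot> d1)" "r2 \<cdot> (z \<cdot> n) = r2 \<cdot> (b2 \<cdot> d2)"
      using pS(1-8) r n o p1(1-8) p2(1-8) pD(1-8) by (simp_all add: f_def)
  qed
  obtain x1 where x1: "x1 \<in> hom C W (Dom C a1)" "a1 \<cdot> x1 = a" "c1 \<cdot> x1 = c"
    by (rule pullback_lift[OF v1 _ _ ac]) (use a c r in auto)
  obtain x2 where x2: "x2 \<in> hom C W (Dom C c2)" "c2 \<cdot> x2 = c" "b2 \<cdot> x2 = b"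
    by (rule pullback_lift[OF v2 _ _ bc]) (use b c r in auto)
  obtain x where x: "x \<in> hom C W (Dom C d1)" "d1 \<cdot> x = x1" "d2 \<cdot> x = x2"
    by (rule pullback_lift[OF D, of x1 W x2]) (use x1 x2 p1 p2 in auto)
  have "r1 \<cdot> (z \<cdot> n \<cdot> x) = r1 \<cdot> a" "r2 \<cdot> (z \<cdot> n \<cdot> x) = r2 \<cdot> b"
    using reassoc[OF t(1), of x] reassoc[OF t(2), of x] r n(1) x x1 x2 pS(1-8) f p1(1-8) p2(1-8) pD(1-8)
    by auto
  then show thesis using that[of "z \<cdot> n \<cdot> x"] r n x pS f by auto
qed

text \<open>Difunctionality together with the diagonal: the triple
  \<open>(y, y), (x, y), (x, x)\<close> yields symmetry, the triple
  \<open>(x, y), (y, y), (y, z)\<close> yields transitivity.\<close>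

lemma reflexive_relation_equivalence:
  assumes r: "r1 \<in> hom C R X" "r2 \<in> hom C R X"
    and jm: "is_mono C (pair C r1 r2)"
    and d: "d \<in> hom C X R" "r1 \<cdot> d = Id C X" "r2 \<cdot> d = Id C X"
  shows "is_equivalence_relation C X r1 r2"
proof -
  have R: "Dom C r1 = R" using r by simp
  note o = hom_Obj[OF r(1)]
  obtain s where s: "s \<in> hom C R R" "r1 \<cdot> s = r1 \<cdot> (d \<cdot> r2)" "r2 \<cdot> s = r2 \<cdot> (d \<cdot> r1)"
    by (rule reflexive_relation_difunctional[OF r jm, of "d \<cdot> r2" R "d \<cdot> r1" "Id C R"])
      (use r d o in \<open>auto simp: reassoc[OF d(2)] reassoc[OF d(3)]\<close>)
  then have s': "r1 \<cdot> s = r2" "r2 \<cdot> s = r1"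
    using r d by (simp_all add: reassoc[OF d(2)] reassoc[OF d(3)])
  have tr: "\<exists>t\<in>hom C (Dom C q1) R. r1 \<cdot> t = r1 \<cdot> q1 \<and> r2 \<cdot> t = r2 \<cdot> q2"
    if q: "is_pullback C r2 r1 q1 q2" for q1 q2
  proof -
    note p = pullbackD[OF q]
    show ?thesis
      by (rule reflexive_relation_difunctional[OF r jm, of q1 "Dom C q1" q2 "d \<cdot> (r1 \<cdot> q2)"])
        (use r d o p in \<open>auto simp: reassoc[OF d(2)] reassoc[OF d(3)]\<close>)
  qed
  show ?thesis
    unfolding is_equivalence_relation_def Let_def R
  proof (intro conjI)
    show "\<exists>d\<in>hom C X R. r1 \<cdot> d = Id C X \<and> r2 \<cdot> d = Id C X" using d by blast
    show "\<exists>s\<in>hom C R R. r1 \<cdot> s = r2 \<and> r2 \<cdot> s = r1" using s(1) s' by blast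
    show "\<forall>W. \<forall>u\<in>hom C W R. \<forall>v\<in>hom C W R. r1 \<cdot> u = r1 \<cdot> v \<and> r2 \<cdot> u = r2 \<cdot> v \<longrightarrow> u = v"
    proof (intro allI ballI impI)
      fix W u v assume u: "u \<in> hom C W R" and v: "v \<in> hom C W R" and "r1 \<cdot> u = r1 \<cdot> v \<and> r2 \<cdot> u = r2 \<cdot> v"
      then have "pair C r1 r2 \<cdot> u = pair C r1 r2 \<cdot> v"
        by (rule_tac prod_ext[of _ W X X]) (use r o in auto)
      then show "u = v" by (rule is_monoD[OF jm, rotated 2]) (use u v r in auto)
    qed
  qed (use r tr in blast)+
qed

text \<open>The coequalizer of \<open>x\<close> and \<open>y\<close> is that of the reflexive pair \<open>[1, x]\<close>, \<open>[1, y]\<close>, whose image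
  in \<open>G \<times> G\<close> is an equivalence relation.\<close>

lemma coequalizer_ex:
  assumes x: "x \<in> hom C N G" and y: "y \<in> hom C N G"
  obtains q where "is_coequalizer C x y q"
proof -
  note o = hom_Obj[OF x]
  define h where "h = pair C (copair C (Id C G) x) (copair C (Id C G) y)"
  have h: "h \<in> hom C (coprod_obj C G N) (prod_obj C G G)" using x y o by (simp add: h_def)
  then have hA: "h \<in> Arr C" by simp
  obtain k1 k2 e m where k: "is_pullback C h h k1 k2" and e: "is_coequalizer C k1 k2 e"
    and m: "m \<in> hom C (Cod C e) (Cod C h)" "m \<cdot> e = h" "is_mono C m"
    by (rule image[OF hA])
  note c = coequalizerD[OF e] and p = pullbackD[OF k]
  define r1 r2 where "r1 = pr1 G G \<cdot> m" and "r2 = pr2 G G \<cdot> m"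
  have r: "r1 \<in> hom C (Cod C e) G" "r2 \<in> hom C (Cod C e) G"
    using m h o by (auto simp: r1_def r2_def)
  have dome: "Dom C e = coprod_obj C G N" using c p h by auto
  have re: "r1 \<cdot> e = copair C (Id C G) x" "r2 \<cdot> e = copair C (Id C G) y"
  proof -
    have "r1 \<cdot> e = pr1 G G \<cdot> h" "r2 \<cdot> e = pr2 G G \<cdot> h"
      using m(1) c h o by (simp_all add: r1_def r2_def m(2))
    then show "r1 \<cdot> e = copair C (Id C G) x" "r2 \<cdot> e = copair C (Id C G) y"
      using x y o by (simp_all add: h_def)
  qed
  have "is_equivalence_relation C G r1 r2"
  proof (rule reflexive_relation_equivalence[OF r])
    have "pair C r1 r2 = m"
      by (rule prod_ext[of _ "Cod C e" G G]) (use r m(1) h o in \<open>auto simp: r1_def r2_def\<close>)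
    then show "is_mono C (pair C r1 r2)" using m(3) by simp
  next
    \<comment> \<open>On the summand \<open>G\<close> both components of \<open>h\<close> are the
      identity; this is the diagonal of the relation, and the reason for enlarging \<open>N\<close>
      to \<open>G + N\<close>.\<close>
    show "e \<cdot> inl C G N \<in> hom C G (Cod C e)" using c dome o by auto
    show "r1 \<cdot> (e \<cdot> inl C G N) = Id C G" "r2 \<cdot> (e \<cdot> inl C G N) = Id C G"
      using c dome o r x y by (simp_all add: reassoc[OF re(1)] reassoc[OF re(2)])
  qed
  then obtain g where g: "is_pullback C g g r1 r2"
    using semi_abelian unfolding semi_abelian_def barr_exact_def by blast
  then obtain q where q: "is_coequalizer C r1 r2 q" by (rule coequalizer_kernel_pair)
  note cq = coequalizerD[OF q]
  have dq: "Dom C q = G" using cq r by auto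
  have qe: "q \<cdot> copair C (Id C G) x = q \<cdot> copair C (Id C G) y"
    using cq r c by (simp add: re[symmetric] reassoc[OF cq(7)])
  have "q \<cdot> (copair C (Id C G) x \<cdot> inr C G N) = q \<cdot> (copair C (Id C G) y \<cdot> inr C G N)"
    using x y o cq(5) dq by (simp add: reassoc[OF qe] del: copair_inj)
  then have qxy: "q \<cdot> x = q \<cdot> y" using x y o by simp
  have desc: "\<exists>t. t \<in> hom C (Cod C q) W \<and> t \<cdot> q = u" if u: "u \<in> hom C G W" "u \<cdot> x = u \<cdot> y" for u W
  proof -
    have "u \<cdot> r1 \<cdot> e = u \<cdot> r2 \<cdot> e"
      using u(1) r c(5) x y o by (simp add: re comp_copair u(2))
    then have "u \<cdot> r1 = u \<cdot> r2"
      by (rule coequalizer_epi[OF e, rotated 2]) (use u r in auto)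
    then obtain t where "t \<in> hom C (Cod C q) W" "t \<cdot> q = u"
      by (rule coequalizer_desc[OF q, rotated]) (use u r in auto)
    then show ?thesis by blast
  qed
  have "is_coequalizer C x y q"
    unfolding is_coequalizer_def
  proof (intro conjI allI ballI impI)
    fix W u assume "u \<in> hom C (Cod C x) W" "u \<cdot> x = u \<cdot> y"
    then obtain t where "t \<in> hom C (Cod C q) W" "t \<cdot> q = u" using desc x by auto
    then show "\<exists>!t. t \<in> hom C (Cod C q) W \<and> t \<cdot> q = u"
      using coequalizer_epi[OF q] by blast
  qed (use x y cq dq qxy in auto)
  then show thesis using that by blast
qed

lemma cokernel_ex:
  assumes f: "f \<in> Arr C"
  obtains q where "is_cokernel C f q"
proof -
  note o = Dom_Obj[OF f] Cod_Obj[OF f]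
  obtain q where q: "is_coequalizer C f (zero (Dom C f) (Cod C f)) q"
    by (rule coequalizer_ex[of f "Dom C f" "Cod C f" "zero (Dom C f) (Cod C f)"]) (use f o in auto)
  note c = coequalizerD[OF q]
  have "is_cokernel C f q"
    unfolding is_cokernel_def
  proof (intro conjI allI ballI impI)
    fix W u assume u: "u \<in> hom C (Cod C f) W" "u \<cdot> f = zero (Dom C f) W"
    then have "u \<cdot> f = u \<cdot> zero (Dom C f) (Cod C f)" using o by simp
    then show "\<exists>!t. t \<in> hom C (Cod C q) W \<and> t \<cdot> q = u"
      using q u unfolding is_coequalizer_def by blast
  qed (use c o in auto)
  then show thesis using that by blast
qed

lemma cokernel_epi:
  assumes "is_cokernel C f q" "u \<in> hom C (Cod C q) W" "v \<in> hom C (Cod C q) W" "u \<cdot> q = v \<cdot> q"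
  shows "u = v"
proof -
  note d = cokernelD[OF assms(1)]
  have "u \<cdot> q \<in> hom C (Cod C f) W" "u \<cdot> q \<cdot> f = zero (Dom C f) W"
    using assms(2) d hom_Obj[OF assms(2)] Dom_Obj[OF d(1)] by auto
  then have "\<exists>!t. t \<in> hom C (Cod C q) W \<and> t \<cdot> q = u \<cdot> q"
    using assms(1) unfolding is_cokernel_def by blast
  then show ?thesis using assms by auto
qed

section \<open>Points and the monad of actions\<close>

definition point :: "'o \<Rightarrow> 'o \<Rightarrow> 'a \<Rightarrow> 'a \<Rightarrow> bool" where
  "point B A p s \<longleftrightarrow> p \<in> hom C A B \<and> s \<in> hom C B A \<and> p \<cdot> s = Id C B"

definition point_map :: "'o \<Rightarrow> 'o \<times> 'a \<times> 'a \<Rightarrow> 'a \<Rightarrow> 'o \<times> 'a \<times> 'a \<Rightarrow> bool" where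
  "point_map B x f y \<longleftrightarrow> (x, f, y) \<in> Arr (Pt C B)"

lemma point_map_iff: "point_map B (A, p, s) f (A', p', s') \<longleftrightarrow>
    point B A p s \<and> point B A' p' s' \<and> f \<in> hom C A A' \<and> p' \<cdot> f = p \<and> f \<cdot> s = s'"
  by (auto simp: point_map_def Pt_def Pt_Arr_def Pt_Obj_def point_def)

lemma point_mapD:
  assumes "point_map B (A, p, s) f (A', p', s')"
  shows "p \<in> hom C A B" "s \<in> hom C B A" "p \<cdot> s = Id C B"
    "p' \<in> hom C A' B" "s' \<in> hom C B A'" "p' \<cdot> s' = Id C B"
    "f \<in> hom C A A'" "p' \<cdot> f = p" "f \<cdot> s = s'"
  using assms by (auto simp: point_map_iff point_def)

lemma Pt_simps [simp]:
  "(A, p, s) \<in> Obj (Pt C B) \<longleftrightarrow> point B A p s"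
  "Dom (Pt C B) (x, f, y) = x" "Cod (Pt C B) (x, f, y) = y"
  "Comp (Pt C B) (y, g, z) (x, f, y') = (x, g \<cdot> f, z)"
  "Id (Pt C B) (A, p, s) = ((A, p, s), Id C A, (A, p, s))"
  by (auto simp: Pt_def Pt_Obj_def point_def)

lemma Pt_homE:
  assumes "t \<in> hom (Pt C B) x y"
  obtains f where "t = (x, f, y)" "point_map B x f y"
  using assms by (cases t) (auto simp: hom_def point_map_def)

lemma Pt_homI: "point_map B x f y \<Longrightarrow> (x, f, y) \<in> hom (Pt C B) x y"
  by (simp add: hom_def point_map_def)

lemma category_Pt: "category (Pt C B)"
proof
  fix t assume "t \<in> Arr (Pt C B)"
  then show "Dom (Pt C B) t \<in> Obj (Pt C B)" "Cod (Pt C B) t \<in> Obj (Pt C B)"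
    by (cases t, auto simp: Pt_def Pt_Arr_def)+
next
  fix x assume "x \<in> Obj (Pt C B)"
  then show "Id (Pt C B) x \<in> hom (Pt C B) x x"
    by (cases x) (use Dom_Obj in \<open>auto intro!: Pt_homI simp: point_map_iff point_def\<close>)
next
  fix t u x y z assume "t \<in> hom (Pt C B) x y" "u \<in> hom (Pt C B) y z"
  then obtain f g where tu: "t = (x, f, y)" "u = (y, g, z)" "point_map B x f y" "point_map B y g z"
    by (blast elim: Pt_homE)
  obtain A p s A' p' s' A'' p'' s'' where "x = (A, p, s)" "y = (A', p', s')" "z = (A'', p'', s'')"
    by (cases x, cases y, cases z) blast
  with tu have xyz: "x = (A, p, s)" "y = (A', p', s')" "z = (A'', p'', s'')"
    "point_map B (A, p, s) f (A', p', s')" "point_map B (A', p', s') g (A'', p'', s'')" by auto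
  note d = point_mapD[OF xyz(4)] and e = point_mapD[OF xyz(5)]
  have "point_map B (A, p, s) (g \<cdot> f) (A'', p'', s'')"
    unfolding point_map_iff point_def using d e(4-9) by (simp add: reassoc[OF e(8)])
  then show "Comp (Pt C B) u t \<in> hom (Pt C B) x z"
    using tu(1,2) xyz(1-3) by (simp add: Pt_homI)
next
  fix t x y assume "t \<in> hom (Pt C B) x y"
  then show "Comp (Pt C B) (Id (Pt C B) y) t = t" "Comp (Pt C B) t (Id (Pt C B) x) = t"
    by (cases x, cases y, auto elim!: Pt_homE simp: point_map_iff)+
next
  fix t u v w x y z assume "t \<in> hom (Pt C B) w x" "u \<in> hom (Pt C B) x y" "v \<in> hom (Pt C B) y z"
  then show "Comp (Pt C B) v (Comp (Pt C B) u t) = Comp (Pt C B) (Comp (Pt C B) v u) t"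
    by (cases w, cases x, cases y, cases z) (auto elim!: Pt_homE simp: point_map_iff)
qed

lemma Pt_zero_obj:
  assumes B: "B \<in> Obj C"
  shows "is_zero_obj (Pt C B) (B, Id C B, Id C B)"
  unfolding is_zero_obj_def
proof (intro conjI ballI)
  show "(B, Id C B, Id C B) \<in> Obj (Pt C B)" using B by (simp add: point_def)
  fix x assume "x \<in> Obj (Pt C B)"
  then obtain A p s where x: "x = (A, p, s)" "point B A p s" by (cases x) auto
  show "\<exists>!f. f \<in> hom (Pt C B) x (B, Id C B, Id C B)"
    by (rule ex1I[of _ "(x, p, (B, Id C B, Id C B))"])
      (use x B in \<open>auto elim!: Pt_homE intro!: Pt_homI simp: point_map_iff point_def\<close>)
  show "\<exists>!f. f \<in> hom (Pt C B) (B, Id C B, Id C B) x"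
    by (rule ex1I[of _ "((B, Id C B, Id C B), s, x)"])
      (use x B in \<open>auto elim!: Pt_homE intro!: Pt_homI simp: point_map_iff point_def\<close>)
qed

text \<open>The factorization through the zero object \<open>(B, 1, 1)\<close> is \<open>p\<close>
  followed by \<open>s'\<close>. Vanishing in \<open>Pt C B\<close> therefore means being constant
  along the section, not being zero in \<open>C\<close>.\<close>

lemma Pt_zero_arr:
  assumes "point B A p s" "point B A' p' s'"
  shows "zero_arr (Pt C B) (A, p, s) (A', p', s') = ((A, p, s), s' \<cdot> p, (A', p', s'))"
proof -
  have B: "B \<in> Obj C" using assms hom_Obj by (auto simp: point_def)
  have "zero_arr (Pt C B) (A, p, s) (A', p', s') =
      Comp (Pt C B) ((B, Id C B, Id C B), s', (A', p', s')) ((A, p, s), p, (B, Id C B, Id C B))"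
    by (rule category.zero_arr_eq[OF category_Pt Pt_zero_obj[OF B]]; rule Pt_homI)
      (use assms B in \<open>auto simp: point_map_iff point_def\<close>)
  then show ?thesis by simp
qed

text \<open>An arrow out of \<open>A1\<close> is determined by its restrictions to \<open>s1\<close>
  and \<open>k\<close>. A morphism of points composed with \<open>f\<close> is thus zero in
  \<open>Pt C B\<close> exactly when it kills \<open>f \<cdot> k\<close> in \<open>C\<close>, and
  the cokernel can be computed there.\<close>

lemma point_cokernel:
  assumes f: "point_map B (A1, p1, s1) f (A, p, s)" and k: "is_kernel C p1 k"
    and q: "is_cokernel C (f \<cdot> k) q"
  obtains p' s' where "point_map B (A, p, s) q (Cod C q, p', s')"
    "is_cokernel (Pt C B) ((A1, p1, s1), f, (A, p, s)) ((A, p, s), q, (Cod C q, p', s'))"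
proof -
  note d = point_mapD[OF f] and dk = kernelD[OF k] and dq = cokernelD[OF q]
  have B: "B \<in> Obj C" using hom_Obj[OF d(1)] by simp
  have fk: "Cod C (f \<cdot> k) = A" "Dom C (f \<cdot> k) = Dom C k" using d dk by auto
  have o: "Dom C k \<in> Obj C" "Cod C q \<in> Obj C" using dk dq Dom_Obj Cod_Obj by auto
  obtain p' where p': "p' \<in> hom C (Cod C q) B" "p' \<cdot> q = p"
    by (rule cokernel_desc[OF q, of p B]) (use d dk fk in \<open>auto simp: reassoc[OF d(8)]\<close>)
  have qm: "point_map B (A, p, s) q (Cod C q, p', q \<cdot> s)"
    using d p' dq fk by (auto simp: point_map_iff point_def reassoc[OF p'(2)])
  have qf: "q \<cdot> f = q \<cdot> s \<cdot> p1"
    by (rule point_ext[OF d(1-3) k, of _ "Cod C q"])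
      (use d dk dq fk o in auto)
  have "is_cokernel (Pt C B) ((A1, p1, s1), f, (A, p, s)) ((A, p, s), q, (Cod C q, p', q \<cdot> s))"
    unfolding is_cokernel_def
  proof (intro conjI allI ballI impI)
    show "((A1, p1, s1), f, (A, p, s)) \<in> Arr (Pt C B)" using f by (simp add: point_map_def)
    show "((A, p, s), q, (Cod C q, p', q \<cdot> s))
        \<in> hom (Pt C B) (Cod (Pt C B) ((A1, p1, s1), f, (A, p, s)))
          (Cod (Pt C B) ((A, p, s), q, (Cod C q, p', q \<cdot> s)))"
      using Pt_homI[OF qm] by simp
    show "Comp (Pt C B) ((A, p, s), q, (Cod C q, p', q \<cdot> s)) ((A1, p1, s1), f, (A, p, s)) =
        zero_arr (Pt C B) (Dom (Pt C B) ((A1, p1, s1), f, (A, p, s)))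
          (Cod (Pt C B) ((A, p, s), q, (Cod C q, p', q \<cdot> s)))"
      using f qm by (simp add: Pt_zero_arr qf point_map_iff)
    fix w u assume u: "u \<in> hom (Pt C B) (Cod (Pt C B) ((A1, p1, s1), f, (A, p, s))) w"
      and uz: "Comp (Pt C B) u ((A1, p1, s1), f, (A, p, s)) =
        zero_arr (Pt C B) (Dom (Pt C B) ((A1, p1, s1), f, (A, p, s))) w"
    obtain W pW sW where w: "w = (W, pW, sW)" by (cases w) auto
    obtain u0 where u0: "u = ((A, p, s), u0, (W, pW, sW))" "point_map B (A, p, s) u0 (W, pW, sW)"
      using u w by (auto elim: Pt_homE)
    note du = point_mapD[OF u0(2)]
    have "u0 \<cdot> f = sW \<cdot> p1"
      using uz f u0 w by (simp add: Pt_zero_arr point_map_iff)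
    then have "u0 \<cdot> (f \<cdot> k) = zero (Dom C k) W"
      using du d dk o B by (simp add: reassoc)
    then obtain t where t: "t \<in> hom C (Cod C q) W" "t \<cdot> q = u0"
      by (rule cokernel_desc[OF q, rotated, unfolded fk]) (use du in auto)
    have "pW \<cdot> t \<cdot> q = p' \<cdot> q" using t du p' dq fk by simp
    then have "pW \<cdot> t = p'" by (rule cokernel_epi[OF q, rotated 2]) (use t du p' in auto)
    then have "point_map B (Cod C q, p', q \<cdot> s) t w"
      using qm u0 t du d dq fk unfolding w point_map_iff by (auto simp: reassoc[OF t(2)])
    show "\<exists>!t. t \<in> hom (Pt C B) (Cod (Pt C B) ((A, p, s), q, (Cod C q, p', q \<cdot> s))) w \<and>
        Comp (Pt C B) t ((A, p, s), q, (Cod C q, p', q \<cdot> s)) = u"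
    proof (rule ex1I[of _ "((Cod C q, p', q \<cdot> s), t, w)"])
      fix t' assume t': "t' \<in> hom (Pt C B) (Cod (Pt C B) ((A, p, s), q, (Cod C q, p', q \<cdot> s))) w \<and>
        Comp (Pt C B) t' ((A, p, s), q, (Cod C q, p', q \<cdot> s)) = u"
      then obtain t0 where t0: "t' = ((Cod C q, p', q \<cdot> s), t0, w)" "point_map B (Cod C q, p', q \<cdot> s) t0 w"
        by (auto elim: Pt_homE)
      have "t0 = t"
        by (rule cokernel_epi[OF q]) (use t' t0 t u0 w point_mapD(7) in auto)
      then show "t' = ((Cod C q, p', q \<cdot> s), t, w)" using t0 by simp
    qed (use Pt_homI \<open>point_map B (Cod C q, p', q \<cdot> s) t w\<close> t u0 w in auto)
  qed
  with qm show thesis using that by blast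
qed

section \<open>The kernel functor, the monad it induces, and conjugation actions\<close>

lemma Ker_fun_arr:
  assumes f: "point_map B (A, p, s) f (A', p', s')"
  shows "farr (Ker_fun C B) ((A, p, s), f, (A', p', s')) \<in> hom C (Dom C (ker C p)) (Dom C (ker C p'))"
    "ker C p' \<cdot> farr (Ker_fun C B) ((A, p, s), f, (A', p', s')) = f \<cdot> ker C p"
proof -
  note d = point_mapD[OF f]
  have B: "B \<in> Obj C" using hom_Obj[OF d(1)] by simp
  have k': "is_kernel C p' (ker C p')" using d ker by simp
  have "\<exists>!g. g \<in> hom C (Dom C (ker C p)) (Dom C (ker C p')) \<and> ker C p' \<cdot> g = f \<cdot> ker C p"
  proof -
    have "f \<cdot> ker C p \<in> hom C (Dom C (ker C p)) (Dom C p')"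
      "p' \<cdot> (f \<cdot> ker C p) = zero (Dom C (ker C p)) (Cod C p')"
      using d B by (auto simp: reassoc[OF d(8)])
    then show ?thesis using k' unfolding is_kernel_def by blast
  qed
  from theI'[OF this] show
    "farr (Ker_fun C B) ((A, p, s), f, (A', p', s')) \<in> hom C (Dom C (ker C p)) (Dom C (ker C p'))"
    "ker C p' \<cdot> farr (Ker_fun C B) ((A, p, s), f, (A', p', s')) = f \<cdot> ker C p"
    by (simp_all add: Ker_fun_def)
qed

text \<open>The inclusion of the object part \<open>bf B X\<close> of the monad into
  \<open>B + X\<close>. Being a kernel it is monic, and equations in the monad are verified after
  composing with it.\<close>

abbreviation kap :: "'o \<Rightarrow> 'o \<Rightarrow> 'a" where "kap B X \<equiv> ker C (copair C (Id C B) (zero X B))"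
abbreviation bf :: "'o \<Rightarrow> 'o \<Rightarrow> 'o" where "bf B X \<equiv> Dom C (kap B X)"
abbreviation bfa :: "'o \<Rightarrow> 'a \<Rightarrow> 'a" where "bfa B \<equiv> farr (bflat C B)"

lemma bflat_obj [simp]: "fobj (bflat C B) X = bf B X"
  by (simp add: bflat_def fun_comp_def Ker_fun_def plus_fun_def plus_pt_def)

lemma plus_point:
  assumes "B \<in> Obj C" "X \<in> Obj C"
  shows "point B (coprod_obj C B X) (copair C (Id C B) (zero X B)) (inl C B X)"
  using assms by (auto simp: point_def)

lemma copair_zero_kap:
  assumes "B \<in> Obj C" "X \<in> Obj C" "s \<in> hom C B A"
  shows "copair C s (zero X A) \<cdot> kap B X = zero (bf B X) A"
proof -
  have "copair C s (zero X A) = s \<cdot> copair C (Id C B) (zero X B)"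
    using assms by (simp add: comp_copair)
  then show ?thesis using assms by simp
qed

lemma kap_kernel:
  assumes "B \<in> Obj C" "X \<in> Obj C"
  shows "is_kernel C (copair C (Id C B) (zero X B)) (kap B X)"
  using assms by (simp add: ker)

lemma kap_simps [simp]:
  assumes "B \<in> Obj C" "X \<in> Obj C"
  shows "kap B X \<in> Arr C" "Cod C (kap B X) = coprod_obj C B X" "bf B X \<in> Obj C"
  using assms by simp_all

lemma bflat_arr:
  assumes B: "B \<in> Obj C" and f: "f \<in> hom C X Y"
  shows "bfa B f \<in> hom C (bf B X) (bf B Y)"
    "kap B Y \<cdot> bfa B f = copair C (inl C B Y) (inr C B Y \<cdot> f) \<cdot> kap B X"
proof -
  note o = hom_Obj[OF f]
  have "copair C (Id C B) (zero Y B) \<cdot> copair C (inl C B Y) (inr C B Y \<cdot> f) = copair C (Id C B) (zero X B)"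
    using B f o by (simp add: comp_copair)
  then have m: "point_map B (plus_pt C B X) (copair C (inl C B Y) (inr C B Y \<cdot> f)) (plus_pt C B Y)"
    using plus_point[OF B, of X] plus_point[OF B, of Y] B f o by (simp add: plus_pt_def point_map_iff)
  have e: "bfa B f = farr (Ker_fun C B)
      (plus_pt C B X, copair C (inl C B Y) (inr C B Y \<cdot> f), plus_pt C B Y)"
    using f by (simp add: bflat_def fun_comp_def plus_fun_def)
  show "bfa B f \<in> hom C (bf B X) (bf B Y)"
    "kap B Y \<cdot> bfa B f = copair C (inl C B Y) (inr C B Y \<cdot> f) \<cdot> kap B X"
    using Ker_fun_arr[OF m[unfolded plus_pt_def]] by (simp_all add: e plus_pt_def)
qed

lemma bflat_arr_simps [simp]:
  assumes "B \<in> Obj C" "f \<in> Arr C"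
  shows "bfa B f \<in> Arr C" "Dom C (bfa B f) = bf B (Dom C f)" "Cod C (bfa B f) = bf B (Cod C f)"
  using bflat_arr(1)[OF assms(1), of f "Dom C f" "Cod C f"] assms(2) by auto

text \<open>The restriction of \<open>B + f\<close> to kernels is \<open>bfa B f\<close>. The rule
  moves an arrow in and out of the conjugation formula
  \<open>copair C s j \<cdot> kap B Y\<close>.\<close>

lemma copair_bflat:
  assumes "B \<in> Obj C" "f \<in> hom C X Y" "s \<in> hom C B A" "j \<in> hom C Y A"
  shows "copair C s j \<cdot> (kap B Y \<cdot> bfa B f) = copair C s (j \<cdot> f) \<cdot> kap B X"
proof -
  note o = hom_Obj[OF assms(2)] assms(1)
  have "copair C s j \<cdot> copair C (inl C B Y) (inr C B Y \<cdot> f) = copair C s (j \<cdot> f)"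
    using assms o by (simp add: comp_copair)
  from reassoc[OF this, of "kap B X"] show ?thesis
    using assms o by (simp add: bflat_arr(2)[OF assms(1,2)])
qed

lemma kap_cancel:
  assumes "B \<in> Obj C" "X \<in> Obj C" "u \<in> hom C W (bf B X)" "v \<in> hom C W (bf B X)"
    "kap B X \<cdot> u = kap B X \<cdot> v"
  shows "u = v"
  using kernel_cancel[OF kap_kernel[OF assms(1,2)] assms(3-5)] .

lemma bflat_comp:
  assumes B: "B \<in> Obj C" and f: "f \<in> hom C X Y" and g: "g \<in> hom C Y Z"
  shows "bfa B (g \<cdot> f) = bfa B g \<cdot> bfa B f"
proof (rule kap_cancel[OF B, of Z _ "bf B X"])
  note o = hom_Obj[OF f] hom_Obj[OF g]
  show "Z \<in> Obj C" using o by simp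
  have gf: "g \<cdot> f \<in> hom C X Z" using f g by simp
  show "kap B Z \<cdot> bfa B (g \<cdot> f) = kap B Z \<cdot> (bfa B g \<cdot> bfa B f)"
    using copair_bflat[OF B f, of "inl C B Z" "coprod_obj C B Z" "inr C B Z \<cdot> g"] B f g o
    by (simp add: bflat_arr(2)[OF B gf] reassoc[OF bflat_arr(2)[OF B g]])
qed (use B f g in auto)

lemma bflat_zero:
  assumes "B \<in> Obj C" "X \<in> Obj C" "Y \<in> Obj C"
  shows "bfa B (zero X Y) = zero (bf B X) (bf B Y)"
proof (rule kap_cancel[OF assms(1,3), of _ "bf B X"])
  have "zero X Y \<in> hom C X Y" using assms by simp
  from bflat_arr(2)[OF assms(1) this]
  show "kap B Y \<cdot> bfa B (zero X Y) = kap B Y \<cdot> zero (bf B X) (bf B Y)"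
    using assms copair_zero_kap[OF assms(1,2), of "inl C B Y" "coprod_obj C B Y"] by simp
qed (use assms in auto)

lemma bflat_unit_props:
  assumes "B \<in> Obj C" "X \<in> Obj C"
  shows "bflat_unit C B X \<in> hom C X (bf B X)" "kap B X \<cdot> bflat_unit C B X = inr C B X"
proof -
  have "inr C B X \<in> hom C X (Dom C (copair C (Id C B) (zero X B)))"
    "copair C (Id C B) (zero X B) \<cdot> inr C B X = zero X (Cod C (copair C (Id C B) (zero X B)))"
    using assms by auto
  then have "\<exists>!e. e \<in> hom C X (bf B X) \<and> kap B X \<cdot> e = inr C B X"
    using kap_kernel[OF assms] unfolding is_kernel_def by blast
  from theI'[OF this] show "bflat_unit C B X \<in> hom C X (bf B X)" "kap B X \<cdot> bflat_unit C B X = inr C B X"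
    by (simp_all add: bflat_unit_def)
qed

lemma bflat_unit_simps [simp]:
  assumes "B \<in> Obj C" "X \<in> Obj C"
  shows "bflat_unit C B X \<in> Arr C" "Dom C (bflat_unit C B X) = X" "Cod C (bflat_unit C B X) = bf B X"
  using bflat_unit_props(1)[OF assms] by auto

lemma bflat_unit_natural:
  assumes B: "B \<in> Obj C" and f: "f \<in> hom C X Y"
  shows "bfa B f \<cdot> bflat_unit C B X = bflat_unit C B Y \<cdot> f"
proof (rule kap_cancel[OF B, of Y _ X])
  note o = hom_Obj[OF f]
  show "kap B Y \<cdot> (bfa B f \<cdot> bflat_unit C B X) = kap B Y \<cdot> (bflat_unit C B Y \<cdot> f)"
    using B f o
    by (simp add: reassoc[OF bflat_arr(2)[OF B f]] reassoc[OF bflat_unit_props(2)] bflat_unit_props(2))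
qed (use B f hom_Obj[OF f] in auto)

lemma bflat_mult_props:
  assumes B: "B \<in> Obj C" and X: "X \<in> Obj C"
  shows "bflat_mult C B X \<in> hom C (bf B (bf B X)) (bf B X)"
    "kap B X \<cdot> bflat_mult C B X = copair C (inl C B X) (kap B X) \<cdot> kap B (bf B X)"
proof -
  have "copair C (Id C B) (zero X B) \<cdot> copair C (inl C B X) (kap B X) =
      copair C (Id C B) (zero (bf B X) B)"
    using B X by (simp add: comp_copair)
  then have m: "point_map B (plus_pt C B (bf B X)) (copair C (inl C B X) (kap B X)) (plus_pt C B X)"
    using plus_point[OF B X] plus_point[OF B, of "bf B X"] B X by (simp add: plus_pt_def point_map_iff)
  have e: "bflat_mult C B X = farr (Ker_fun C B)
      (plus_pt C B (bf B X), copair C (inl C B X) (kap B X), plus_pt C B X)"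
    by (simp add: bflat_mult_def pt_counit_def plus_fun_def Ker_fun_def plus_pt_def)
  show "bflat_mult C B X \<in> hom C (bf B (bf B X)) (bf B X)"
    "kap B X \<cdot> bflat_mult C B X = copair C (inl C B X) (kap B X) \<cdot> kap B (bf B X)"
    using Ker_fun_arr[OF m[unfolded plus_pt_def]] by (simp_all add: e plus_pt_def)
qed

lemma bflat_mult_natural:
  assumes B: "B \<in> Obj C" and f: "f \<in> hom C X Y"
  shows "bfa B f \<cdot> bflat_mult C B X = bflat_mult C B Y \<cdot> bfa B (bfa B f)"
proof (rule kap_cancel[OF B, of Y _ "bf B (bf B X)"])
  note o = hom_Obj[OF f]
  note mX = bflat_mult_props[OF B, of X] and mY = bflat_mult_props[OF B, of Y]
  have "kap B Y \<cdot> (bfa B f \<cdot> bflat_mult C B X) =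
      copair C (inl C B Y) (inr C B Y \<cdot> f) \<cdot> (kap B X \<cdot> bflat_mult C B X)"
    using B f o mX(1) by (simp add: reassoc[OF bflat_arr(2)[OF B f]])
  also have "\<dots> = copair C (inl C B Y) (inr C B Y \<cdot> f) \<cdot> copair C (inl C B X) (kap B X) \<cdot> kap B (bf B X)"
    using B f o mX by simp
  also have "copair C (inl C B Y) (inr C B Y \<cdot> f) \<cdot> copair C (inl C B X) (kap B X) =
      copair C (inl C B Y) (kap B Y \<cdot> bfa B f)"
    using B f o by (simp add: comp_copair bflat_arr(2)[OF B f])
  also have "\<dots> \<cdot> kap B (bf B X) = copair C (inl C B Y) (kap B Y) \<cdot> (kap B (bf B Y) \<cdot> bfa B (bfa B f))"
    by (rule copair_bflat[symmetric]) (use B f o in auto)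
  also have "\<dots> = kap B Y \<cdot> (bflat_mult C B Y \<cdot> bfa B (bfa B f))"
    using B f o mY(1) by (simp add: reassoc[OF mY(2)])
  finally show "kap B Y \<cdot> (bfa B f \<cdot> bflat_mult C B X) = kap B Y \<cdot> (bflat_mult C B Y \<cdot> bfa B (bfa B f))" .
qed (use B f hom_Obj[OF f] bflat_mult_props[OF B, of X] bflat_mult_props[OF B, of Y] in auto)

text \<open>Both algebra laws can be tested after the monomorphism \<open>l\<close>, where
  naturality of unit and multiplication reduces them to the laws of \<open>xi\<close>. Restricting
  an action to a subobject thus only requires finding the arrow.\<close>

lemma action_restrict:
  assumes B: "B \<in> Obj C" and act: "is_action C B G xi" and l: "is_mono C l" "l \<in> hom C L G"
    and xi': "xi' \<in> hom C (bf B L) L" "l \<cdot> xi' = xi \<cdot> bfa B l"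
  shows "is_action C B L xi'"
proof -
  have x: "xi \<in> hom C (bf B G) G" "xi \<cdot> bflat_unit C B G = Id C G"
    "xi \<cdot> bflat_mult C B G = xi \<cdot> bfa B xi"
    using act by (auto simp: is_action_def)
  note o = hom_Obj[OF l(2)]
  note mL = bflat_mult_props[OF B, of L] and mG = bflat_mult_props[OF B, of G]
  have "xi' \<cdot> bflat_unit C B L = Id C L"
  proof (rule is_monoD[OF l(1), of _ L])
    have "l \<cdot> (xi' \<cdot> bflat_unit C B L) = xi \<cdot> (bflat_unit C B G \<cdot> l)"
      using B x(1) l xi'(1) o by (simp add: reassoc[OF xi'(2)] bflat_unit_natural[OF B l(2)])
    then show "l \<cdot> (xi' \<cdot> bflat_unit C B L) = l \<cdot> Id C L"
      using B x(1) l o by (simp add: reassoc[OF x(2)])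
  qed (use B l xi' o in auto)
  moreover have "xi' \<cdot> bflat_mult C B L = xi' \<cdot> bfa B xi'"
  proof (rule is_monoD[OF l(1), of _ "bf B (bf B L)"])
    have "l \<cdot> (xi' \<cdot> bflat_mult C B L) = xi \<cdot> (bflat_mult C B G \<cdot> bfa B (bfa B l))"
      using B x(1) l xi'(1) o mL(1) by (simp add: reassoc[OF xi'(2)] bflat_mult_natural[OF B l(2)])
    also have "\<dots> = xi \<cdot> (bfa B xi \<cdot> bfa B (bfa B l))"
      using B x(1) l o mG(1) by (simp add: reassoc[OF x(3)])
    also have "bfa B xi \<cdot> bfa B (bfa B l) = bfa B l \<cdot> bfa B xi'"
      using bflat_comp[OF B xi'(1) l(2)] bflat_comp[OF B, of "bfa B l" "bf B L" "bf B G" xi G] B l o x(1)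
      by (simp add: xi'(2))
    also have "xi \<cdot> (bfa B l \<cdot> bfa B xi') = l \<cdot> (xi' \<cdot> bfa B xi')"
      using B x(1) l o xi'(1) by (simp add: reassoc[OF xi'(2)])
    finally show "l \<cdot> (xi' \<cdot> bflat_mult C B L) = l \<cdot> (xi' \<cdot> bfa B xi')" .
  qed (use B l xi' o mL in auto)
  ultimately show ?thesis using xi' by (simp add: is_action_def)
qed

text \<open>The hypotheses \<open>j \<cdot> xi = [s, j] \<cdot> kap\<close> say that \<open>xi\<close> is the conjugation action of the point on its kernel.\<close>

lemma kernel_map_equivariant:
  assumes B: "B \<in> Obj C" and s: "s \<in> hom C B A" and j: "j \<in> hom C X A"
    and xi: "xi \<in> hom C (bf B X) X" "j \<cdot> xi = copair C s j \<cdot> kap B X"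
    and s': "s' \<in> hom C B A'" and j': "j' \<in> hom C X' A'" "is_mono C j'"
    and xi': "xi' \<in> hom C (bf B X') X'" "j' \<cdot> xi' = copair C s' j' \<cdot> kap B X'"
    and t: "t \<in> hom C A A'" "t \<cdot> s = s'" and t0: "t0 \<in> hom C X X'" "j' \<cdot> t0 = t \<cdot> j"
  shows "t0 \<cdot> xi = xi' \<cdot> bfa B t0"
proof (rule is_monoD[OF j'(2), of _ "bf B X"])
  note o = hom_Obj[OF j] hom_Obj[OF j'(1)]
  have "j' \<cdot> (t0 \<cdot> xi) = t \<cdot> (j \<cdot> xi)"
    using j xi(1) j'(1) t t0(1) by (simp add: reassoc[OF t0(2)])
  also have "\<dots> = copair C s' (j' \<cdot> t0) \<cdot> kap B X"
  proof -
    have "t \<cdot> copair C s j = copair C s' (j' \<cdot> t0)"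
      using j s t t0(2) by (simp add: comp_copair)
    from reassoc[OF this, of "kap B X"] show ?thesis using B s j t o by (simp add: xi(2))
  qed
  also have "\<dots> = copair C s' j' \<cdot> (kap B X' \<cdot> bfa B t0)"
    by (rule copair_bflat[symmetric]) (use B s' j' t0 in auto)
  also have "\<dots> = j' \<cdot> (xi' \<cdot> bfa B t0)"
    using B s' j'(1) t0(1) xi'(1) o by (simp add: reassoc[OF xi'(2)])
  finally show "j' \<cdot> (t0 \<cdot> xi) = j' \<cdot> (xi' \<cdot> bfa B t0)" .
qed (use B j' xi xi' t0 in auto)

text \<open>Since \<open>p\<close> composed with \<open>[s, j]\<close> is \<open>[1, 0]\<close>,
  whose kernel is \<open>kap\<close>, the composite \<open>[s, j] \<cdot> kap\<close> lands in the
  kernel of \<open>p\<close>.\<close>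

lemma conjugation_ex:
  assumes "point B A p s" "is_kernel C p j"
  obtains xi where "xi \<in> hom C (bf B (Dom C j)) (Dom C j)" "j \<cdot> xi = copair C s j \<cdot> kap B (Dom C j)"
proof -
  have d: "p \<in> hom C A B" "s \<in> hom C B A" "p \<cdot> s = Id C B" using assms by (auto simp: point_def)
  note k = kernelD[OF assms(2)]
  have o: "B \<in> Obj C" "Dom C j \<in> Obj C" using hom_Obj[OF d(1)] Dom_Obj[OF k(2)] by auto
  have "p \<cdot> copair C s j = copair C (Id C B) (zero (Dom C j) B)"
    using d k by (simp add: comp_copair)
  from reassoc[OF this, of "kap B (Dom C j)"]
  have "p \<cdot> (copair C s j \<cdot> kap B (Dom C j)) = zero (bf B (Dom C j)) B" using d k o by simp
  then show thesis
    by (intro kernel_lift[OF assms(2), of "copair C s j \<cdot> kap B (Dom C j)" "bf B (Dom C j)", OF _ _ that])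
      (use d k o in auto)
qed

end

section \<open>Semidirect products\<close>

locale kernel_preserving_category = semi_abelian_category +
  assumes pres_jse: "B \<in> Obj C \<Longrightarrow> preserves_jointly_strongly_epi_pairs (Pt C B) C (Ker_fun C B)"
    and pres_coker: "B \<in> Obj C \<Longrightarrow> preserves_cokernels (Pt C B) C (Ker_fun C B)"
begin

text \<open>Preservation of jointly strongly epimorphic pairs speaks of the chosen kernels; the
  comparisons \<open>w\<close>, \<open>w1\<close>, \<open>w2\<close> transport it to arbitrary ones.
  Joint epimorphicity follows because the equalizer of two arrows agreeing on the pair cannot be a
  proper subobject.\<close>

lemma jointly_epi_kernels:
  assumes f: "point_map B (A1, p1, s1) f (A, p, s)" and g: "point_map B (A2, p2, s2) g (A, p, s)"
    and jse: "jointly_strongly_epi (Pt C B) ((A1, p1, s1), f, (A, p, s)) ((A2, p2, s2), g, (A, p, s))"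
    and k: "is_kernel C p1 k1" "is_kernel C p2 k2" "is_kernel C p k"
    and f0: "f0 \<in> hom C (Dom C k1) (Dom C k)" "k \<cdot> f0 = f \<cdot> k1"
    and g0: "g0 \<in> hom C (Dom C k2) (Dom C k)" "k \<cdot> g0 = g \<cdot> k2"
    and u: "u \<in> hom C (Dom C k) W" and v: "v \<in> hom C (Dom C k) W"
    and uv: "u \<cdot> f0 = v \<cdot> f0" "u \<cdot> g0 = v \<cdot> g0"
  shows "u = v"
proof -
  note df = point_mapD[OF f] and dg = point_mapD[OF g]
  note dk = kernelD[OF k(1)] kernelD[OF k(2)] kernelD[OF k(3)]
  have B: "B \<in> Obj C" using hom_Obj[OF df(1)] by simp
  define F where "F = farr (Ker_fun C B) ((A1, p1, s1), f, (A, p, s))"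
  define G where "G = farr (Ker_fun C B) ((A2, p2, s2), g, (A, p, s))"
  note F = Ker_fun_arr[OF f, folded F_def] and G = Ker_fun_arr[OF g, folded G_def]
  have j: "jointly_strongly_epi C F G"
    using pres_jse[OF B] jse unfolding preserves_jointly_strongly_epi_pairs_def F_def G_def by blast
  have K: "is_kernel C p (ker C p)" "is_kernel C p1 (ker C p1)" "is_kernel C p2 (ker C p2)"
    using dk ker by auto
  note dK = kernelD[OF K(1)] kernelD[OF K(2)] kernelD[OF K(3)]
  obtain w w' where w: "w \<in> hom C (Dom C (ker C p)) (Dom C k)" "k \<cdot> w = ker C p"
    "w' \<in> hom C (Dom C k) (Dom C (ker C p))" "w \<cdot> w' = Id C (Dom C k)"
    by (rule kernel_unique[OF K(1) k(3)])
  obtain w1 where w1: "w1 \<in> hom C (Dom C (ker C p1)) (Dom C k1)" "k1 \<cdot> w1 = ker C p1"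
    by (rule kernel_unique[OF K(2) k(1)])
  obtain w2 where w2: "w2 \<in> hom C (Dom C (ker C p2)) (Dom C k2)" "k2 \<cdot> w2 = ker C p2"
    by (rule kernel_unique[OF K(3) k(2)])
  have wF: "w \<cdot> F = f0 \<cdot> w1"
    by (rule kernel_cancel[OF k(3), of _ "Dom C (ker C p1)"])
      (use w(1) w1 F f0(1) df dk in \<open>auto simp: reassoc[OF w(2)] reassoc[OF f0(2)]\<close>)
  have wG: "w \<cdot> G = g0 \<cdot> w2"
    by (rule kernel_cancel[OF k(3), of _ "Dom C (ker C p2)"])
      (use w(1) w2 G g0(1) dg dk in \<open>auto simp: reassoc[OF w(2)] reassoc[OF g0(2)]\<close>)
  have e: "u \<cdot> w \<cdot> F = v \<cdot> w \<cdot> F"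
    using u v w(1) F(1) w1(1) f0(1) by (simp add: wF reassoc[OF uv(1)])
  have e': "u \<cdot> w \<cdot> G = v \<cdot> w \<cdot> G"
    using u v w(1) G(1) w2(1) g0(1) by (simp add: wG reassoc[OF uv(2)])
  have uw: "u \<cdot> w \<in> hom C (Dom C (ker C p)) W" "v \<cdot> w \<in> hom C (Dom C (ker C p)) W"
    using u v w by auto
  obtain m where m: "is_mono C m" "Cod C m = Dom C (ker C p)" "u \<cdot> w \<cdot> m = v \<cdot> w \<cdot> m"
    "\<And>W' x. x \<in> hom C W' (Dom C (ker C p)) \<Longrightarrow> u \<cdot> w \<cdot> x = v \<cdot> w \<cdot> x \<Longrightarrow> \<exists>t\<in>hom C W' (Dom C m). m \<cdot> t = x"
    using equalizer[OF uw] by blast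
  have "is_iso C m"
    using j m(1,2) m(4)[OF F(1) e] m(4)[OF G(1) e'] F(1) G(1)
    unfolding jointly_strongly_epi_def is_subobject_def by auto
  then obtain n where n: "n \<in> hom C (Dom C (ker C p)) (Dom C m)" "m \<cdot> n = Id C (Dom C (ker C p))" "m \<in> Arr C"
    using m(2) by (auto simp: is_iso_def)
  have "u \<cdot> w \<cdot> (m \<cdot> n) = v \<cdot> w \<cdot> (m \<cdot> n)"
    by (subst (1 2) comp_assoc[symmetric]) (use uw n(1,3) m(2,3) in auto)
  then have uww: "u \<cdot> w = v \<cdot> w" using n uw by auto
  have "u \<cdot> (w \<cdot> w') = v \<cdot> (w \<cdot> w')" using u v w(1,3) by (simp add: reassoc[OF uww])
  then show ?thesis using w(4) u v by auto
qed

text \<open>Preservation of cokernels, combined with the computation of cokernels of points in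
  \<open>C\<close> and transported from the chosen kernels to arbitrary kernels \<open>k1\<close>
  and \<open>k\<close>.\<close>

lemma cokernel_kernels:
  assumes f: "point_map B (A1, p1, s1) f (A, p, s)"
    and k: "is_kernel C p1 k1" "is_kernel C p k"
    and f0: "f0 \<in> hom C (Dom C k1) (Dom C k)" "k \<cdot> f0 = f \<cdot> k1"
  obtains q p' s' k' q0 where "is_cokernel C (f \<cdot> k1) q" "point_map B (A, p, s) q (Cod C q, p', s')"
    "is_kernel C p' k'" "q0 \<in> hom C (Dom C k) (Dom C k')" "k' \<cdot> q0 = q \<cdot> k" "is_cokernel C f0 q0"
proof -
  note d = point_mapD[OF f]
  note dk = kernelD[OF k(1)] kernelD[OF k(2)]
  have B: "B \<in> Obj C" using hom_Obj[OF d(1)] by simp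
  have "f \<cdot> k1 \<in> Arr C" using d dk by auto
  then obtain q where q: "is_cokernel C (f \<cdot> k1) q" by (rule cokernel_ex)
  obtain p' s' where qm: "point_map B (A, p, s) q (Cod C q, p', s')"
    and qc: "is_cokernel (Pt C B) ((A1, p1, s1), f, (A, p, s)) ((A, p, s), q, (Cod C q, p', s'))"
    by (rule point_cokernel[OF f k(1) q])
  note dq = point_mapD[OF qm]
  define F where "F = farr (Ker_fun C B) ((A1, p1, s1), f, (A, p, s))"
  define Q where "Q = farr (Ker_fun C B) ((A, p, s), q, (Cod C q, p', s'))"
  note F = Ker_fun_arr[OF f, folded F_def] and Q = Ker_fun_arr[OF qm, folded Q_def]
  have FQ: "is_cokernel C F Q"
    using pres_coker[OF B] qc unfolding preserves_cokernels_def F_def Q_def by blast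
  have K: "is_kernel C p (ker C p)" "is_kernel C p1 (ker C p1)" "is_kernel C p' (ker C p')"
    using dk dq ker by auto
  note dK = kernelD[OF K(1)] kernelD[OF K(2)] kernelD[OF K(3)] and dFQ = cokernelD[OF FQ]
  obtain w w' where w: "w \<in> hom C (Dom C (ker C p)) (Dom C k)" "k \<cdot> w = ker C p"
    "w' \<in> hom C (Dom C k) (Dom C (ker C p))" "ker C p \<cdot> w' = k"
    "w \<cdot> w' = Id C (Dom C k)" "w' \<cdot> w = Id C (Dom C (ker C p))"
    by (rule kernel_unique[OF K(1) k(2)])
  obtain w1 w1' where w1: "w1 \<in> hom C (Dom C (ker C p1)) (Dom C k1)" "k1 \<cdot> w1 = ker C p1"
    "w1' \<in> hom C (Dom C k1) (Dom C (ker C p1))" "ker C p1 \<cdot> w1' = k1"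
    by (rule kernel_unique[OF K(2) k(1)])
  note o = hom_Obj[OF w(1)] hom_Obj[OF w1(1)] hom_Obj[OF Q(1)]
  have wf: "w' \<cdot> f0 = F \<cdot> w1'"
    by (rule kernel_cancel[OF K(1), of _ "Dom C k1"])
      (use w(1,3) w1(1,3) F f0 d dk in \<open>auto simp: reassoc[OF w(4)] reassoc[OF F(2)] w1(4)\<close>)
  have wF: "w \<cdot> F = f0 \<cdot> w1"
    by (rule kernel_cancel[OF k(2), of _ "Dom C (ker C p1)"])
      (use w(1) w1(1,2) F f0(1) d dk in \<open>auto simp: reassoc[OF w(2)] reassoc[OF f0(2)]\<close>)
  have "is_cokernel C f0 (Q \<cdot> w')"
    unfolding is_cokernel_def
  proof (intro conjI allI ballI impI)
    show "Q \<cdot> w' \<cdot> f0 = zero (Dom C f0) (Cod C (Q \<cdot> w'))"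
      using Q(1) w(3) f0(1) F(1) w1(3) dFQ(4) o by (simp add: wf reassoc[OF dFQ(4)])
    fix W u assume u: "u \<in> hom C (Cod C f0) W" and uf: "u \<cdot> f0 = zero (Dom C f0) W"
    have W: "W \<in> Obj C" using hom_Obj[OF u] by simp
    have "u \<cdot> w \<cdot> F = zero (Dom C F) W"
      using u w(1) F(1) f0(1) w1(1) W by (simp add: wF reassoc[OF uf])
    then obtain t where t: "t \<in> hom C (Cod C Q) W" "t \<cdot> Q = u \<cdot> w"
      by (rule cokernel_desc[OF FQ, rotated]) (use u w F f0 in auto)
    have tu: "t \<cdot> (Q \<cdot> w') = u"
      using t(1) Q(1) w(1,3,5) u f0(1) by (simp add: reassoc[OF t(2)])
    show "\<exists>!t. t \<in> hom C (Cod C (Q \<cdot> w')) W \<and> t \<cdot> (Q \<cdot> w') = u"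
    proof (rule ex1I[of _ t])
      show "t \<in> hom C (Cod C (Q \<cdot> w')) W \<and> t \<cdot> (Q \<cdot> w') = u" using t(1) tu Q(1) w(3) by simp
      fix t' assume "t' \<in> hom C (Cod C (Q \<cdot> w')) W \<and> t' \<cdot> (Q \<cdot> w') = u"
      then have t': "t' \<in> hom C (Cod C Q) W" "t' \<cdot> (Q \<cdot> w') = u" using Q(1) w(3) by auto
      have "t' \<cdot> Q = t' \<cdot> (Q \<cdot> w') \<cdot> w"
        using t'(1) Q(1) w(1,3,6) o by simp
      then have "t' \<cdot> Q = t \<cdot> Q" using t'(2) t(2) by simp
      then show "t' = t" by (rule cokernel_epi[OF FQ t'(1) t(1)])
    qed
  qed (use f0 Q w in auto)
  moreover have "ker C p' \<cdot> (Q \<cdot> w') = q \<cdot> k"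
    using Q(1) w(1,3,4) dK dq by (simp add: reassoc[OF Q(2)])
  moreover have "Q \<cdot> w' \<in> hom C (Dom C k) (Dom C (ker C p'))" using Q(1) w(3) by simp
  ultimately show thesis using that[OF q qm K(3)] by blast
qed

text \<open>The point is the cokernel of \<open>[inl, kap \<cdot> n] : B + N \<rightarrow> B + X\<close>, where \<open>n\<close> is the kernel of \<open>xi\<close>;
  the restriction of that arrow to the kernels has cokernel \<open>xi\<close>.\<close>

lemma semidirect_product:
  assumes B: "B \<in> Obj C" and act: "is_action C B X xi"
  obtains A p s j where "point B A p s" "is_kernel C p j" "Dom C j = X"
    "j \<cdot> xi = copair C s j \<cdot> kap B X"
    "\<And>W u s'. u \<in> hom C X W \<Longrightarrow> s' \<in> hom C B W \<Longrightarrow> u \<cdot> xi = copair C s' u \<cdot> kap B X \<Longrightarrow>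
       \<exists>t\<in>hom C A W. t \<cdot> j = u \<and> t \<cdot> s = s'"
proof -
  have x: "xi \<in> hom C (bf B X) X" "xi \<cdot> bflat_unit C B X = Id C X"
    "xi \<cdot> bflat_mult C B X = xi \<cdot> bfa B xi"
    using act by (auto simp: is_action_def)
  have X: "X \<in> Obj C" using hom_Obj[OF x(1)] by simp
  note mX = bflat_mult_props[OF B X] and eta = bflat_unit_props[OF B X]
  define n where "n = ker C xi"
  have n: "is_kernel C xi n" using x ker by (simp add: n_def)
  note dn = kernelD[OF n]
  define N where "N = Dom C n"
  have nh: "n \<in> hom C N (bf B X)" using dn x by (simp add: N_def)
  have N: "N \<in> Obj C" using hom_Obj[OF nh] by simp
  have "strong_epi xi" by (rule split_epi_strong[of xi "bflat_unit C B X"]) (use x eta in auto)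
  then have xic: "is_cokernel C n xi" using n by (rule strong_epi_cokernel)
  define f where "f = copair C (inl C B X) (kap B X \<cdot> n)"
  have fh: "f \<in> hom C (coprod_obj C B N) (coprod_obj C B X)" using nh B X by (simp add: f_def)
  have kn: "copair C (Id C B) (zero X B) \<cdot> (kap B X \<cdot> n) = zero N B"
    using reassoc[OF ker_simps(3)[of "copair C (Id C B) (zero X B)"], of n] B X nh by simp
  have f: "point_map B (coprod_obj C B N, copair C (Id C B) (zero N B), inl C B N) f
      (coprod_obj C B X, copair C (Id C B) (zero X B), inl C B X)"
    unfolding point_map_iff using plus_point[OF B N] plus_point[OF B X] fh B X N nh
    by (simp add: f_def comp_copair kn)
  \<comment> \<open>The restriction of \<open>f\<close> to kernels: the extension of
    \<open>n\<close> to the free algebra on \<open>N\<close>.\<close>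
  define f0 where "f0 = bflat_mult C B X \<cdot> bfa B n"
  have f0: "f0 \<in> hom C (bf B N) (bf B X)" using mX(1) nh B by (simp add: f0_def)
  have kf0: "kap B X \<cdot> f0 = f \<cdot> kap B N"
    using copair_bflat[OF B nh, of "inl C B X" "coprod_obj C B X" "kap B X"] mX(1) B X nh
    by (simp add: f0_def f_def reassoc[OF mX(2)])
  obtain q p s k q0 where q: "is_cokernel C (f \<cdot> kap B N) q"
    and qm: "point_map B (coprod_obj C B X, copair C (Id C B) (zero X B), inl C B X) q (Cod C q, p, s)"
    and k: "is_kernel C p k" and q0: "q0 \<in> hom C (bf B X) (Dom C k)" "k \<cdot> q0 = q \<cdot> kap B X"
    and q0c: "is_cokernel C f0 q0"
    by (rule cokernel_kernels[OF f kap_kernel[OF B N] kap_kernel[OF B X] f0 kf0])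
  note dq = point_mapD[OF qm] and dk = kernelD[OF k] and dc = cokernelD[OF q0c]
  note o = hom_Obj[OF q0(1)]
  \<comment> \<open>Associativity of the action rewrites this as the action applied to
    \<open>xi \<cdot> n\<close>, which is zero. So \<open>xi\<close> factors through the cokernel
    \<open>q0\<close> of \<open>f0\<close>.\<close>
  have "xi \<cdot> f0 = xi \<cdot> (bfa B xi \<cdot> bfa B n)"
    using x(1) mX(1) B nh by (simp add: f0_def reassoc[OF x(3)])
  also have "\<dots> = xi \<cdot> bfa B (xi \<cdot> n)" using bflat_comp[OF B nh x(1)] by simp
  also have "xi \<cdot> n = zero N X" using dn(4) x(1) by (simp add: N_def)
  also have "xi \<cdot> bfa B (zero N X) = zero (bf B N) X" using bflat_zero[OF B N X] x(1) B N by simp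
  finally have xf: "xi \<cdot> f0 = zero (bf B N) X" .
  obtain th where th: "th \<in> hom C (Dom C k) X" "th \<cdot> q0 = xi"
    by (rule cokernel_desc[OF q0c, of xi X]) (use xf f0 x q0 in auto)
  \<comment> \<open>Conversely \<open>q0\<close> kills \<open>n\<close> and factors through
    \<open>xi\<close>, the cokernel of \<open>n\<close>. The two factorizations \<open>th\<close>
    and \<open>ph\<close> are mutually inverse.\<close>
  have nf: "f0 \<cdot> bflat_unit C B N = n"
  proof (rule kap_cancel[OF B X, of _ N])
    have "kap B X \<cdot> (f0 \<cdot> bflat_unit C B N) = f \<cdot> inr C B N"
      using bflat_unit_props(2)[OF B N] f0 fh B N X by (simp add: reassoc[OF kf0])
    then show "kap B X \<cdot> (f0 \<cdot> bflat_unit C B N) = kap B X \<cdot> n" using B X N nh by (simp add: f_def)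
  qed (use f0 nh B N in auto)
  have "q0 \<cdot> n = zero N (Dom C k)"
    unfolding nf[symmetric] using dc f0 q0(1) B N o by (simp add: reassoc[OF dc(4)])
  then obtain ph where ph: "ph \<in> hom C X (Dom C k)" "ph \<cdot> xi = q0"
    by (rule cokernel_desc[OF xic, rotated, unfolded N_def[symmetric]]) (use q0 nh x in \<open>auto simp: N_def\<close>)
  have tp: "th \<cdot> ph = Id C X"
    by (rule cokernel_epi[OF xic, of _ X]) (use th ph x X in auto)
  have pt: "ph \<cdot> th = Id C (Dom C k)"
    by (rule cokernel_epi[OF q0c, of _ "Dom C k"]) (use th ph x o q0 in auto)
  \<comment> \<open>Transport along the isomorphism \<open>ph\<close> gives a kernel of
    \<open>p\<close> whose domain is \<open>X\<close> itself.\<close>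
  define j where "j = k \<cdot> ph"
  have jh: "j \<in> hom C X (Cod C q)" using ph dk dq by (simp add: j_def)
  have j: "is_kernel C p j"
    unfolding is_kernel_def
  proof (intro conjI allI ballI impI)
    show "p \<cdot> j = zero (Dom C j) (Cod C p)"
      using dk ph dq X B by (simp add: j_def reassoc[OF dk(4)])
    fix W u assume u: "u \<in> hom C W (Dom C p)" "p \<cdot> u = zero W (Cod C p)"
    obtain t where t: "t \<in> hom C W (Dom C k)" "k \<cdot> t = u" by (rule kernel_lift[OF k u])
    show "\<exists>!t. t \<in> hom C W (Dom C j) \<and> j \<cdot> t = u"
    proof (rule ex1I[of _ "th \<cdot> t"])
      show "th \<cdot> t \<in> hom C W (Dom C j) \<and> j \<cdot> (th \<cdot> t) = u"
        using t th(1) ph(1) dk jh by (simp add: j_def reassoc[OF pt])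
      fix t' assume "t' \<in> hom C W (Dom C j) \<and> j \<cdot> t' = u"
      then have t': "t' \<in> hom C W X" "k \<cdot> (ph \<cdot> t') = u" using jh ph(1) dk by (auto simp: j_def)
      have "ph \<cdot> t' = t" by (rule kernel_cancel[OF k, of _ W]) (use t' t ph in auto)
      then have "th \<cdot> t = th \<cdot> (ph \<cdot> t')" by simp
      then show "t' = th \<cdot> t" using t'(1) th(1) ph(1) by (simp add: reassoc[OF tp])
    qed
  qed (use jh dk dq in auto)
  have qin: "q \<cdot> inl C B X = s" "q \<cdot> inr C B X = j"
  proof -
    show "q \<cdot> inl C B X = s" using dq by simp
    have "q \<cdot> inr C B X = q \<cdot> kap B X \<cdot> bflat_unit C B X" using dq B X eta by simp
    also have "\<dots> = k \<cdot> (q0 \<cdot> bflat_unit C B X)"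
      unfolding q0(2)[symmetric] using dk q0(1) B X by simp
    also have "q0 \<cdot> bflat_unit C B X = ph"
      using x(1,2) ph(1) B X by (simp add: ph(2)[symmetric])
    finally show "q \<cdot> inr C B X = j" by (simp add: j_def)
  qed
  have qcp: "q = copair C s j"
    by (rule coprod_ext[of _ B X "Cod C q"]) (use dq jh B X qin in auto)
  have "j \<cdot> xi = k \<cdot> q0" using dk ph x(1) by (simp add: j_def)
  then have jxi: "j \<cdot> xi = copair C s j \<cdot> kap B X" using q0(2) qcp by simp
  have univ: "\<exists>t\<in>hom C (Cod C q) W. t \<cdot> j = u \<and> t \<cdot> s = s'"
    if u: "u \<in> hom C X W" and s': "s' \<in> hom C B W" and ux: "u \<cdot> xi = copair C s' u \<cdot> kap B X" for W u s'
  proof -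
    have W: "W \<in> Obj C" using hom_Obj[OF u] by simp
    \<comment> \<open>Equivariance of \<open>u\<close> moves the computation to
      \<open>xi \<cdot> n\<close>, which vanishes. Hence \<open>[s', u]\<close> factors through the
      cokernel \<open>q\<close> that defines the point.\<close>
    have "copair C s' u \<cdot> (kap B X \<cdot> n) = u \<cdot> (xi \<cdot> n)"
      using u s' nh B X x(1) by (simp add: reassoc[OF ux[symmetric]])
    also have "\<dots> = zero N W" using dn(4) x(1) u N by (simp add: N_def)
    finally have "copair C s' u \<cdot> f = copair C s' (zero N W)"
      using u s' nh B X by (simp add: f_def comp_copair)
    from reassoc[OF this, of "kap B N"]
    have "copair C s' u \<cdot> (f \<cdot> kap B N) = zero (bf B N) W"
      using copair_zero_kap[OF B N s'] u s' fh B N by simp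
    then obtain t where t: "t \<in> hom C (Cod C q) W" "t \<cdot> q = copair C s' u"
      by (rule_tac cokernel_desc[OF q, of "copair C s' u" W]) (use u s' fh B N in auto)
    have "t \<cdot> (q \<cdot> inl C B X) = s'" "t \<cdot> (q \<cdot> inr C B X) = u"
      using t(1) dq(7) u s' B X by (simp_all add: reassoc[OF t(2)])
    then show ?thesis using t(1) qin by auto
  qed
  have "point B (Cod C q) p s" using dq by (simp add: point_def)
  then show thesis using that j jh jxi univ by auto
qed

end

section \<open>Stability of the Huq commutator\<close>

context semi_abelian_category
begin

lemma Sigma_simps:
  assumes "H \<in> Obj C" "K \<in> Obj C"
  shows "Sigma_arr C H K \<in> hom C (coprod_obj C H K) (prod_obj C H K)"
    "pr1 H K \<cdot> Sigma_arr C H K = copair C (Id C H) (zero K H)"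
    "pr2 H K \<cdot> Sigma_arr C H K = copair C (zero H K) (Id C K)"
  using assms by (auto simp: Sigma_arr_def)

text \<open>\<open>H \<times> K\<close> is a point over \<open>K\<close> with kernel
  \<open><1, 0>\<close> and section \<open><0, 1>\<close>. Both are composites of a coproduct
  injection with the canonical arrow, so a subobject through which that arrow factors contains them,
  and \<open>point_strong\<close> applies.\<close>

lemma Sigma_strong:
  assumes H: "H \<in> Obj C" and K: "K \<in> Obj C"
  shows "strong_epi (Sigma_arr C H K)"
  unfolding strong_epi_def
proof (intro conjI allI impI; (elim conjE bexE)?)
  note S = Sigma_simps[OF H K]
  show "Sigma_arr C H K \<in> Arr C" using S by simp
  fix m f assume m: "is_mono C m" "Cod C m = Cod C (Sigma_arr C H K)"
    and f: "f \<in> hom C (Dom C (Sigma_arr C H K)) (Dom C m)" "m \<cdot> f = Sigma_arr C H K"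
  have mA: "m \<in> Arr C" using m by (simp add: is_mono_def)
  have k: "is_kernel C (pr2 H K) (pair C (Id C H) (zero H K))"
    unfolding is_kernel_def
  proof (intro conjI allI ballI impI)
    fix W u assume u: "u \<in> hom C W (Dom C (pr2 H K))" "pr2 H K \<cdot> u = zero W (Cod C (pr2 H K))"
    have W: "W \<in> Obj C" using hom_Obj[OF u(1)] by simp
    show "\<exists>!t. t \<in> hom C W (Dom C (pair C (Id C H) (zero H K))) \<and> pair C (Id C H) (zero H K) \<cdot> t = u"
    proof (rule ex1I[of _ "pr1 H K \<cdot> u"])
      have "pair C (Id C H) (zero H K) \<cdot> (pr1 H K \<cdot> u) = u"
        by (rule prod_ext[of _ W H K]) (use u W H K in auto)
      then show "pr1 H K \<cdot> u \<in> hom C W (Dom C (pair C (Id C H) (zero H K))) \<and>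
          pair C (Id C H) (zero H K) \<cdot> (pr1 H K \<cdot> u) = u" using u H K by simp
      fix t assume "t \<in> hom C W (Dom C (pair C (Id C H) (zero H K))) \<and> pair C (Id C H) (zero H K) \<cdot> t = u"
      then have t: "t \<in> hom C W H" and u: "u = pair C (Id C H) (zero H K) \<cdot> t" using H K by auto
      show "t = pr1 H K \<cdot> u" unfolding u using t H K by simp
    qed
  qed (use H K in auto)
  have fi: "m \<cdot> (f \<cdot> inl C H K) = pair C (Id C H) (zero H K)" "m \<cdot> (f \<cdot> inr C H K) = pair C (zero K H) (Id C K)"
    by (rule prod_ext[of _ H H K], use mA f(1) S m(2) H K in
        \<open>auto simp: reassoc[OF f(2)] reassoc[OF S(2)] reassoc[OF S(3)]\<close>)
      (rule prod_ext[of _ K H K], use mA f(1) S m(2) H K in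
        \<open>auto simp: reassoc[OF f(2)] reassoc[OF S(2)] reassoc[OF S(3)]\<close>)
  show "is_iso C m"
    by (rule point_strong[OF _ _ _ k m(1) _ _ fi(1) _ fi(2)]) (use m mA f S H K in auto)
qed

text \<open>The canonical arrow is the cokernel of its kernel \<open>n\<close>, and pushing a
  cokernel of \<open>n\<close> out along \<open>[h, k]\<close> gives the cokernel of the composite.
  One direction analyses a given commutator, the other constructs one.\<close>

lemma pushout_Sigma_cokernel:
  assumes h: "h \<in> hom C H G" and k: "k \<in> hom C K G"
    and n: "is_kernel C (Sigma_arr C H K) n"
  shows "is_pushout C (copair C h k) (Sigma_arr C H K) q m \<Longrightarrow> is_cokernel C (copair C h k \<cdot> n) q"
    and "is_cokernel C (copair C h k \<cdot> n) q \<Longrightarrow> \<exists>m. is_pushout C (copair C h k) (Sigma_arr C H K) q m"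
proof -
  note o = hom_Obj[OF h] hom_Obj[OF k]
  have H: "H \<in> Obj C" and K: "K \<in> Obj C" and G: "G \<in> Obj C" using o by auto
  note S = Sigma_simps(1)[OF H K] and dn = kernelD[OF n]
  have N: "Dom C n \<in> Obj C" using dn Dom_Obj by simp
  have c: "copair C h k \<in> hom C (coprod_obj C H K) G" using h k by simp
  have Sc: "is_cokernel C n (Sigma_arr C H K)" using Sigma_strong[OF H K] n by (rule strong_epi_cokernel)
  have factor: "\<exists>v. v \<in> hom C (prod_obj C H K) W \<and> v \<cdot> Sigma_arr C H K = u \<cdot> copair C h k"
    if u: "u \<in> hom C G W" "u \<cdot> (copair C h k \<cdot> n) = zero (Dom C n) W" for u W
  proof -
    have "u \<cdot> copair C h k \<cdot> n = zero (Dom C n) W" using u c dn S by simp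
    then obtain v where "v \<in> hom C (Cod C (Sigma_arr C H K)) W" "v \<cdot> Sigma_arr C H K = u \<cdot> copair C h k"
      by (rule cokernel_desc[OF Sc, rotated]) (use u c dn S in auto)
    then show ?thesis using S by auto
  qed
  have kill: "u \<cdot> (copair C h k \<cdot> n) = zero (Dom C n) W"
    if "u \<in> hom C G W" "v \<in> hom C (prod_obj C H K) W" "u \<cdot> copair C h k = v \<cdot> Sigma_arr C H K" for u v W
    using that(1,2) c dn S N by (simp add: reassoc[OF that(3)])
  have cn: "copair C h k \<cdot> n \<in> hom C (Dom C n) G" using c dn S by simp
  show "is_cokernel C (copair C h k \<cdot> n) q" if P: "is_pushout C (copair C h k) (Sigma_arr C H K) q m"
  proof -
    have d: "q \<in> hom C G (Cod C q)" "m \<in> hom C (prod_obj C H K) (Cod C q)"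
      "q \<cdot> copair C h k = m \<cdot> Sigma_arr C H K"
      using P c S unfolding is_pushout_def by auto
    show ?thesis
      unfolding is_cokernel_def
    proof (intro conjI allI ballI impI)
      show "q \<cdot> (copair C h k \<cdot> n) = zero (Dom C (copair C h k \<cdot> n)) (Cod C q)"
        using kill[OF d] cn by simp
      fix W u assume u: "u \<in> hom C (Cod C (copair C h k \<cdot> n)) W"
        "u \<cdot> (copair C h k \<cdot> n) = zero (Dom C (copair C h k \<cdot> n)) W"
      then have u': "u \<in> hom C G W" "u \<cdot> (copair C h k \<cdot> n) = zero (Dom C n) W" using cn by auto
      obtain v where v: "v \<in> hom C (prod_obj C H K) W" "v \<cdot> Sigma_arr C H K = u \<cdot> copair C h k"
        using factor[OF u'] by blast
      obtain t where t: "t \<in> hom C (Cod C q) W" "t \<cdot> q = u"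
      proof -
        have "u \<in> hom C (Cod C (copair C h k)) W" "v \<in> hom C (Cod C (Sigma_arr C H K)) W"
          using u' v c S by auto
        then show thesis using P v(2)[symmetric] that unfolding is_pushout_def by blast
      qed
      show "\<exists>!t. t \<in> hom C (Cod C q) W \<and> t \<cdot> q = u"
      proof (rule ex1I[of _ t])
        fix t' assume t': "t' \<in> hom C (Cod C q) W \<and> t' \<cdot> q = u"
        have m: "x \<cdot> m = v" if x: "x \<in> hom C (Cod C q) W" "x \<cdot> q = u" for x
        proof (rule cokernel_epi[OF Sc, of _ W])
          show "x \<cdot> m \<cdot> Sigma_arr C H K = v \<cdot> Sigma_arr C H K"
            using x(1) d(1,2) S c by (simp add: v(2) d(3)[symmetric] reassoc[OF x(2)])
        qed (use x d v S in auto)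
        have "t \<in> hom C (Cod C q) W \<and> t \<cdot> q = u \<and> t \<cdot> m = v" "t' \<in> hom C (Cod C q) W \<and> t' \<cdot> q = u \<and> t' \<cdot> m = v"
          using m t t' by auto
        moreover have "\<exists>!t. t \<in> hom C (Cod C q) W \<and> t \<cdot> q = u \<and> t \<cdot> m = v"
        proof -
          have "u \<in> hom C (Cod C (copair C h k)) W" "v \<in> hom C (Cod C (Sigma_arr C H K)) W"
            using u' v c S by auto
          then show ?thesis using P v(2)[symmetric] unfolding is_pushout_def by blast
        qed
        ultimately show "t' = t" by blast
      qed (use t in blast)
    qed (use cn d in auto)
  qed
  show "\<exists>m. is_pushout C (copair C h k) (Sigma_arr C H K) q m" if q: "is_cokernel C (copair C h k \<cdot> n) q"
  proof -
    note dq = cokernelD[OF q]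
    have qh: "q \<in> hom C G (Cod C q)" "q \<cdot> (copair C h k \<cdot> n) = zero (Dom C n) (Cod C q)"
      using dq cn by auto
    obtain m where m: "m \<in> hom C (prod_obj C H K) (Cod C q)" "m \<cdot> Sigma_arr C H K = q \<cdot> copair C h k"
      using factor[OF qh] by blast
    have "is_pushout C (copair C h k) (Sigma_arr C H K) q m"
      unfolding is_pushout_def
    proof (intro conjI allI ballI impI)
      fix W u v assume u: "u \<in> hom C (Cod C (copair C h k)) W" and v: "v \<in> hom C (Cod C (Sigma_arr C H K)) W"
        and uv: "u \<cdot> copair C h k = v \<cdot> Sigma_arr C H K"
      have u': "u \<in> hom C G W" and v': "v \<in> hom C (prod_obj C H K) W" using u v c S by auto
      obtain t where t: "t \<in> hom C (Cod C q) W" "t \<cdot> q = u"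
        by (rule cokernel_desc[OF q, of u W]) (use u' kill[OF u' v' uv] cn in auto)
      show "\<exists>!t. t \<in> hom C (Cod C q) W \<and> t \<cdot> q = u \<and> t \<cdot> m = v"
      proof (rule ex1I[of _ t])
        have "t \<cdot> m = v"
        proof (rule cokernel_epi[OF Sc, of _ W])
          show "t \<cdot> m \<cdot> Sigma_arr C H K = v \<cdot> Sigma_arr C H K"
            using t(1) m(1) qh(1) S c by (simp add: m(2) uv[symmetric] reassoc[OF t(2)])
        qed (use t m v S in auto)
        then show "t \<in> hom C (Cod C q) W \<and> t \<cdot> q = u \<and> t \<cdot> m = v" using t by blast
        fix t' assume "t' \<in> hom C (Cod C q) W \<and> t' \<cdot> q = u \<and> t' \<cdot> m = v"
        then show "t' = t" using cokernel_epi[OF q, of t' W t] t by simp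
      qed
    qed (use c S m qh in auto)
    then show ?thesis by blast
  qed
qed

text \<open>The coproduct of points is the pushout in \<open>C\<close> of the two sections, obtained
  as a coequalizer on \<open>X + Y\<close>. Its universal property is kept for arbitrary targets
  \<open>W\<close> in \<open>C\<close>, so that it also yields the projection \<open>pP\<close> and
  equations between arrows that are not morphisms of points.\<close>

lemma point_coproduct:
  assumes x: "point B X p s" and y: "point B Y p' s'"
  obtains P i j pP sP where "point_map B (X, p, s) i (P, pP, sP)" "point_map B (Y, p', s') j (P, pP, sP)"
    "\<And>u v W. u \<in> hom C X W \<Longrightarrow> v \<in> hom C Y W \<Longrightarrow> u \<cdot> s = v \<cdot> s' \<Longrightarrow>
       \<exists>t\<in>hom C P W. t \<cdot> i = u \<and> t \<cdot> j = v"
    "\<And>t t' W. t \<in> hom C P W \<Longrightarrow> t' \<in> hom C P W \<Longrightarrow> t \<cdot> i = t' \<cdot> i \<Longrightarrow> t \<cdot> j = t' \<cdot> j \<Longrightarrow> t = t'"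
proof -
  have d: "p \<in> hom C X B" "s \<in> hom C B X" "p \<cdot> s = Id C B"
    "p' \<in> hom C Y B" "s' \<in> hom C B Y" "p' \<cdot> s' = Id C B" using assms by (auto simp: point_def)
  note o = hom_Obj[OF d(1)] hom_Obj[OF d(4)]
  obtain c where c: "is_coequalizer C (inl C X Y \<cdot> s) (inr C X Y \<cdot> s') c"
    by (rule coequalizer_ex[of "inl C X Y \<cdot> s" B "coprod_obj C X Y" "inr C X Y \<cdot> s'"]) (use d o in auto)
  note dc = coequalizerD[OF c]
  define i j where "i = c \<cdot> inl C X Y" and "j = c \<cdot> inr C X Y"
  have cd: "c \<in> hom C (coprod_obj C X Y) (Cod C c)" using dc d o by simp
  have ij: "i \<in> hom C X (Cod C c)" "j \<in> hom C Y (Cod C c)" using cd o by (auto simp: i_def j_def)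
  have ijs: "i \<cdot> s = j \<cdot> s'" using dc(7) cd d o by (simp add: i_def j_def)
  have ex: "\<exists>t\<in>hom C (Cod C c) W. t \<cdot> i = u \<and> t \<cdot> j = v"
    if u: "u \<in> hom C X W" and v: "v \<in> hom C Y W" and uv: "u \<cdot> s = v \<cdot> s'" for u v W
  proof -
    obtain t where t: "t \<in> hom C (Cod C c) W" "t \<cdot> c = copair C u v"
      by (rule coequalizer_desc[OF c, of "copair C u v" W]) (use u v uv d o in auto)
    have "t \<cdot> i = u" "t \<cdot> j = v"
      using t(1) cd u v o by (simp_all add: i_def j_def reassoc[OF t(2)])
    then show ?thesis using t by blast
  qed
  have ext: "t = t'" if t: "t \<in> hom C (Cod C c) W" and t': "t' \<in> hom C (Cod C c) W"
    and "t \<cdot> i = t' \<cdot> i" "t \<cdot> j = t' \<cdot> j" for t t' W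
  proof (rule coequalizer_epi[OF c t t'])
    show "t \<cdot> c = t' \<cdot> c"
      by (rule coprod_ext[of _ X Y W]) (use that cd o in \<open>auto simp: i_def j_def\<close>)
  qed
  obtain pP where pP: "pP \<in> hom C (Cod C c) B" "pP \<cdot> i = p" "pP \<cdot> j = p'"
    using ex[OF d(1,4)] d by auto
  have "point B (Cod C c) pP (i \<cdot> s)"
    using pP(1) ij d by (simp add: point_def reassoc[OF pP(2)])
  then have "point_map B (X, p, s) i (Cod C c, pP, i \<cdot> s)" "point_map B (Y, p', s') j (Cod C c, pP, i \<cdot> s)"
    using assms pP ij ijs by (auto simp: point_map_iff)
  then show thesis using that ex ext by blast
qed

text \<open>If both injections factor through \<open>m\<close>, the factorizations induce an arrow
  from the coproduct back to the domain of \<open>m\<close>. It is a section of \<open>m\<close>,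
  and a monomorphism with a section is invertible.\<close>

lemma point_coproduct_jointly_strongly_epi:
  assumes i: "point_map B (X, p, s) i (P, pP, sP)" and j: "point_map B (Y, p', s') j (P, pP, sP)"
    and ex: "\<And>u v W. u \<in> hom C X W \<Longrightarrow> v \<in> hom C Y W \<Longrightarrow> u \<cdot> s = v \<cdot> s' \<Longrightarrow>
       \<exists>t\<in>hom C P W. t \<cdot> i = u \<and> t \<cdot> j = v"
    and ext: "\<And>t t' W. t \<in> hom C P W \<Longrightarrow> t' \<in> hom C P W \<Longrightarrow> t \<cdot> i = t' \<cdot> i \<Longrightarrow> t \<cdot> j = t' \<cdot> j \<Longrightarrow> t = t'"
  shows "jointly_strongly_epi (Pt C B) ((X, p, s), i, (P, pP, sP)) ((Y, p', s'), j, (P, pP, sP))"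
  unfolding jointly_strongly_epi_def
proof (intro conjI allI impI; (elim conjE bexE)?)
  fix m f g
  assume m: "is_subobject (Pt C B) (Cod (Pt C B) ((X, p, s), i, (P, pP, sP))) m"
    and f: "f \<in> hom (Pt C B) (Dom (Pt C B) ((X, p, s), i, (P, pP, sP))) (Dom (Pt C B) m)"
      "Comp (Pt C B) m f = ((X, p, s), i, (P, pP, sP))"
    and g: "g \<in> hom (Pt C B) (Dom (Pt C B) ((Y, p', s'), j, (P, pP, sP))) (Dom (Pt C B) m)"
      "Comp (Pt C B) m g = ((Y, p', s'), j, (P, pP, sP))"
  have mm: "is_mono (Pt C B) m" "m \<in> Arr (Pt C B)" using m by (auto simp: is_subobject_def is_mono_def)
  obtain M pM sM m0 y where m0: "m = ((M, pM, sM), m0, y)" by (cases m) auto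
  then have m1: "m = ((M, pM, sM), m0, (P, pP, sP))" using m by (simp add: is_subobject_def)
  then have m2: "point_map B (M, pM, sM) m0 (P, pP, sP)" using mm by (simp add: point_map_def)
  obtain f0 where f0: "f = ((X, p, s), f0, (M, pM, sM))" "point_map B (X, p, s) f0 (M, pM, sM)"
    using f m1 by (auto elim: Pt_homE)
  obtain g0 where g0: "g = ((Y, p', s'), g0, (M, pM, sM))" "point_map B (Y, p', s') g0 (M, pM, sM)"
    using g m1 by (auto elim: Pt_homE)
  have mf: "m0 \<cdot> f0 = i" "m0 \<cdot> g0 = j" using f g f0 g0 m1 by auto
  note di = point_mapD[OF i] and dj = point_mapD[OF j] and dm = point_mapD[OF m2]
    and df = point_mapD[OF f0(2)] and dg = point_mapD[OF g0(2)]
  have P: "P \<in> Obj C" using hom_Obj[OF di(7)] by simp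
  have "f0 \<cdot> s = g0 \<cdot> s'" using df(9) dg(9) by simp
  then obtain t where t: "t \<in> hom C P M" "t \<cdot> i = f0" "t \<cdot> j = g0"
    using ex[OF df(7) dg(7)] by blast
  have mt: "m0 \<cdot> t = Id C P"
    by (rule ext[of _ P]) (use t dm(7) di(7) dj(7) mf P in auto)
  have "pM \<cdot> t = pP \<cdot> (m0 \<cdot> t)"
    using dm(4,7) t(1) by (simp add: reassoc[OF dm(8)])
  then have "pM \<cdot> t = pP" using mt di(4) by simp
  moreover have "t \<cdot> sP = sM"
  proof -
    have "t \<cdot> (i \<cdot> s) = f0 \<cdot> s" using t(1) di(2,7) by (simp add: reassoc[OF t(2)])
    then show ?thesis using di(9) df(9) by simp
  qed
  ultimately have tm: "point_map B (P, pP, sP) t (M, pM, sM)"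
    using m2 t by (simp add: point_map_iff)
  show "is_iso (Pt C B) m"
    by (rule category.is_iso_mono_section[OF category_Pt mm(1), of "((P, pP, sP), t, (M, pM, sM))"])
      (use Pt_homI[OF tm] m1 mt in auto)
qed (use i j in \<open>auto simp: point_map_def\<close>)

end

section \<open>Restriction of the action to the commutator\<close>

context kernel_preserving_category
begin

text \<open>Only the arrow is produced: as \<open>l\<close> is monic, the algebra laws and
  uniqueness come for free.\<close>

lemma huq_stable:
  assumes B: "B \<in> Obj C" and act: "is_action C B G xi"
    and h: "h \<in> hom C H G" and k: "k \<in> hom C K G"
    and actH: "is_action C B H xiH" "h \<cdot> xiH = xi \<cdot> bfa B h"
    and actK: "is_action C B K xiK" "k \<cdot> xiK = xi \<cdot> bfa B k"
    and po: "is_pushout C (copair C h k) (Sigma_arr C H K) q m" and l: "is_kernel C q l"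
  obtains xi' where "xi' \<in> hom C (bf B (Dom C l)) (Dom C l)" "l \<cdot> xi' = xi \<cdot> bfa B l"
proof -
  have H: "H \<in> Obj C" and K: "K \<in> Obj C" and G: "G \<in> Obj C"
    using hom_Obj[OF h] hom_Obj[OF k] by auto
  note S = Sigma_simps[OF H K]
  have xi: "xi \<in> hom C (bf B G) G" "xi \<cdot> bflat_unit C B G = Id C G"
    using act by (auto simp: is_action_def)
  have xiH: "xiH \<in> hom C (bf B H) H" and xiK: "xiK \<in> hom C (bf B K) K"
    using actH actK by (auto simp: is_action_def)
  define n where "n = ker C (Sigma_arr C H K)"
  have n: "is_kernel C (Sigma_arr C H K) n" using S ker by (simp add: n_def)
  define N where "N = Dom C n"
  have nh: "n \<in> hom C N (coprod_obj C H K)" using kernelD[OF n] S by (simp add: N_def)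
  have N: "N \<in> Obj C" using hom_Obj[OF nh] by simp
  have hk: "copair C h k \<in> hom C (coprod_obj C H K) G" using h k by simp
  define nu where "nu = copair C h k \<cdot> n"
  have nu: "nu \<in> hom C N G" using hk nh by (simp add: nu_def)
  have qc: "is_cokernel C nu q" unfolding nu_def using pushout_Sigma_cokernel(1)[OF h k n po] .
  define Q where "Q = Cod C q"
  have q: "q \<in> hom C G Q" using cokernelD[OF qc] nu by (simp add: Q_def)
  have m: "m \<in> hom C (prod_obj C H K) Q" "q \<cdot> copair C h k = m \<cdot> Sigma_arr C H K"
    using po S hk by (auto simp: is_pushout_def Q_def)
  have Q: "Q \<in> Obj C" using hom_Obj[OF q] by simp
  obtain A p s j where A: "point B A p s" "is_kernel C p j" "Dom C j = G" "j \<cdot> xi = copair C s j \<cdot> kap B G"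
    by (rule semidirect_product[OF B act])
  have dA: "p \<in> hom C A B" "s \<in> hom C B A" "p \<cdot> s = Id C B" using A by (auto simp: point_def)
  have j: "j \<in> hom C G A" "p \<cdot> j = zero G B" using kernelD[OF A(2)] A(3) dA by auto
  \<comment> \<open>Equivariance of \<open>x\<close> is precisely the condition under which the
    universal property of the semidirect product for \<open>xiX\<close> yields a morphism of points
    to \<open>A\<close>.\<close>
  have sub: "\<exists>A' p' s' j' a. point_map B (A', p', s') a (A, p, s) \<and> is_kernel C p' j' \<and> Dom C j' = X \<and>
      j' \<cdot> xiX = copair C s' j' \<cdot> kap B X \<and> a \<cdot> j' = j \<cdot> x"
    if x: "x \<in> hom C X G" and actX: "is_action C B X xiX" and xx: "x \<cdot> xiX = xi \<cdot> bfa B x" for X x xiX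
  proof -
    obtain A' p' s' j' where A': "point B A' p' s'" "is_kernel C p' j'" "Dom C j' = X"
      "j' \<cdot> xiX = copair C s' j' \<cdot> kap B X"
      "\<And>W u t. u \<in> hom C X W \<Longrightarrow> t \<in> hom C B W \<Longrightarrow> u \<cdot> xiX = copair C t u \<cdot> kap B X \<Longrightarrow>
        \<exists>a\<in>hom C A' W. a \<cdot> j' = u \<and> a \<cdot> s' = t"
      by (rule semidirect_product[OF B actX]) blast
    have xiX: "xiX \<in> hom C (bf B X) X" using actX by (simp add: is_action_def)
    have d': "p' \<in> hom C A' B" "s' \<in> hom C B A'" "p' \<cdot> s' = Id C B" using A' by (auto simp: point_def)
    have j': "j' \<in> hom C X A'" "p' \<cdot> j' = zero X B" using kernelD[OF A'(2)] A'(3) d' by auto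
    have "j \<cdot> x \<cdot> xiX = j \<cdot> (xi \<cdot> bfa B x)" using j x xiX by (simp add: xx)
    also have "\<dots> = copair C s j \<cdot> (kap B G \<cdot> bfa B x)"
      using j(1) xi(1) x dA B G by (simp add: reassoc[OF A(4)])
    also have "\<dots> = copair C s (j \<cdot> x) \<cdot> kap B X" by (rule copair_bflat[OF B x dA(2) j(1)])
    finally obtain a where a: "a \<in> hom C A' A" "a \<cdot> j' = j \<cdot> x" "a \<cdot> s' = s"
      using A'(5)[of "j \<cdot> x" A s] x j dA by auto
    have "p \<cdot> a = p'"
      by (rule point_ext[OF d' A'(2), of _ B])
        (use a dA d' j j' x hom_Obj[OF x] B in \<open>auto simp: reassoc[OF j(2)]\<close>)
    then have "point_map B (A', p', s') a (A, p, s)" using A(1) A'(1) a by (simp add: point_map_iff)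
    then show ?thesis using A' a by blast
  qed
  obtain AH pH sH jH aH where aH: "point_map B (AH, pH, sH) aH (A, p, s)" "is_kernel C pH jH" "Dom C jH = H"
    "jH \<cdot> xiH = copair C sH jH \<cdot> kap B H" "aH \<cdot> jH = j \<cdot> h"
    using sub[OF h actH] by blast
  obtain AK pK sK jK aK where aK: "point_map B (AK, pK, sK) aK (A, p, s)" "is_kernel C pK jK" "Dom C jK = K"
    "jK \<cdot> xiK = copair C sK jK \<cdot> kap B K" "aK \<cdot> jK = j \<cdot> k"
    using sub[OF k actK] by blast
  note dH = point_mapD[OF aH(1)] and dK = point_mapD[OF aK(1)]
  have jH: "jH \<in> hom C H AH" "pH \<cdot> jH = zero H B" using kernelD[OF aH(2)] aH(3) dH by auto
  have jK: "jK \<in> hom C K AK" "pK \<cdot> jK = zero K B" using kernelD[OF aK(2)] aK(3) dK by auto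
  have oA: "AH \<in> Obj C" "AK \<in> Obj C" using hom_Obj[OF jH(1)] hom_Obj[OF jK(1)] by auto
  have pts: "point B AH pH sH" "point B AK pK sK" using dH dK by (auto simp: point_def)
  obtain P iH iK pP sP where i: "point_map B (AH, pH, sH) iH (P, pP, sP)"
    "point_map B (AK, pK, sK) iK (P, pP, sP)"
    and ex: "\<And>u v W. u \<in> hom C AH W \<Longrightarrow> v \<in> hom C AK W \<Longrightarrow> u \<cdot> sH = v \<cdot> sK \<Longrightarrow>
       \<exists>t\<in>hom C P W. t \<cdot> iH = u \<and> t \<cdot> iK = v"
    and ext: "\<And>t t' W. t \<in> hom C P W \<Longrightarrow> t' \<in> hom C P W \<Longrightarrow> t \<cdot> iH = t' \<cdot> iH \<Longrightarrow> t \<cdot> iK = t' \<cdot> iK \<Longrightarrow> t = t'"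
    by (rule point_coproduct[OF pts]) blast
  have jse: "jointly_strongly_epi (Pt C B) ((AH, pH, sH), iH, (P, pP, sP)) ((AK, pK, sK), iK, (P, pP, sP))"
    by (rule point_coproduct_jointly_strongly_epi[OF i]) (fact ex, fact ext)
  note diH = point_mapD[OF i(1)] and diK = point_mapD[OF i(2)]
  define jP where "jP = ker C pP"
  have kP: "is_kernel C pP jP" using ker diH by (simp add: jP_def)
  define R where "R = Dom C jP"
  have jP: "jP \<in> hom C R P" "pP \<cdot> jP = zero R B" using kernelD[OF kP] diH by (auto simp: R_def)
  have R: "R \<in> Obj C" using hom_Obj[OF jP(1)] by simp
  \<comment> \<open>\<open>sH \<cdot> pK\<close> and \<open>sK \<cdot> pH\<close> are zero morphisms
    in \<open>Pt C B\<close>; paired with identities they induce the two retractions of the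
    coproduct \<open>P\<close> onto \<open>AH\<close> and \<open>AK\<close>.\<close>
  have hom1: "Id C AH \<in> hom C AH AH" "sH \<cdot> pK \<in> hom C AK AH" "sK \<cdot> pH \<in> hom C AH AK" "Id C AK \<in> hom C AK AK"
    and eq1: "Id C AH \<cdot> sH = sH \<cdot> pK \<cdot> sK" "sK \<cdot> pH \<cdot> sH = Id C AK \<cdot> sK"
    using dH dK oA by auto
  obtain gB where gB: "gB \<in> hom C P A" "gB \<cdot> iH = aH" "gB \<cdot> iK = aK"
    using ex[OF dH(7) dK(7)] dH(9) dK(9) by metis
  obtain rHB where rHB: "rHB \<in> hom C P AH" "rHB \<cdot> iH = Id C AH" "rHB \<cdot> iK = sH \<cdot> pK"
    using ex[OF hom1(1,2) eq1(1)] by blast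
  obtain rKB where rKB: "rKB \<in> hom C P AK" "rKB \<cdot> iH = sK \<cdot> pH" "rKB \<cdot> iK = Id C AK"
    using ex[OF hom1(3,4) eq1(2)] by blast
  have over: "pX \<cdot> t = pP" if "pX \<in> hom C X B" "t \<in> hom C P X" "pX \<cdot> (t \<cdot> iH) = pH" "pX \<cdot> (t \<cdot> iK) = pK" for pX t X
    by (rule ext[of _ B]) (use that diH diK in auto)
  have pr: "p \<cdot> gB = pP" "pH \<cdot> rHB = pP" "pK \<cdot> rKB = pP"
    by (rule over; use gB rHB rKB dH dK in \<open>simp add: reassoc[OF dH(3)] reassoc[OF dK(3)]\<close>)+
  have sr: "gB \<cdot> sP = s" "rHB \<cdot> sP = sH" "rKB \<cdot> sP = sK"
  proof -
    have "gB \<cdot> (iH \<cdot> sH) = s" "rHB \<cdot> (iH \<cdot> sH) = sH"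
      using gB(1) rHB(1) diH(7) dH by (simp_all add: reassoc[OF gB(2)] reassoc[OF rHB(2)])
    then show "gB \<cdot> sP = s" "rHB \<cdot> sP = sH" using diH(9) by simp_all
    have "rKB \<cdot> (iK \<cdot> sK) = sK"
      using rKB(1) diK(7) dK by (simp add: reassoc[OF rKB(3)])
    then show "rKB \<cdot> sP = sK" using diK(9) by simp
  qed
  have restr: "\<exists>t0\<in>hom C X Y. jY \<cdot> t0 = t \<cdot> jX"
    if prems: "is_kernel C pY jY" "Dom C jY = Y" "t \<in> hom C T T'" "pY \<in> hom C T' B" "jX \<in> hom C X T" "pY \<cdot> t = pX"
      "pX \<cdot> jX = zero X B" for pY jY Y t T T' jX X pX
  proof -
    obtain t0 where "t0 \<in> hom C X (Dom C jY)" "jY \<cdot> t0 = t \<cdot> jX"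
      by (rule kernel_lift[OF prems(1), of "t \<cdot> jX" X]) (use prems kernelD(1)[OF prems(1)] in \<open>auto simp: reassoc[OF prems(6)]\<close>)
    then show ?thesis using prems(2) by auto
  qed
  obtain eH where eH: "eH \<in> hom C H R" "jP \<cdot> eH = iH \<cdot> jH"
    using restr[OF kP R_def[symmetric] diH(7,4) jH(1) diH(8) jH(2)] by blast
  obtain eK where eK: "eK \<in> hom C K R" "jP \<cdot> eK = iK \<cdot> jK"
    using restr[OF kP R_def[symmetric] diK(7,4) jK(1) diK(8) jK(2)] by blast
  obtain g where g: "g \<in> hom C R G" "j \<cdot> g = gB \<cdot> jP"
    using restr[OF A(2,3) gB(1) dA(1) jP(1) pr(1) jP(2)] by blast
  obtain rH where rH: "rH \<in> hom C R H" "jH \<cdot> rH = rHB \<cdot> jP"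
    using restr[OF aH(2,3) rHB(1) dH(1) jP(1) pr(2) jP(2)] by blast
  obtain rK where rK: "rK \<in> hom C R K" "jK \<cdot> rK = rKB \<cdot> jP"
    using restr[OF aK(2,3) rKB(1) dK(1) jP(1) pr(3) jP(2)] by blast
  have ge: "g \<cdot> eH = h" "g \<cdot> eK = k"
  proof -
    show "g \<cdot> eH = h"
      by (rule kernel_cancel[OF A(2), of _ H])
        (use g(1) eH h A(3) j(1) jP(1) gB(1) diH(7) jH(1) aH(5) in
          \<open>auto simp: reassoc[OF g(2)] reassoc[OF gB(2)]\<close>)
    show "g \<cdot> eK = k"
      by (rule kernel_cancel[OF A(2), of _ K])
        (use g(1) eK k A(3) j(1) jP(1) gB(1) diK(7) jK(1) aK(5) in
          \<open>auto simp: reassoc[OF g(2)] reassoc[OF gB(3)]\<close>)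
  qed
  have rHe: "rH \<cdot> eH = Id C H" "rH \<cdot> eK = zero K H"
  proof -
    show "rH \<cdot> eH = Id C H"
      by (rule kernel_cancel[OF aH(2), of _ H])
        (use rH(1) eH H aH(3) jP(1) rHB(1) diH(7) jH(1) in
          \<open>auto simp: reassoc[OF rH(2)] reassoc[OF rHB(2)]\<close>)
    show "rH \<cdot> eK = zero K H"
      by (rule kernel_cancel[OF aH(2), of _ K])
        (use rH(1) eK H K B aH(3) jP(1) rHB(1) diK(7) jH(1) jK dH dK(1) in
          \<open>auto simp: reassoc[OF rH(2)] reassoc[OF rHB(3)]\<close>)
  qed
  have rKe: "rK \<cdot> eH = zero H K" "rK \<cdot> eK = Id C K"
  proof -
    show "rK \<cdot> eH = zero H K"
      by (rule kernel_cancel[OF aK(2), of _ H])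
        (use rK(1) eH H K B aK(3) jP(1) rKB(1) diH(7) jK(1) jH dK dH(1) in
          \<open>auto simp: reassoc[OF rK(2)] reassoc[OF rKB(2)]\<close>)
    show "rK \<cdot> eK = Id C K"
      by (rule kernel_cancel[OF aK(2), of _ K])
        (use rK(1) eK K aK(3) jP(1) rKB(1) diK(7) jK(1) in
          \<open>auto simp: reassoc[OF rK(2)] reassoc[OF rKB(3)]\<close>)
  qed
  \<comment> \<open>No action on \<open>H \<times> K\<close> is constructed: equivariance is used
    for \<open>rH\<close> and \<open>rK\<close> separately.\<close>
  define r where "r = pair C rH rK"
  have r: "r \<in> hom C R (prod_obj C H K)" using rH rK by (simp add: r_def)
  define e where "e = copair C eH eK"
  have e: "e \<in> hom C (coprod_obj C H K) R" using eH eK by (simp add: e_def)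
  have gee: "g \<cdot> e = copair C h k" using g eH eK ge by (simp add: e_def comp_copair)
  have rHe': "rH \<cdot> e = copair C (Id C H) (zero K H)" and rKe': "rK \<cdot> e = copair C (zero H K) (Id C K)"
    using rH rK eH eK rHe rKe by (simp_all add: e_def comp_copair)
  have re: "r \<cdot> e = Sigma_arr C H K"
    by (rule prod_ext[of _ "coprod_obj C H K" H K]) (use r e S H K rH rK rHe' rKe' in \<open>auto simp: r_def\<close>)
  \<comment> \<open>The pushout square of the commutator, rewritten through
    \<open>g \<cdot> e = [h, k]\<close> and \<open>r \<cdot> e = Sigma_arr C H K\<close>. Cancelling
    \<open>e\<close> is possible because \<open>eH\<close> and \<open>eK\<close> are jointly
    epic.\<close>
  have eq: "q \<cdot> g \<cdot> e = m \<cdot> r \<cdot> e" using q g(1) e m r by (simp add: gee re)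
  have eqx: "q \<cdot> g \<cdot> (e \<cdot> x) = m \<cdot> r \<cdot> (e \<cdot> x)" if x: "x \<in> hom C X (coprod_obj C H K)" for x X
  proof -
    have "q \<cdot> g \<cdot> (e \<cdot> x) = q \<cdot> g \<cdot> e \<cdot> x"
      by (rule comp_assoc[symmetric]) (use q g(1) e x in auto)
    also have "\<dots> = m \<cdot> r \<cdot> e \<cdot> x" by (simp only: eq)
    also have "\<dots> = m \<cdot> r \<cdot> (e \<cdot> x)"
      by (rule comp_assoc) (use m(1) r e x in auto)
    finally show ?thesis .
  qed
  have inj: "e \<cdot> inl C H K = eH" "e \<cdot> inr C H K = eK" using eH eK by (auto simp: e_def)
  have qge: "q \<cdot> g \<cdot> eH = m \<cdot> r \<cdot> eH" "q \<cdot> g \<cdot> eK = m \<cdot> r \<cdot> eK"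
    using eqx[of "inl C H K" H] eqx[of "inr C H K" K] H K unfolding inj by auto
  have qg: "q \<cdot> g = m \<cdot> r"
    by (rule jointly_epi_kernels[OF i jse aH(2) aK(2) kP _ eH(2) _ eK(2) _ _ qge])
      (use q g(1) m(1) r eH(1) eK(1) aH(3) aK(3) in \<open>auto simp: R_def\<close>)
  obtain ze where ze: "ze \<in> hom C (bf B R) R" "jP \<cdot> ze = copair C sP jP \<cdot> kap B R"
    using conjugation_ex[of B P pP sP jP] kP diH by (auto simp: point_def R_def)
  have mono: "is_mono C j" "is_mono C jH" "is_mono C jK" using A aH aK kernel_mono by auto
  have gz: "g \<cdot> ze = xi \<cdot> bfa B g"
    by (rule kernel_map_equivariant[OF B diH(5) jP(1) ze dA(2) j(1) mono(1) xi(1) A(4) gB(1) sr(1) g])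
  have rHz: "rH \<cdot> ze = xiH \<cdot> bfa B rH"
    by (rule kernel_map_equivariant[OF B diH(5) jP(1) ze dH(2) jH(1) mono(2) xiH aH(4) rHB(1) sr(2) rH])
  have rKz: "rK \<cdot> ze = xiK \<cdot> bfa B rK"
    by (rule kernel_map_equivariant[OF B diH(5) jP(1) ze dK(2) jK(1) mono(3) xiK aK(4) rKB(1) sr(3) rK])
  have en: "e \<cdot> n \<in> hom C N R" using e nh by simp
  have Sn: "Sigma_arr C H K \<cdot> n = zero N (prod_obj C H K)" using kernelD[OF n] S(1) by (simp add: N_def)
  have ren: "rH \<cdot> (e \<cdot> n) = zero N H" "rK \<cdot> (e \<cdot> n) = zero N K"
  proof -
    have "pr1 H K \<cdot> (Sigma_arr C H K \<cdot> n) = zero N H" "pr2 H K \<cdot> (Sigma_arr C H K \<cdot> n) = zero N K"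
      using H K N by (simp_all add: Sn)
    then show "rH \<cdot> (e \<cdot> n) = zero N H" "rK \<cdot> (e \<cdot> n) = zero N K"
      using rH(1) rK(1) e nh S H K
      by (simp_all add: reassoc[OF rHe'] reassoc[OF rKe'] reassoc[OF S(2)] reassoc[OF S(3)])
  qed
  \<comment> \<open>The conjugation action of \<open>B\<close> on the kernel \<open>R\<close> of
    \<open>P\<close>, applied to \<open>N\<close>. Equivariance sends it under \<open>rH\<close> and
    \<open>rK\<close> to actions applied to zero, so \<open>r\<close> kills it.\<close>
  define x where "x = ze \<cdot> bfa B (e \<cdot> n)"
  have x: "x \<in> hom C (bf B N) R" using ze en B by (simp add: x_def)
  have "rH \<cdot> x = xiH \<cdot> bfa B (rH \<cdot> (e \<cdot> n))"
    using ze(1) rH(1) xiH en B by (simp add: x_def reassoc[OF rHz] bflat_comp[OF B en rH(1)])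
  then have rHx: "rH \<cdot> x = zero (bf B N) H" using ren xiH B N H by (simp add: bflat_zero)
  have "rK \<cdot> x = xiK \<cdot> bfa B (rK \<cdot> (e \<cdot> n))"
    using ze(1) rK(1) xiK en B by (simp add: x_def reassoc[OF rKz] bflat_comp[OF B en rK(1)])
  then have rKx: "rK \<cdot> x = zero (bf B N) K" using ren xiK B N K by (simp add: bflat_zero)
  have rx: "r \<cdot> x = zero (bf B N) (prod_obj C H K)"
    by (rule prod_ext[of _ "bf B N" H K]) (use r x rH(1) rK(1) rHx rKx H K B N in \<open>auto simp: r_def\<close>)
  have nug: "nu = g \<cdot> (e \<cdot> n)" using g(1) e nh by (simp add: nu_def reassoc[OF gee])
  define f0 where "f0 = xi \<cdot> bfa B nu"
  have f0: "f0 \<in> hom C (bf B N) G" using xi nu B by (simp add: f0_def)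
  have "f0 = g \<cdot> x"
    using g(1) ze(1) xi(1) en B R
    by (simp add: f0_def nug bflat_comp[OF B en g(1)] x_def reassoc[OF gz])
  then have qf0: "q \<cdot> f0 = zero (bf B N) Q"
    using q g(1) x r m(1) B N by (simp add: reassoc[OF qg] rx)
  \<comment> \<open>Exhibits \<open>f0\<close> as the restriction to kernels of a morphism of
    points, which is what makes its cokernel underlie one.\<close>
  define f where "f = copair C s (j \<cdot> nu)"
  have f: "f \<in> hom C (coprod_obj C B N) A" using j nu dA by (simp add: f_def)
  have fm: "point_map B (coprod_obj C B N, copair C (Id C B) (zero N B), inl C B N) f (A, p, s)"
    unfolding point_map_iff using plus_point[OF B N] A(1) f dA j nu B N
    by (simp add: f_def comp_copair reassoc[OF j(2)])
  have jf0: "j \<cdot> f0 = f \<cdot> kap B N"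
    using copair_bflat[OF B nu dA(2) j(1)] j(1) xi(1) nu B G dA
    by (simp add: f0_def f_def reassoc[OF A(4)])
  have f0': "f0 \<in> hom C (bf B N) (Dom C j)" using f0 A(3) by simp
  obtain a p' s' k' q0 where a: "point_map B (A, p, s) a (Cod C a, p', s')"
    "is_kernel C p' k'" "q0 \<in> hom C (Dom C j) (Dom C k')" "k' \<cdot> q0 = a \<cdot> j" "is_cokernel C f0 q0"
    by (rule cokernel_kernels[OF fm kap_kernel[OF B N] A(2) f0' jf0])
  note da = point_mapD[OF a(1)] and dk' = kernelD[OF a(2)] and dq0 = cokernelD[OF a(5)]
  have q0: "q0 \<in> hom C G (Dom C k')" using a(3) A(3) by simp
  have oq: "Dom C k' \<in> Obj C" using hom_Obj[OF q0] by simp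
  \<comment> \<open>The unit law recovers \<open>nu\<close> from \<open>f0\<close>, so
    \<open>q0\<close> kills \<open>nu\<close>; \<open>q\<close> was shown to kill \<open>f0\<close>.
    Hence \<open>q\<close> and \<open>q0\<close> factor through each other.\<close>
  have "f0 \<cdot> bflat_unit C B N = nu"
    using xi(1) nu B N G by (simp add: f0_def bflat_unit_natural[OF B nu] reassoc[OF xi(2)])
  then have "q0 \<cdot> nu = q0 \<cdot> (f0 \<cdot> bflat_unit C B N)" by simp
  also have "\<dots> = zero N (Dom C k')" using f0 q0 dq0(4) B N oq by (simp add: reassoc[OF dq0(4)])
  finally have q0nu: "q0 \<cdot> nu = zero N (Dom C k')" .
  obtain t where t: "t \<in> hom C Q (Dom C k')" "t \<cdot> q = q0"
    by (rule cokernel_desc[OF qc, of q0 "Dom C k'"]) (use q0 nu q0nu in \<open>auto simp: Q_def\<close>)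
  obtain t' where t': "t' \<in> hom C (Dom C k') Q" "t' \<cdot> q0 = q"
    by (rule cokernel_desc[OF a(5), of q Q]) (use q f0 qf0 q0 in auto)
  define L where "L = Dom C l"
  have lh: "l \<in> hom C L G" "q \<cdot> l = zero L Q" using kernelD[OF l] q by (auto simp: L_def Q_def)
  have L: "L \<in> Obj C" using hom_Obj[OF lh(1)] by simp
  have "t \<cdot> (q \<cdot> l) = zero L (Dom C k')" using t L by (simp add: lh(2))
  then have q0l: "q0 \<cdot> l = zero L (Dom C k')" using t q lh(1) by (simp add: reassoc[OF t(2)])
  have ajl: "a \<cdot> (j \<cdot> l) = zero L (Cod C a)"
  proof -
    have "k' \<cdot> (q0 \<cdot> l) = zero L (Cod C a)" using dk' da L by (simp add: q0l)
    then show ?thesis using dk'(2) q0 lh(1) da j(1) by (simp add: reassoc[OF a(4)])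
  qed
  \<comment> \<open>In \<open>A\<close> the action is conjugation, and \<open>a\<close> preserves
    sections and kills \<open>j \<cdot> l\<close>. Thus \<open>a\<close> sends
    \<open>[s, j \<cdot> l]\<close> to \<open>[s', 0]\<close>, which vanishes on
    \<open>kap\<close>.\<close>
  have "k' \<cdot> (q0 \<cdot> (xi \<cdot> bfa B l)) = a \<cdot> (j \<cdot> (xi \<cdot> bfa B l))"
    using dk'(2) q0 xi(1) lh(1) B da j(1) by (simp add: reassoc[OF a(4)])
  also have "j \<cdot> (xi \<cdot> bfa B l) = copair C s (j \<cdot> l) \<cdot> kap B L"
    using copair_bflat[OF B lh(1) dA(2) j(1)] j(1) xi(1) lh(1) B G dA by (simp add: reassoc[OF A(4)])
  also have "a \<cdot> \<dots> = copair C s' (zero L (Cod C a)) \<cdot> kap B L"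
  proof -
    have "a \<cdot> copair C s (j \<cdot> l) = copair C s' (zero L (Cod C a))"
      using da dA j(1) lh(1) ajl by (simp add: comp_copair)
    from reassoc[OF this, of "kap B L"] show ?thesis using da dA j(1) lh(1) B L by simp
  qed
  also have "\<dots> = k' \<cdot> zero (bf B L) (Dom C k')"
    using copair_zero_kap[OF B L da(5)] dk' da(4) B L oq by simp
  finally have "k' \<cdot> (q0 \<cdot> (xi \<cdot> bfa B l)) = k' \<cdot> zero (bf B L) (Dom C k')" .
  then have z: "q0 \<cdot> (xi \<cdot> bfa B l) = zero (bf B L) (Dom C k')"
    by (rule kernel_cancel[OF a(2), rotated 2]) (use q0 xi lh(1) B L oq in auto)
  have "t' \<cdot> (q0 \<cdot> (xi \<cdot> bfa B l)) = zero (bf B L) Q" using t' B L by (simp add: z)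
  then have "q \<cdot> (xi \<cdot> bfa B l) = zero (bf B L) (Cod C q)"
    using t'(1) q0 xi(1) lh(1) B by (simp add: reassoc[OF t'(2)] Q_def)
  then obtain xi' where "xi' \<in> hom C (bf B L) (Dom C l)" "l \<cdot> xi' = xi \<cdot> bfa B l"
    by (rule kernel_lift[OF l, rotated]) (use q xi lh(1) B in auto)
  then show thesis using that by (simp add: L_def)
qed

end

theorem proposition4p1:
  fixes C :: "('o, 'a) cat" and G :: 'o and h k :: 'a
  assumes "semi_abelian C"
    and "\<And>B. B \<in> Obj C \<Longrightarrow>
           preserves_jointly_strongly_epi_pairs (Pt C B) C (Ker_fun C B)"
    and "\<And>B. B \<in> Obj C \<Longrightarrow> preserves_cokernels (Pt C B) C (Ker_fun C B)"
    and "G \<in> Obj C"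
    and "characteristic C G h"
    and "characteristic C G k"
  shows "(\<exists>l. is_huq_commutator C G h k l) \<and>
         (\<forall>l. is_huq_commutator C G h k l \<longrightarrow> characteristic C G l)"
proof -
  interpret category C using assms(1) by (simp add: semi_abelian_def)
  interpret kernel_preserving_category C by unfold_locales (fact assms(1-3))+
  have sub: "is_subobject C G h" "is_subobject C G k"
    using assms(5,6) by (auto simp: characteristic_def)
  define H K where "H = Dom C h" and "K = Dom C k"
  have h: "h \<in> hom C H G" and k: "k \<in> hom C K G"
    using sub by (auto simp: is_subobject_def is_mono_def H_def K_def)
  have o: "H \<in> Obj C" "K \<in> Obj C" using hom_Obj h k by blast+
  note S = Sigma_simps(1)[OF o]
  show ?thesis
  proof (intro conjI allI impI)
    \<comment> \<open>Pushouts are not among the axioms; the one needed is obtained from the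
      cokernel of \<open>[h, k]\<close> restricted to the kernel of the canonical arrow.\<close>
    have n: "is_kernel C (Sigma_arr C H K) (ker C (Sigma_arr C H K))" using S ker by simp
    obtain q where q: "is_cokernel C (copair C h k \<cdot>\<^bsub>C\<^esub> ker C (Sigma_arr C H K)) q"
      by (rule cokernel_ex[of "copair C h k \<cdot>\<^bsub>C\<^esub> ker C (Sigma_arr C H K)"]) (use h k S in auto)
    obtain m where "is_pushout C (copair C h k) (Sigma_arr C H K) q m"
      using pushout_Sigma_cokernel(2)[OF h k n q] by blast
    moreover have "is_kernel C q (ker C q)" using cokernelD[OF q] ker by simp
    ultimately show "\<exists>l. is_huq_commutator C G h k l"
      using sub unfolding is_huq_commutator_def H_def K_def by blast
  next
    fix l assume "is_huq_commutator C G h k l"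
    then obtain q m where po: "is_pushout C (copair C h k) (Sigma_arr C H K) q m" and l: "is_kernel C q l"
      unfolding is_huq_commutator_def H_def K_def by blast
    have lh: "l \<in> hom C (Dom C l) G" and lm: "is_mono C l"
      using kernelD[OF l] kernel_mono[OF l] po h k by (auto simp: is_pushout_def)
    have "\<exists>!xi'. is_action C B (Dom C l) xi' \<and> l \<cdot>\<^bsub>C\<^esub> xi' = xi \<cdot>\<^bsub>C\<^esub> bfa B l"
      if B: "B \<in> Obj C" and act: "is_action C B G xi" for B xi
    proof -
      obtain xiH where xiH: "is_action C B H xiH" "h \<cdot>\<^bsub>C\<^esub> xiH = xi \<cdot>\<^bsub>C\<^esub> bfa B h"
        using assms(5) B act unfolding characteristic_def H_def by blast
      obtain xiK where xiK: "is_action C B K xiK" "k \<cdot>\<^bsub>C\<^esub> xiK = xi \<cdot>\<^bsub>C\<^esub> bfa B k"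
        using assms(6) B act unfolding characteristic_def K_def by blast
      obtain xi' where xi': "xi' \<in> hom C (bf B (Dom C l)) (Dom C l)" "l \<cdot>\<^bsub>C\<^esub> xi' = xi \<cdot>\<^bsub>C\<^esub> bfa B l"
        by (rule huq_stable[OF B act h k xiH xiK po l])
      show ?thesis
      proof (rule ex1I[of _ xi'])
        show "is_action C B (Dom C l) xi' \<and> l \<cdot>\<^bsub>C\<^esub> xi' = xi \<cdot>\<^bsub>C\<^esub> bfa B l"
          using action_restrict[OF B act lm lh xi'] xi' by blast
        fix y assume "is_action C B (Dom C l) y \<and> l \<cdot>\<^bsub>C\<^esub> y = xi \<cdot>\<^bsub>C\<^esub> bfa B l"
        then show "y = xi'"
          using is_monoD[OF lm, of y "bf B (Dom C l)" xi'] xi' by (simp add: is_action_def)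
      qed
    qed
    then show "characteristic C G l"
      using lh lm by (simp add: characteristic_def is_subobject_def)
  qed
qed

end
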